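(* Let $k$ be a field of characteristic zero and $m,n\ge 2$ integers. (a) If $m>n^2$, then $\mathrm{UD}(m,n)^{\mathrm{SL}_m}=\mathrm{UD}(m,n)^{\mathrm{GL}_m}=k$. Now let $m=n^2$, and denote by $\Delta$ the discriminant of the generic matrices $X_1,\dots,X_m$. Then: (b) $\mathrm{UD}(m,n)^{\mathrm{GL}_m}=k$. (c) $(T_{m,n})^{\mathrm{SL}_m}=k[\Delta]$. (d) $\mathrm{UD}(m,n)^{\mathrm{SL}_m}=k(\Delta)$.
   Context: $G_{m,n}$ is the $k$-subalgebra of $\mathrm{M}_n(k[x_{ij}^{(h)}])$ generated by the generic matrices $X_h=(x_{ij}^{(h)})$, $h=1,\dots,m$, where the $x_{ij}^{(h)}$ are $mn^2$ independent commuting variables. The trace ring $T_{m,n}$ is the subring of $\mathrm{M}_n(k[x_{ij}^{(h)}])$ generated by all $Y$ and $\operatorname{tr}(Y)$ with $Y\in G_{m,n}$ (scalars are identified with scalar matrices). $\mathrm{UD}(m,n)$ is the common division algebra of quotients of $G_{m,n}$ and $T_{m,n}$. The group $\mathrm{GL}_m$ acts on $G_{m,n}$ by $k$-algebra automorphisms via $g=(g_{ij})\colon X_j\mapsto\sum_{i=1}^m g_{ij}X_i$; this extends naturally to $T_{m,n}$ and $\mathrm{UD}(m,n)$. The discriminant $\Delta(A_1,\dots,A_{n^2})$ of $n^2$ matrices of size $n\times n$ is the determinant of the $n^2\times n^2$-matrix whose $i$-th row consists of the entries of $A_i$ (in the order $11,12,\dots,nn$); equivalently, it is the unique multilinear alternating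 function with $\Delta(e_{11},e_{12},\dots,e_{nn})=1$, where the $e_{ij}$ are the matrix units. *)

theory Defs
  imports
    "HOL-Library.Poly_Mapping"
    "HOL-Library.Product_Lexorder"
    "HOL-Computational_Algebra.Fraction_Field"
    "HOL-Algebra.Generated_Fields"
    "Jordan_Normal_Form.VS_Connect"
begin

text \<open>
  Polynomials over \<open>'k\<close> in commuting variables indexed by triples of natural numbers; the
  variable with index \<open>(h, i, j)\<close> is the \<open>(i, j)\<close> entry of the \<open>h\<close>-th generic matrix.  All
  indices count from \<open>0\<close>.  For given \<open>m\<close> and \<open>n\<close> only the variables with \<open>h < m\<close> and \<open>i, j < n\<close>
  are used, the remaining ones do not occur in the algebras below.
  The type \<open>'k ratfun\<close> is the field of fractions.  All algebras are realised inside the matrix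
  ring over this field, which contains the matrix ring over the polynomials.
\<close>

type_synonym 'k mpoly = "((nat \<times> nat \<times> nat) \<Rightarrow>\<^sub>0 nat) \<Rightarrow>\<^sub>0 'k"
type_synonym 'k ratfun = "'k mpoly fract"

definition var :: "nat \<times> nat \<times> nat \<Rightarrow> 'k::field mpoly" where
  "var v = Poly_Mapping.single (Poly_Mapping.single v 1) 1"

definition const :: "'k::field \<Rightarrow> 'k mpoly" where
  "const c = Poly_Mapping.single 0 c"

definition emb :: "'k::field mpoly \<Rightarrow> 'k ratfun" where
  "emb p = Fract p 1"

definition subst :: "(nat \<times> nat \<times> nat \<Rightarrow> 'k::field mpoly) \<Rightarrow> 'k mpoly \<Rightarrow> 'k mpoly" where
  "subst \<sigma> p =
     (\<Sum>t \<in> Poly_Mapping.keys p. const (Poly_Mapping.lookup p t) *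
        (\<Prod>v \<in> Poly_Mapping.keys t. \<sigma> v ^ Poly_Mapping.lookup t v))"

text \<open>
  The extension of an injective ring endomorphism to the field of fractions.  The value does not
  depend on the chosen representative, see \<open>frac_ext_Fract\<close>.
\<close>

definition frac_ext :: "('a::idom \<Rightarrow> 'a) \<Rightarrow> 'a fract \<Rightarrow> 'a fract" where
  "frac_ext f q = (let r = (SOME r. snd r \<noteq> 0 \<and> q = Fract (fst r) (snd r))
                   in Fract (f (fst r)) (f (snd r)))"


lemma frac_ext_Fract:
  assumes add: "\<And>x y. f (x + y) = f x + f y" and mult: "\<And>x y. f (x * y) = f x * f y"
    and inj: "inj f" and b: "b \<noteq> 0"
  shows "frac_ext f (Fract a b) = Fract (f a) (f b)"
proof -
  have f0: "f 0 = 0"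
    using add[of 0 0] by (metis add.right_neutral add_left_cancel)
  have nz: "f x \<noteq> 0" if "x \<noteq> 0" for x
    using inj that f0 by (metis injD)
  define r where "r = (SOME r. snd r \<noteq> 0 \<and> Fract a b = Fract (fst r) (snd r))"
  have "snd r \<noteq> 0 \<and> Fract a b = Fract (fst r) (snd r)"
    unfolding r_def by (rule someI[of _ "(a, b)"]) (simp add: b)
  hence r: "snd r \<noteq> 0" and eq: "Fract a b = Fract (fst r) (snd r)"
    by blast+
  from eq have "a * snd r = fst r * b"
    using eq_fract(1)[OF b r] by blast
  hence "f a * f (snd r) = f (fst r) * f b"
    by (metis mult)
  hence "Fract (f (fst r)) (f (snd r)) = Fract (f a) (f b)"
    using nz[OF r] nz[OF b] by (simp add: eq_fract)
  thus ?thesis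
    by (simp add: frac_ext_def r_def[symmetric] Let_def)
qed

lemma const_mult: "const (c * d) = const c * const d"
  by (simp add: const_def mult_single)

lemma const_sum: "const (sum f A) = (\<Sum>a \<in> A. const (f a))"
  by (induction A rule: infinite_finite_induct) (simp_all add: const_def single_add)

lemma emb_mult: "emb (p * q) = emb p * emb q"
  by (simp add: emb_def)

lemma emb_add: "emb (p + q) = emb p + emb q"
  by (simp add: emb_def)

lemma emb_zero: "emb 0 = 0"
  by (simp add: emb_def Zero_fract_def)

lemma emb_sum: "emb (sum f A) = (\<Sum>a \<in> A. emb (f a))"
  by (induction A rule: infinite_finite_induct) (simp_all add: emb_add emb_zero)

context
  fixes \<sigma> :: "nat \<times> nat \<times> nat \<Rightarrow> 'k::field mpoly"
begin

private definition ev where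
  "ev t = (\<Prod>v \<in> Poly_Mapping.keys t. \<sigma> v ^ Poly_Mapping.lookup t v)"

private lemma ev_superset:
  "finite K \<Longrightarrow> Poly_Mapping.keys t \<subseteq> K \<Longrightarrow> ev t = (\<Prod>v \<in> K. \<sigma> v ^ Poly_Mapping.lookup t v)"
  unfolding ev_def by (rule prod.mono_neutral_left) (auto simp: in_keys_iff)

private lemma ev_add: "ev (s + t) = ev s * ev t"
proof -
  let ?K = "Poly_Mapping.keys s \<union> Poly_Mapping.keys t"
  have "ev (s + t) = (\<Prod>v \<in> ?K. \<sigma> v ^ Poly_Mapping.lookup (s + t) v)"
    by (rule ev_superset) (auto dest!: subsetD[OF Poly_Mapping.keys_add])
  also have "\<dots> = (\<Prod>v \<in> ?K. \<sigma> v ^ Poly_Mapping.lookup s v) * (\<Prod>v \<in> ?K. \<sigma> v ^ Poly_Mapping.lookup t v)"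
    by (simp add: lookup_add power_add prod.distrib)
  also have "\<dots> = ev s * ev t"
    by (subst (1 2) ev_superset[of ?K]) auto
  finally show ?thesis .
qed

private lemma subst_superset:
  assumes "finite K" "Poly_Mapping.keys p \<subseteq> K"
  shows "subst \<sigma> p = (\<Sum>t \<in> K. const (Poly_Mapping.lookup p t) * ev t)"
  unfolding subst_def ev_def[symmetric]
  by (rule sum.mono_neutral_left) (use assms in \<open>auto simp: in_keys_iff const_def\<close>)

lemma subst_add: "subst \<sigma> (p + q) = subst \<sigma> p + subst \<sigma> q"
proof -
  let ?K = "Poly_Mapping.keys p \<union> Poly_Mapping.keys q"
  have "subst \<sigma> (p + q) = (\<Sum>t \<in> ?K. const (Poly_Mapping.lookup (p + q) t) * ev t)"
    by (rule subst_superset) (auto dest!: subsetD[OF Poly_Mapping.keys_add])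
  also have "\<dots> = (\<Sum>t \<in> ?K. const (Poly_Mapping.lookup p t) * ev t) + (\<Sum>t \<in> ?K. const (Poly_Mapping.lookup q t) * ev t)"
    by (simp add: lookup_add const_def single_add distrib_right sum.distrib)
  also have "\<dots> = subst \<sigma> p + subst \<sigma> q"
    by (subst (1 2) subst_superset[of ?K]) auto
  finally show ?thesis .
qed

private lemma subst_single: "subst \<sigma> (Poly_Mapping.single t c) = const c * ev t"
  by (subst subst_superset[of "{t}"]) auto

lemma subst_0 [simp]: "subst \<sigma> 0 = 0"
  by (simp add: subst_def)

private lemma mpoly_induct:
  assumes "P 0" "\<And>p t c. P p \<Longrightarrow> P (Poly_Mapping.single t c + p)"
  shows "P (p :: 'k mpoly)"
proof (induction "card (Poly_Mapping.keys p)" arbitrary: p)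
  case 0
  thus ?case using assms(1) by simp
next
  case (Suc k)
  then obtain t where t: "t \<in> Poly_Mapping.keys p"
    by (metis card.empty ex_in_conv nat.distinct(1))
  define q where "q = p - Poly_Mapping.single t (Poly_Mapping.lookup p t)"
  have "Poly_Mapping.keys q = Poly_Mapping.keys p - {t}"
    by (auto simp: q_def in_keys_iff lookup_minus lookup_single when_def split: if_splits)
  hence "k = card (Poly_Mapping.keys q)"
    using t Suc.hyps(2) by simp
  hence "P q" by (rule Suc.hyps(1))
  from assms(2)[OF this, of t "Poly_Mapping.lookup p t"] show ?case
    by (simp add: q_def)
qed

lemma subst_mult: "subst \<sigma> (p * q) = subst \<sigma> p * subst \<sigma> q"
proof (induction p rule: mpoly_induct)
  case 1
  show ?case by simp
next
  case (2 p t c)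
  have "subst \<sigma> (Poly_Mapping.single t c * q) = subst \<sigma> (Poly_Mapping.single t c) * subst \<sigma> q"
  proof (induction q rule: mpoly_induct)
    case 1
    show ?case by simp
  next
    case (2 q s d)
    thus ?case
      by (simp add: subst_add distrib_left mult_single subst_single ev_add const_mult)
  qed
  with 2 show ?case
    by (simp add: subst_add distrib_right)
qed

lemma subst_var: "subst \<sigma> (var v) = \<sigma> v"
  by (simp add: var_def subst_single ev_def const_def single_one)

lemma subst_const: "subst \<sigma> (const c) = const c"
  using subst_single[of 0 c] by (simp add: const_def ev_def)

lemma subst_sum: "subst \<sigma> (sum f A) = (\<Sum>a \<in> A. subst \<sigma> (f a))"
  by (induction A rule: infinite_finite_induct) (simp_all add: subst_add)

lemma subst_prod: "subst \<sigma> (prod f A) = (\<Prod>a \<in> A. subst \<sigma> (f a))"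
proof -
  have "subst \<sigma> 1 = 1"
    using subst_const[of 1] by (simp add: const_def)
  thus ?thesis
    by (induction A rule: infinite_finite_induct) (simp_all add: subst_mult)
qed

lemma subst_power: "subst \<sigma> (p ^ k) = subst \<sigma> p ^ k"
  using subst_prod[of "\<lambda>_. p" "{..<k}"] by simp

end

lemma subst_subst: "subst \<tau> (subst \<sigma> p) = subst (\<lambda>v. subst \<tau> (\<sigma> v)) p"
  by (simp add: subst_def[of \<sigma>] subst_def[of "\<lambda>v. subst \<tau> (\<sigma> v)"]
        subst_sum subst_mult subst_prod subst_power subst_const)

lemma subst_id: "subst var p = p"
proof -
  have pw: "(var v :: 'a mpoly) ^ k = Poly_Mapping.single (Poly_Mapping.single v k) 1" for v k
    by (induction k) (simp_all add: var_def mult_single single_add[symmetric])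
  have pr: "(\<Prod>v \<in> A. Poly_Mapping.single (g v) (1 :: 'a)) = Poly_Mapping.single (sum g A) 1"
    if "finite A" for A :: "(nat \<times> nat \<times> nat) set" and g :: "_ \<Rightarrow> (nat \<times> nat \<times> nat) \<Rightarrow>\<^sub>0 nat"
    using that by induction (simp_all add: mult_single)
  have id: "(\<Sum>t \<in> Poly_Mapping.keys q. Poly_Mapping.single t (Poly_Mapping.lookup q t)) = q"
    for q :: "'b \<Rightarrow>\<^sub>0 'c::comm_monoid_add"
    by (rule poly_mapping_eqI)
       (simp add: lookup_sum lookup_single when_def in_keys_iff sum.delta)
  show ?thesis
    by (simp add: subst_def pw pr id const_def mult_single)
qed

definition generic :: "nat \<Rightarrow> nat \<Rightarrow> 'k::field ratfun mat" where
  "generic n h = mat n n (\<lambda>(i, j). emb (var (h, i, j)))"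

definition scalar :: "nat \<Rightarrow> 'a::comm_ring_1 \<Rightarrow> 'a mat" where
  "scalar n a = a \<cdot>\<^sub>m 1\<^sub>m n"

definition base_field :: "nat \<Rightarrow> 'k::field ratfun mat set" where
  "base_field n = range (\<lambda>c. scalar n (emb (const c)))"

definition subring_gen :: "nat \<Rightarrow> 'a::comm_ring_1 mat set \<Rightarrow> 'a mat set" where
  "subring_gen n S = generate_ring (ring_mat TYPE('a) n ()) S"

definition subalg_gen :: "nat \<Rightarrow> 'k::field ratfun mat set \<Rightarrow> 'k ratfun mat set" where
  "subalg_gen n S = subring_gen n (base_field n \<union> S)"

definition generic_alg :: "nat \<Rightarrow> nat \<Rightarrow> 'k::field ratfun mat set" where
  "generic_alg m n = subalg_gen n (generic n ` {..<m})"

definition mat_tr :: "'a::comm_monoid_add mat \<Rightarrow> 'a" where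
  "mat_tr A = (\<Sum>i < dim_row A. A $$ (i, i))"

definition trace_ring :: "nat \<Rightarrow> nat \<Rightarrow> 'k::field ratfun mat set" where
  "trace_ring m n =
     subring_gen n (generic_alg m n \<union> (\<lambda>Y. scalar n (mat_tr Y)) ` generic_alg m n)"

text \<open>
  The generic matrix algebra and the trace ring have the same division algebra of quotients.  It
  is taken here as the set of all fractions \<open>A B\<^sup>-\<^sup>1\<close> with \<open>A\<close> and \<open>B\<close> in the trace ring, where
  \<open>C = B\<^sup>-\<^sup>1\<close> is formed in the matrix ring over the field of rational functions.  (Every nonzero
  element of the trace ring is invertible there, by a theorem of Amitsur.)
\<close>

definition UD :: "nat \<Rightarrow> nat \<Rightarrow> 'k::field ratfun mat set" where
  "UD m n = {A * C | A B C. A \<in> trace_ring m n \<and> B \<in> trace_ring m n \<and> B \<noteq> 0\<^sub>m n n \<and>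
     C \<in> carrier_mat n n \<and> B * C = 1\<^sub>m n \<and> C * B = 1\<^sub>m n}"


definition GL :: "nat \<Rightarrow> 'k::field mat set" where
  "GL m = {g \<in> carrier_mat m m. invertible_mat g}"

definition SL :: "nat \<Rightarrow> 'k::field mat set" where
  "SL m = {g \<in> carrier_mat m m. det g = 1}"

text \<open>
  A matrix \<open>g\<close> of size \<open>m\<close> sends the variable \<open>(j, a, b)\<close> to the sum of the
  \<open>g\<^sub>i\<^sub>j\<close> times \<open>(i, a, b)\<close> over all \<open>i < m\<close>, and fixes the variables that do not belong to the
  first \<open>m\<close> generic matrices.  Extended to rational functions and applied to each entry of a matrix,
  this is a ring automorphism with the prescribed effect on the generic matrices
  (\<open>act_generic\<close>) which commutes with traces; its restrictions are the actions on the generic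
  matrix algebra, the trace ring and the division algebra.
\<close>

definition lin_subst :: "'k::field mat \<Rightarrow> nat \<times> nat \<times> nat \<Rightarrow> 'k mpoly" where
  "lin_subst g = (\<lambda>(j, a, b).
     if j < dim_row g then \<Sum>i < dim_row g. const (g $$ (i, j)) * var (i, a, b)
     else var (j, a, b))"

definition act :: "'k::field mat \<Rightarrow> 'k ratfun mat \<Rightarrow> 'k ratfun mat" where
  "act g = map_mat (frac_ext (subst (lin_subst g)))"

lemma subst_lin_subst_inverse:
  assumes "g \<in> carrier_mat m m" "h \<in> carrier_mat m m" "h * g = 1\<^sub>m m"
  shows "subst (lin_subst h) (subst (lin_subst g) p) = p"
proof -
  have "subst (lin_subst h) (lin_subst g v) = var v" for v
  proof (cases v)
    case (fields j a b)
    show ?thesis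
    proof (cases "j < m")
      case False
      thus ?thesis
        using assms by (simp add: fields lin_subst_def subst_var)
    next
      case j: True
      have "subst (lin_subst h) (lin_subst g v) =
          (\<Sum>i<m. const (g $$ (i, j)) * (\<Sum>l<m. const (h $$ (l, i)) * var (l, a, b)))"
        using assms j by (simp add: fields lin_subst_def subst_sum subst_mult subst_const subst_var)
      also have "\<dots> = (\<Sum>i<m. \<Sum>l<m. const (h $$ (l, i) * g $$ (i, j)) * var (l, a, b))"
        by (simp add: sum_distrib_left const_mult mult_ac)
      also have "\<dots> = (\<Sum>l<m. \<Sum>i<m. const (h $$ (l, i) * g $$ (i, j)) * var (l, a, b))"
        by (rule sum.swap)
      also have "\<dots> = (\<Sum>l<m. const ((h * g) $$ (l, j)) * var (l, a, b))"
      proof (rule sum.cong[OF refl])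
        fix l assume l: "l \<in> {..<m}"
        have "(h * g) $$ (l, j) = (\<Sum>i<m. h $$ (l, i) * g $$ (i, j))"
          using assms(1,2) j l by (simp add: scalar_prod_def lessThan_atLeast0)
        thus "(\<Sum>i<m. const (h $$ (l, i) * g $$ (i, j)) * var (l, a, b)) =
            const ((h * g) $$ (l, j)) * var (l, a, b)"
          by (simp add: sum_distrib_right const_sum)
      qed
      also have "\<dots> = (\<Sum>l<m. if l = j then var (l, a, b) else 0)"
        using j by (intro sum.cong) (auto simp: assms(3) const_def)
      also have "\<dots> = var v"
        using j by (simp add: fields)
      finally show ?thesis .
    qed
  qed
  hence "(\<lambda>v. subst (lin_subst h) (lin_subst g v)) = var"
    by (rule ext)
  thus ?thesis
    by (simp add: subst_subst subst_id)
qed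

lemma SL_subset_GL: "SL m \<subseteq> GL m"
proof
  fix g :: "'a mat" assume "g \<in> SL m"
  hence g: "g \<in> carrier_mat m m" and "det g \<noteq> 0"
    by (auto simp: SL_def)
  hence "g \<in> Units (ring_mat TYPE('a) m ())"
    by (rule det_non_zero_imp_unit)
  then obtain h where "h \<in> carrier_mat m m" "h * g = 1\<^sub>m m" "g * h = 1\<^sub>m m"
    by (auto simp: Units_def ring_mat_simps)
  with g show "g \<in> GL m"
    by (auto simp: GL_def invertible_mat_def inverts_mat_def)
qed

lemma GL_obtain_inverse:
  assumes "g \<in> GL m"
  obtains h where "h \<in> carrier_mat m m" "g * h = 1\<^sub>m m" "h * g = 1\<^sub>m m"
proof -
  from assms obtain h where g: "g \<in> carrier_mat m m" and h: "g * h = 1\<^sub>m m" "h * g = 1\<^sub>m (dim_row h)"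
    by (auto simp: GL_def invertible_mat_def inverts_mat_def)
  have "dim_col h = m"
    using arg_cong[OF h(1), of dim_col] by simp
  moreover have "dim_row h = m"
    using arg_cong[OF h(2), of dim_col] g by simp
  ultimately show ?thesis
    using that h by auto
qed

lemma inj_subst_lin_subst: "g \<in> GL m \<Longrightarrow> inj (subst (lin_subst g))"
proof -
  assume g: "g \<in> GL m"
  then obtain h where "h \<in> carrier_mat m m" "h * g = 1\<^sub>m m"
    by (rule GL_obtain_inverse)
  with g show ?thesis
    by (intro inj_on_inverseI[of _ "subst (lin_subst h)"] subst_lin_subst_inverse)
       (simp_all add: GL_def)
qed

lemma frac_ext_subst:
  assumes "g \<in> GL m" "q \<noteq> 0"
  shows "frac_ext (subst (lin_subst g)) (Fract p q) =
           Fract (subst (lin_subst g) p) (subst (lin_subst g) q)"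
  using assms by (intro frac_ext_Fract subst_add subst_mult inj_subst_lin_subst)

lemma frac_ext_emb:
  assumes "g \<in> GL m"
  shows "frac_ext (subst (lin_subst g)) (emb p) = emb (subst (lin_subst g) p)"
proof -
  have "subst (lin_subst g) 1 = 1"
    using subst_const[of "lin_subst g" 1] by (simp add: const_def)
  thus ?thesis
    by (simp add: emb_def frac_ext_subst[OF assms])
qed

lemma act_generic:
  assumes "g \<in> GL m" "j < m"
  shows "act g (generic n j) =
    mat n n (\<lambda>(a, b). \<Sum>i<m. emb (const (g $$ (i, j))) * generic n i $$ (a, b))"
proof (rule eq_matI)
  fix a b assume ab: "a < dim_row (mat n n (\<lambda>(a, b). \<Sum>i<m. emb (const (g $$ (i, j))) * generic n i $$ (a, b)))"
    "b < dim_col (mat n n (\<lambda>(a, b). \<Sum>i<m. emb (const (g $$ (i, j))) * generic n i $$ (a, b)))"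
  have "dim_row g = m"
    using assms(1) by (auto simp: GL_def)
  thus "act g (generic n j) $$ (a, b) =
      mat n n (\<lambda>(a, b). \<Sum>i<m. emb (const (g $$ (i, j))) * generic n i $$ (a, b)) $$ (a, b)"
    using ab assms
    by (simp add: act_def generic_def frac_ext_emb[OF assms(1)] subst_var)
       (simp add: lin_subst_def emb_sum emb_mult)
qed (simp_all add: act_def generic_def)


definition invariants :: "'k::field mat set \<Rightarrow> 'k ratfun mat set \<Rightarrow> 'k ratfun mat set" where
  "invariants H R = {Y \<in> R. \<forall>g \<in> H. act g Y = Y}"


text \<open>The pair \<open>(i, j)\<close> of matrix indices is placed in column \<open>n i + j\<close>.\<close>

definition discriminant :: "nat \<Rightarrow> (nat \<Rightarrow> 'a::comm_ring_1 mat) \<Rightarrow> 'a" where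
  "discriminant n A = det (mat (n\<^sup>2) (n\<^sup>2) (\<lambda>(r, c). A r $$ (c div n, c mod n)))"

definition Delta :: "nat \<Rightarrow> 'k::field ratfun" where
  "Delta n = discriminant n (generic n)"

definition poly_in :: "nat \<Rightarrow> 'k::field ratfun \<Rightarrow> 'k ratfun mat set" where
  "poly_in n d = subalg_gen n {scalar n d}"

definition ratfun_in :: "nat \<Rightarrow> 'k::field ratfun \<Rightarrow> 'k ratfun mat set" where
  "ratfun_in n d = scalar n ` generate_field class_ring (range (\<lambda>c. emb (const c)) \<union> {d})"

end

theory Submission
  imports Defs
begin

text \<open>
  Over the infinite field \<open>k\<close> a polynomial is determined by its values at points, that is, at \<open>m\<close>-tuples
  of constant matrices, and a rational matrix is handled through a numerator matrix \<open>R\<close> and a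
  scalar denominator \<open>q\<close>.  An element \<open>Y = R / q\<close> of the division algebra has two features.  It
  commutes with simultaneous conjugation, \<open>Y (u X u\<^sup>-\<^sup>1) = u Y (X) u\<^sup>-\<^sup>1\<close>, because this is true for the
  generic matrices and their traces (\<open>trace_ring_concomitants\<close>, \<open>UD_fraction_rep\<close>).  If moreover \<open>Y\<close> is
  invariant under a group \<open>H\<close>, its values agree along \<open>H\<close>-orbits of points (\<open>invariant_fraction_rep\<close>).

  The coordinates of a point form a matrix with one row for each of the \<open>m\<close> matrices, and the group acts by
  left multiplication.  The discriminant \<open>\<delta>\<close> is the determinant of the first \<open>n\<^sup>2\<close> rows.  Two points with
  nonzero \<open>\<delta>\<close> lie in one \<open>GL\<close>-orbit, and they lie in one \<open>SL\<close>-orbit if \<open>m > n\<^sup>2\<close>, or if \<open>m = n\<^sup>2\<close> and \<open>\<delta>\<close> agrees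
  (\<open>point_transport\<close>).  Conjugation preserves \<open>\<delta>\<close> (\<open>discriminant_conjugate\<close>).  Hence a point with
  \<open>\<delta> \<noteq> 0\<close> and its conjugates lie in one \<open>SL\<close>-orbit, the value of an invariant \<open>Y\<close> there commutes with every invertible
  matrix, and \<open>Y\<close> is a scalar \<open>p / q\<close> (\<open>invariant_is_scalar\<close>).  If \<open>H\<close> is transitive on the points with
  \<open>\<delta> \<noteq> 0\<close>, this rational function is constant.  For \<open>SL\<close> and \<open>m = n\<^sup>2\<close> it depends on \<open>\<delta>\<close> only;
  restricting it to a line on which \<open>\<delta>\<close> is the coordinate shows that it is a rational function of
  \<open>\<Delta>\<close>, and a polynomial in \<open>\<Delta>\<close> if \<open>q = 1\<close> (\<open>invariant_factors_through_Delta\<close>).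

  The converse inclusions need that \<open>\<Delta>\<close> itself belongs to the trace ring (\<open>Delta_in_trace_ring\<close>).
  Alternating a product of traces of words, with the cycles of a permutation \<open>\<pi>\<close> of the \<open>n\<^sup>2\<close> positions
  as words, gives \<open>c\<^sub>\<pi> \<Delta>\<close> for an integer \<open>c\<^sub>\<pi>\<close> (\<open>alternating_trace_monomial\<close>), and it must be shown that some
  \<open>c\<^sub>\<pi>\<close> is nonzero.  This is a case of the first fundamental theorem of matrix invariants.  Here it
  is obtained by a positivity argument (\<open>levi_trace_nonzero\<close>): the tensor \<open>D\<close> of values of the
  discriminant at matrix units, read as an operator on \<open>n\<^sup>2\<close>-fold tensors, commutes with all tensor powers,
  and this turns the sum of all \<open>c\<^sub>\<pi>\<^sup>2\<close> into a sum of squares of which one is visibly nonzero.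
\<close>


section \<open>Polynomials as functions on points\<close>

definition peval :: "(nat \<times> nat \<times> nat \<Rightarrow> 'k::field) \<Rightarrow> 'k mpoly \<Rightarrow> 'k" where
  "peval \<xi> p = (\<Sum>t \<in> Poly_Mapping.keys p. Poly_Mapping.lookup p t *
     (\<Prod>v \<in> Poly_Mapping.keys t. \<xi> v ^ Poly_Mapping.lookup t v))"

lemma const_one [simp]: "const 1 = 1"
  by (simp add: const_def)

lemma const_zero [simp]: "const 0 = 0"
  by (simp add: const_def)

lemma const_add: "const (a + b) = const a + const b"
  by (simp add: const_def single_add)

lemma const_prod: "const (prod f A) = (\<Prod>a \<in> A. const (f a))"
  by (induction A rule: infinite_finite_induct) (simp_all add: const_mult)

lemma const_power: "const (a ^ k) = const a ^ k"
  by (induction k) (simp_all add: const_mult)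

lemma const_eq_iff [simp]: "const a = const b \<longleftrightarrow> a = b"
  by (metis const_def lookup_single_eq)

lemma subst_points: "subst (\<lambda>v. const (\<xi> v)) p = const (peval \<xi> p)"
  by (simp add: subst_def peval_def const_sum const_mult const_prod const_power)

lemma peval_add: "peval \<xi> (p + q) = peval \<xi> p + peval \<xi> q"
  by (metis subst_points subst_add const_add const_eq_iff)

lemma peval_mult: "peval \<xi> (p * q) = peval \<xi> p * peval \<xi> q"
  by (metis subst_points subst_mult const_mult const_eq_iff)

lemma peval_const [simp]: "peval \<xi> (const c) = c"
  by (metis subst_points subst_const const_eq_iff)

lemma peval_var [simp]: "peval \<xi> (var v) = \<xi> v"
  by (metis subst_points subst_var const_eq_iff)

lemma peval_zero [simp]: "peval \<xi> 0 = 0"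
  by (simp add: peval_def)

lemma peval_one [simp]: "peval \<xi> 1 = 1"
  by (metis const_one peval_const)

lemma peval_subst: "peval \<xi> (subst \<sigma> p) = peval (\<lambda>v. peval \<xi> (\<sigma> v)) p"
proof -
  have "const (peval \<xi> (subst \<sigma> p)) = const (peval (\<lambda>v. peval \<xi> (\<sigma> v)) p)"
    unfolding subst_points[symmetric] subst_subst ..
  thus ?thesis by simp
qed

interpretation peval: comm_ring_hom "peval \<xi>"
  by unfold_locales (simp_all add: peval_add peval_mult)

interpretation emb: inj_comm_ring_hom "emb :: 'k::field mpoly \<Rightarrow> 'k ratfun"
  by unfold_locales
    (simp_all add: emb_add emb_mult emb_zero, simp_all add: emb_def One_fract_def eq_fract Zero_fract_def)

interpretation const: inj_comm_ring_hom "const :: 'k::field \<Rightarrow> 'k mpoly"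
  by unfold_locales
    (simp_all add: const_add const_mult, metis const_eq_iff const_zero)

text \<open>
  Separating off one variable \<open>w\<close> leaves, for fixed values of the others, a polynomial in a
  single variable with infinitely many zeros; its coefficients are combinations of monomials in the
  remaining variables, and induction applies to them.
\<close>

lemma monomial_functions_independent:
  fixes c :: "('v \<Rightarrow> nat) \<Rightarrow> 'a::field_char_0"
  assumes "finite V" "finite A"
    and "\<And>s t. s \<in> A \<Longrightarrow> t \<in> A \<Longrightarrow> (\<And>v. v \<in> V \<Longrightarrow> s v = t v) \<Longrightarrow> s = t"
    and "\<And>\<xi>. (\<Sum>t \<in> A. c t * (\<Prod>v \<in> V. \<xi> v ^ t v)) = 0"
    and "t \<in> A"
  shows "c t = 0"
  using assms
proof (induction V arbitrary: A rule: finite_induct)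
  case empty
  hence "A = {t}" by auto
  with empty.prems(3) show ?case by simp
next
  case (insert w V)
  define B where "B = {s \<in> A. s w = t w}"
  show ?case
  proof (rule insert.IH)
    show "finite B" "t \<in> B"
      using insert.prems by (auto simp: B_def)
    show "s = s'" if "s \<in> B" "s' \<in> B" and *: "\<And>v. v \<in> V \<Longrightarrow> s v = s' v" for s s'
      proof (rule insert.prems(2))
      show "s \<in> A" "s' \<in> A" using that by (auto simp: B_def)
      show "s v = s' v" if "v \<in> insert w V" for v
        using that \<open>s \<in> B\<close> \<open>s' \<in> B\<close> * by (cases "v = w") (auto simp: B_def)
    qed
    fix \<xi> :: "'v \<Rightarrow> 'a"
    \<comment> \<open>the sum as a polynomial in the value of \<open>w\<close>\<close>
    define P where "P = (\<Sum>s \<in> A. monom (c s * (\<Prod>v \<in> V. \<xi> v ^ s v)) (s w))"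
    have "poly P x = 0" for x
    proof -
      have "poly P x = (\<Sum>s \<in> A. c s * (\<Prod>v \<in> insert w V. (\<xi>(w := x)) v ^ s v))"
      proof -
        have "(\<Prod>v \<in> insert w V. (\<xi>(w := x)) v ^ s v) = x ^ s w * (\<Prod>v \<in> V. \<xi> v ^ s v)" for s
        proof -
          have "(\<Prod>v \<in> V. (\<xi>(w := x)) v ^ s v) = (\<Prod>v \<in> V. \<xi> v ^ s v)"
            using insert.hyps by (intro prod.cong) auto
          thus ?thesis using insert.hyps by simp
        qed
        thus ?thesis by (simp add: P_def poly_sum poly_monom mult_ac)
      qed
      also have "\<dots> = 0" by (rule insert.prems(3))
      finally show ?thesis .
    qed
    hence "P = 0"
      using poly_all_0_iff_0 by blast
    hence "0 = coeff P (t w)" by simp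
    also have "\<dots> = (\<Sum>s \<in> A. if s w = t w then c s * (\<Prod>v \<in> V. \<xi> v ^ s v) else 0)"
      by (simp add: P_def coeff_sum)
    also have "\<dots> = (\<Sum>s \<in> B. c s * (\<Prod>v \<in> V. \<xi> v ^ s v))"
      unfolding B_def using insert.prems(1) by (simp add: sum.inter_filter)
    finally show "(\<Sum>s \<in> B. c s * (\<Prod>v \<in> V. \<xi> v ^ s v)) = 0" by simp
  qed
qed

lemma peval_zero_imp_zero:
  fixes p :: "'k::field_char_0 mpoly"
  assumes "\<And>\<xi>. peval \<xi> p = 0"
  shows "p = 0"
proof (rule ccontr)
  assume "p \<noteq> 0"
  then obtain t where t: "t \<in> Poly_Mapping.keys p"
    by (metis keys_eq_empty ex_in_conv)
  define V where "V = (\<Union>s \<in> Poly_Mapping.keys p. Poly_Mapping.keys s)"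
  have V: "finite V" by (simp add: V_def)
  have "Poly_Mapping.lookup p (Abs_poly_mapping (Poly_Mapping.lookup t)) = 0"
  proof (rule monomial_functions_independent[where c = "\<lambda>s. Poly_Mapping.lookup p (Abs_poly_mapping s)"
        and A = "Poly_Mapping.lookup ` Poly_Mapping.keys p", OF V])
    show "finite (Poly_Mapping.lookup ` Poly_Mapping.keys p)" by simp
    show "Poly_Mapping.lookup t \<in> Poly_Mapping.lookup ` Poly_Mapping.keys p" using t by simp
    fix s s' assume "s \<in> Poly_Mapping.lookup ` Poly_Mapping.keys p"
      "s' \<in> Poly_Mapping.lookup ` Poly_Mapping.keys p"
    then obtain r r' where r: "s = Poly_Mapping.lookup r" "s' = Poly_Mapping.lookup r'"
      "r \<in> Poly_Mapping.keys p" "r' \<in> Poly_Mapping.keys p" by auto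
    assume *: "s v = s' v" if "v \<in> V" for v
    show "s = s'"
    proof
      fix v
      show "s v = s' v"
      proof (cases "v \<in> V")
        case False
        hence "v \<notin> Poly_Mapping.keys r" "v \<notin> Poly_Mapping.keys r'"
          using r by (auto simp: V_def)
        thus ?thesis by (simp add: r in_keys_iff)
      qed (rule *)
    qed
  next
    fix \<xi> :: "nat \<times> nat \<times> nat \<Rightarrow> 'k"
    have "(\<Sum>s \<in> Poly_Mapping.lookup ` Poly_Mapping.keys p.
        Poly_Mapping.lookup p (Abs_poly_mapping s) * (\<Prod>v \<in> V. \<xi> v ^ s v)) =
      (\<Sum>s \<in> Poly_Mapping.keys p. Poly_Mapping.lookup p s * (\<Prod>v \<in> V. \<xi> v ^ Poly_Mapping.lookup s v))"
      by (subst sum.reindex) (auto simp: inj_on_def lookup_inverse Poly_Mapping.lookup_inject)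
    also have "\<dots> = peval \<xi> p"
      unfolding peval_def
    proof (intro sum.cong refl arg_cong2[where f = "(*)"] prod.mono_neutral_right)
      fix s assume "s \<in> Poly_Mapping.keys p"
      thus "Poly_Mapping.keys s \<subseteq> V" by (auto simp: V_def)
    qed (auto simp: V in_keys_iff)
    finally show "(\<Sum>s \<in> Poly_Mapping.lookup ` Poly_Mapping.keys p.
        Poly_Mapping.lookup p (Abs_poly_mapping s) * (\<Prod>v \<in> V. \<xi> v ^ s v)) = 0"
      using assms by simp
  qed
  hence "Poly_Mapping.lookup p t = 0"
    by (simp add: lookup_inverse)
  thus False using t by (simp add: in_keys_iff)
qed

text \<open>
  The difference times \<open>s\<close> vanishes everywhere, and polynomials form a domain.  This is how
  statements about points in general position become identities of polynomials.
\<close>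

lemma mpoly_eqI_generic:
  fixes p q s :: "'k::field_char_0 mpoly"
  assumes "s \<noteq> 0" and "\<And>\<xi>. peval \<xi> s \<noteq> 0 \<Longrightarrow> peval \<xi> p = peval \<xi> q"
  shows "p = q"
proof -
  have "(p - q) * s = 0"
  proof (rule peval_zero_imp_zero)
    fix \<xi>
    show "peval \<xi> ((p - q) * s) = 0"
      using assms(2)[of \<xi>] by (cases "peval \<xi> s = 0") (simp_all add: peval.hom_mult peval.hom_minus)
  qed
  with assms(1) show ?thesis by simp
qed

lemma nonzero_point:
  fixes p :: "'k::field_char_0 mpoly"
  assumes "p \<noteq> 0"
  obtains \<xi> where "peval \<xi> p \<noteq> 0"
  using peval_zero_imp_zero assms by blast


section \<open>The discriminant under one-sided multiplication\<close>

lemma sum_square_div_mod: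
  fixes f :: "nat \<Rightarrow> nat \<Rightarrow> 'a::comm_monoid_add"
  shows "(\<Sum>c<n\<^sup>2. f (c div n) (c mod n)) = (\<Sum>a<n. \<Sum>b<n. f a b)"
proof -
  have "(\<Sum>a<n. \<Sum>b<n. f a b) = (\<Sum>(a, b) \<in> {..<n} \<times> {..<n}. f a b)"
    by (simp add: sum.cartesian_product)
  also have "\<dots> = (\<Sum>c<n\<^sup>2. f (c div n) (c mod n))"
  proof (rule sum.reindex_bij_witness[where i = "\<lambda>c. (c div n, c mod n)" and j = "\<lambda>(a, b). a * n + b"])
    fix p assume "p \<in> {..<n} \<times> {..<n}"
    then obtain a b where p: "p = (a, b)" "a < n" "b < n" by auto
    have "a * n + b < (a + 1) * n" using p by simp
    also have "\<dots> \<le> n * n" using p by (intro mult_right_mono) auto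
    finally show "(case p of (a, b) \<Rightarrow> a * n + b) \<in> {..<n\<^sup>2}"
      using p by (simp add: power2_eq_square)
    from p show "((case p of (a, b) \<Rightarrow> a * n + b) div n, (case p of (a, b) \<Rightarrow> a * n + b) mod n) = p"
      by simp
    from p show "f ((case p of (a, b) \<Rightarrow> a * n + b) div n) ((case p of (a, b) \<Rightarrow> a * n + b) mod n)
        = (case p of (a, b) \<Rightarrow> f a b)"
      by simp
  next
    fix c assume "c \<in> {..<n\<^sup>2}"
    hence "c < n * n" by (simp add: power2_eq_square)
    hence "n > 0" "c div n < n" by (auto intro!: less_mult_imp_div_less gr0I)
    thus "(case (c div n, c mod n) of (a, b) \<Rightarrow> a * n + b) = c"
      "(c div n, c mod n) \<in> {..<n} \<times> {..<n}" by auto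
  qed
  finally show ?thesis ..
qed

lemma square_div_less: "c < n\<^sup>2 \<Longrightarrow> c div n < (n::nat)"
  by (rule less_mult_imp_div_less) (simp add: power2_eq_square)

lemma square_mod_less: "c < n\<^sup>2 \<Longrightarrow> c mod n < (n::nat)"
  by (cases "n = 0") auto

lemma permutes_upto_less: "p permutes {0..<N} \<Longrightarrow> s < N \<Longrightarrow> p s < (N::nat)"
  by (metis atLeastLessThan_iff permutes_in_image zero_le)

lemma det_permute_rows_and_columns:
  assumes A: "A \<in> carrier_mat N N" and p: "p permutes {0..<N}"
  shows "det (mat N N (\<lambda>(i, j). A $$ (p i, p j))) = det A"
proof -
  define B where "B = mat N N (\<lambda>(i, j). A $$ (p i, j))"
  have B: "B \<in> carrier_mat N N" by (simp add: B_def)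
  have "det (mat N N (\<lambda>(i, j). A $$ (p i, p j))) = det (transpose_mat (mat N N (\<lambda>(i, j). A $$ (p i, p j))))"
    by (rule det_transpose[of _ N, symmetric]) simp
  also have "transpose_mat (mat N N (\<lambda>(i, j). A $$ (p i, p j))) =
      mat N N (\<lambda>(i, j). transpose_mat B $$ (p i, j))"
    by (rule eq_matI) (auto simp: B_def permutes_upto_less[OF p])
  also have "det \<dots> = signof p * det (transpose_mat B)"
    by (rule det_permute_rows) (use B p in auto)
  also have "det (transpose_mat B) = signof p * det A"
    by (subst det_transpose[OF B]) (simp only: B_def det_permute_rows[OF A p])
  finally show ?thesis
    by (simp add: sign_def)
qed

lemma det_rows_sum:
  fixes f :: "nat \<Rightarrow> 'y \<Rightarrow> nat \<Rightarrow> 'a::comm_ring_1"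
  assumes "finite Y"
  shows "det (mat N N (\<lambda>(s, c). \<Sum>y \<in> Y. w s y * f s y c)) =
    (\<Sum>g \<in> {..<N} \<rightarrow>\<^sub>E Y. (\<Prod>s<N. w s (g s)) * det (mat N N (\<lambda>(s, c). f s (g s) c)))"
proof -
  let ?P = "{p. p permutes {0..<N}}"
  have "det (mat N N (\<lambda>(s, c). \<Sum>y \<in> Y. w s y * f s y c)) =
      (\<Sum>p \<in> ?P. signof p * (\<Prod>s \<in> {0..<N}. \<Sum>y \<in> Y. w s y * f s y (p s)))"
    by (subst det_def'[of _ N]) (auto intro!: sum.cong prod.cong arg_cong2[where f = "(*)"]
        simp: permutes_upto_less)
  also have "\<dots> = (\<Sum>p \<in> ?P. signof p * (\<Sum>g \<in> {..<N} \<rightarrow>\<^sub>E Y. \<Prod>s<N. w s (g s) * f s (g s) (p s)))"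
    by (subst prod_sum_PiE) (auto simp: assms lessThan_atLeast0)
  also have "\<dots> = (\<Sum>g \<in> {..<N} \<rightarrow>\<^sub>E Y. \<Sum>p \<in> ?P. (\<Prod>s<N. w s (g s)) * (signof p * (\<Prod>s<N. f s (g s) (p s))))"
    by (subst sum.swap) (simp add: sum_distrib_left prod.distrib mult_ac)
  also have "\<dots> = (\<Sum>g \<in> {..<N} \<rightarrow>\<^sub>E Y. (\<Prod>s<N. w s (g s)) * det (mat N N (\<lambda>(s, c). f s (g s) c)))"
  proof (rule sum.cong[OF refl])
    fix g
    have "det (mat N N (\<lambda>(s, c). f s (g s) c)) = (\<Sum>p \<in> ?P. signof p * (\<Prod>s<N. f s (g s) (p s)))"
      by (subst det_def'[of _ N]) (auto intro!: sum.cong prod.cong arg_cong2[where f = "(*)"]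
        simp: permutes_upto_less lessThan_atLeast0)
    thus "(\<Sum>p \<in> ?P. (\<Prod>s<N. w s (g s)) * (signof p * (\<Prod>s<N. f s (g s) (p s)))) =
      (\<Prod>s<N. w s (g s)) * det (mat N N (\<lambda>(s, c). f s (g s) c))"
      by (simp add: sum_distrib_left)
  qed
  finally show ?thesis .
qed

definition coords :: "nat \<Rightarrow> (nat \<Rightarrow> 'a mat) \<Rightarrow> 'a mat" where
  "coords n A = mat (n\<^sup>2) (n\<^sup>2) (\<lambda>(r, c). A r $$ (c div n, c mod n))"

lemma coords_carrier [simp]: "coords n A \<in> carrier_mat (n\<^sup>2) (n\<^sup>2)"
  by (simp add: coords_def)

lemma discriminant_coords: "discriminant n A = det (coords n A)"
  by (simp add: discriminant_def coords_def)

lemma discriminant_cong: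
  assumes "\<And>r i j. r < n\<^sup>2 \<Longrightarrow> i < n \<Longrightarrow> j < n \<Longrightarrow> A r $$ (i, j) = B r $$ (i, j)"
  shows "discriminant n A = discriminant n B"
proof -
  have "coords n A = coords n B"
    unfolding coords_def by (rule cong_mat) (auto simp: assms square_div_less square_mod_less)
  thus ?thesis by (simp add: discriminant_coords)
qed

lemma (in comm_ring_hom) discriminant_hom:
  assumes "\<And>r. r < n\<^sup>2 \<Longrightarrow> A r \<in> carrier_mat n n"
  shows "discriminant n (\<lambda>r. map_mat hom (A r)) = hom (discriminant n A)"
proof -
  have "coords n (\<lambda>r. map_mat hom (A r)) = map_mat hom (coords n A)"
  proof (rule eq_matI)
    fix r c assume "r < dim_row (map_mat hom (coords n A))" "c < dim_col (map_mat hom (coords n A))"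
    hence "r < n\<^sup>2" "c < n\<^sup>2" by (simp_all add: coords_def)
    moreover from this have "A r \<in> carrier_mat n n" using assms by blast
    ultimately show "coords n (\<lambda>r. map_mat hom (A r)) $$ (r, c) = map_mat hom (coords n A) $$ (r, c)"
      by (simp add: coords_def square_div_less square_mod_less)
  qed (simp_all add: coords_def)
  thus ?thesis by (simp add: discriminant_coords)
qed

text \<open>
  In coordinates, left and right multiplication by \<open>u\<close> are the Kronecker products \<open>u\<^sup>T \<otimes> 1\<close> and
  \<open>1 \<otimes> u\<close>.  Interchanging the two indices of every entry, on rows and
  columns alike, carries one Kronecker product into the transpose of the other.  Therefore their
  determinants agree.
\<close>

context
  fixes n :: nat and u :: "'a::comm_ring_1 mat"
  assumes u: "u \<in> carrier_mat n n"
begin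

private definition lmat where
  "lmat = mat (n\<^sup>2) (n\<^sup>2) (\<lambda>(r, c). if r mod n = c mod n then u $$ (c div n, r div n) else 0)"

private definition rmat where
  "rmat = mat (n\<^sup>2) (n\<^sup>2) (\<lambda>(r, c). if r div n = c div n then u $$ (r mod n, c mod n) else 0)"

private lemma coords_left:
  assumes A: "\<And>r. r < n\<^sup>2 \<Longrightarrow> A r \<in> carrier_mat n n"
  shows "coords n (\<lambda>r. u * A r) = coords n A * lmat"
proof (rule eq_matI)
  fix r c assume "r < dim_row (coords n A * lmat)" "c < dim_col (coords n A * lmat)"
  hence r: "r < n\<^sup>2" and c: "c < n\<^sup>2" by (simp_all add: coords_def lmat_def)
  have "(coords n A * lmat) $$ (r, c) =
    (\<Sum>d<n\<^sup>2. A r $$ (d div n, d mod n) * (if d mod n = c mod n then u $$ (c div n, d div n) else 0))"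
    using r c by (simp add: coords_def lmat_def scalar_prod_def lessThan_atLeast0)
  also have "\<dots> = (\<Sum>a<n. \<Sum>b<n. A r $$ (a, b) * (if b = c mod n then u $$ (c div n, a) else 0))"
    by (rule sum_square_div_mod[where f = "\<lambda>a b. A r $$ (a, b) * (if b = c mod n then u $$ (c div n, a) else 0)"])
  also have "\<dots> = (\<Sum>a<n. u $$ (c div n, a) * A r $$ (a, c mod n))"
    using square_mod_less[OF c] by (intro sum.cong refl) (simp add: if_distrib mult_ac sum.delta' cong: if_cong)
  also have "\<dots> = coords n (\<lambda>r. u * A r) $$ (r, c)"
    using r c u A[OF r] square_mod_less[OF c] square_div_less[OF c]
    by (simp add: coords_def scalar_prod_def lessThan_atLeast0)
  finally show "coords n (\<lambda>r. u * A r) $$ (r, c) = (coords n A * lmat) $$ (r, c)" ..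
qed (simp_all add: coords_def lmat_def)

private lemma coords_right:
  assumes A: "\<And>r. r < n\<^sup>2 \<Longrightarrow> A r \<in> carrier_mat n n"
  shows "coords n (\<lambda>r. A r * u) = coords n A * rmat"
proof (rule eq_matI)
  fix r c assume "r < dim_row (coords n A * rmat)" "c < dim_col (coords n A * rmat)"
  hence r: "r < n\<^sup>2" and c: "c < n\<^sup>2" by (simp_all add: coords_def rmat_def)
  have "(coords n A * rmat) $$ (r, c) =
    (\<Sum>d<n\<^sup>2. A r $$ (d div n, d mod n) * (if d div n = c div n then u $$ (d mod n, c mod n) else 0))"
    using r c by (simp add: coords_def rmat_def scalar_prod_def lessThan_atLeast0)
  also have "\<dots> = (\<Sum>a<n. \<Sum>b<n. A r $$ (a, b) * (if a = c div n then u $$ (b, c mod n) else 0))"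
    by (rule sum_square_div_mod[where f = "\<lambda>a b. A r $$ (a, b) * (if a = c div n then u $$ (b, c mod n) else 0)"])
  also have "\<dots> = (\<Sum>b<n. \<Sum>a<n. A r $$ (a, b) * (if a = c div n then u $$ (b, c mod n) else 0))"
    by (rule sum.swap)
  also have "\<dots> = (\<Sum>b<n. A r $$ (c div n, b) * u $$ (b, c mod n))"
    using square_div_less[OF c] by (intro sum.cong refl) (simp add: if_distrib mult_ac sum.delta' cong: if_cong)
  also have "\<dots> = coords n (\<lambda>r. A r * u) $$ (r, c)"
    using r c u A[OF r] square_mod_less[OF c] square_div_less[OF c]
    by (simp add: coords_def scalar_prod_def lessThan_atLeast0)
  finally show "coords n (\<lambda>r. A r * u) $$ (r, c) = (coords n A * rmat) $$ (r, c)" ..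
qed (simp_all add: coords_def rmat_def)

private lemma det_lmat: "det lmat = det rmat"
proof -
  \<comment> \<open>interchanges the two indices \<open>c div n\<close> and \<open>c mod n\<close> of an entry\<close>
  define \<phi> where "\<phi> c = (if c < n\<^sup>2 then c mod n * n + c div n else c)" for c
  have \<phi>_less: "\<phi> c < n\<^sup>2" if "c < n\<^sup>2" for c
  proof -
    have "c mod n * n + c div n < (c mod n + 1) * n"
      using square_div_less[OF that] by simp
    also have "\<dots> \<le> n * n"
      using square_mod_less[OF that] by (intro mult_right_mono) auto
    finally show ?thesis using that by (simp add: \<phi>_def power2_eq_square)
  qed
  have \<phi>_div: "\<phi> c div n = c mod n" and \<phi>_mod: "\<phi> c mod n = c div n" if "c < n\<^sup>2" for c
    using that square_div_less[OF that] by (auto simp: \<phi>_def)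
  have \<phi>_\<phi>: "\<phi> (\<phi> c) = c" for c
  proof (cases "c < n\<^sup>2")
    case True
    thus ?thesis
      using \<phi>_less[OF True] by (simp add: \<phi>_def[of "\<phi> c"] \<phi>_div \<phi>_mod)
  qed (simp add: \<phi>_def)
  have perm: "\<phi> permutes {0..<n\<^sup>2}"
    unfolding permutes_def
  proof (intro conjI allI impI)
    show "\<phi> x = x" if "x \<notin> {0..<n\<^sup>2}" for x using that by (simp add: \<phi>_def)
    show "\<exists>!x. \<phi> x = y" for y by (metis \<phi>_\<phi>)
  qed
  have R: "rmat \<in> carrier_mat (n\<^sup>2) (n\<^sup>2)" by (simp add: rmat_def)
  have "lmat = mat (n\<^sup>2) (n\<^sup>2) (\<lambda>(r, c). transpose_mat rmat $$ (\<phi> r, \<phi> c))"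
    unfolding lmat_def by (rule cong_mat) (auto simp: rmat_def \<phi>_less \<phi>_div \<phi>_mod)
  also have "det \<dots> = det (transpose_mat rmat)"
    using R by (intro det_permute_rows_and_columns[OF _ perm]) simp
  finally show ?thesis
    using det_transpose[OF R] by simp
qed

lemma discriminant_left_eq_right:
  assumes A: "\<And>r. r < n\<^sup>2 \<Longrightarrow> A r \<in> carrier_mat n n"
  shows "discriminant n (\<lambda>r. u * A r) = discriminant n (\<lambda>r. A r * u)"
proof -
  have "det (coords n A * lmat) = det (coords n A * rmat)"
    by (subst (1 2) det_mult[where n = "n\<^sup>2"]) (simp_all add: det_lmat, simp_all add: lmat_def rmat_def)
  thus ?thesis
    by (simp add: discriminant_coords coords_left[OF A] coords_right[OF A])
qed

end

text \<open>
  Moving \<open>u\<close> from the left to the right by \<open>discriminant_left_eq_right\<close> places it next to its inverse.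
\<close>

lemma discriminant_conjugate:
  assumes u: "u \<in> carrier_mat n n" and v: "v \<in> carrier_mat n n" and "v * u = 1\<^sub>m n"
    and A: "\<And>r. r < n\<^sup>2 \<Longrightarrow> A r \<in> carrier_mat n n"
  shows "discriminant n (\<lambda>r. u * A r * v) = discriminant n A"
proof -
  have "discriminant n (\<lambda>r. u * A r * v) = discriminant n (\<lambda>r. u * (A r * v))"
  proof (rule discriminant_cong)
    fix r i j assume "r < n\<^sup>2"
    from assoc_mult_mat[OF u A[OF this] v]
    show "(u * A r * v) $$ (i, j) = (u * (A r * v)) $$ (i, j)" by simp
  qed
  also have "\<dots> = discriminant n (\<lambda>r. (A r * v) * u)"
    by (rule discriminant_left_eq_right[OF u]) (intro mult_carrier_mat[OF A v])
  also have "\<dots> = discriminant n A"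
  proof (rule discriminant_cong)
    fix r i j assume "r < n\<^sup>2"
    from assoc_mult_mat[OF A[OF this] v u] A[OF this]
    show "(A r * v * u) $$ (i, j) = A r $$ (i, j)" by (simp add: assms)
  qed
  finally show ?thesis .
qed


section \<open>Alternating trace monomials that do not vanish\<close>

text \<open>
  Passing to the complement turns this into the sum of \<open>(- 1) ^ card R\<close> over all subsets \<open>R\<close> of \<open>T - U\<close>, a
  product with one factor \<open>1 - 1\<close> for each element.
\<close>

lemma sum_alternating_between:
  fixes T :: "'a set"
  assumes "finite T" "U \<subseteq> T"
  shows "(\<Sum>S | U \<subseteq> S \<and> S \<subseteq> T. (- 1) ^ card (T - S)) = (of_bool (U = T) :: int)"
proof -
  have "(\<Sum>S | U \<subseteq> S \<and> S \<subseteq> T. (- 1) ^ card (T - S)) = (\<Sum>R \<in> Pow (T - U). (- 1 :: int) ^ card R)"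
    by (rule sum.reindex_bij_witness[where i = "\<lambda>R. T - R" and j = "\<lambda>S. T - S"])
       (use assms in \<open>auto simp: double_diff\<close>)
  also have "\<dots> = (\<Prod>x \<in> T - U. (- 1) + 1)"
    using assms by (subst prod_add) auto
  also have "\<dots> = of_bool (U = T)"
    using assms by auto
  finally show ?thesis .
qed

text \<open>
  Ryser's formula.  Expanding the products on the right gives a sum over all self-maps \<open>g\<close> of \<open>T\<close>,
  and the signs cancel unless the image of \<open>g\<close> is all of \<open>T\<close>.  It expresses a sum over
  permutations through tensor powers of a single matrix, for which commutation is known.
\<close>

lemma permanent_polarization:
  fixes f :: "'t \<Rightarrow> 't \<Rightarrow> int"
  assumes T: "finite T"
  shows "(\<Sum>\<pi> | \<pi> permutes T. \<Prod>t \<in> T. f (\<pi> t) t) =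
    (\<Sum>S \<in> Pow T. (- 1) ^ card (T - S) * (\<Prod>t \<in> T. \<Sum>s \<in> S. f s t))"
proof -
  have "(\<Sum>S \<in> Pow T. (- 1) ^ card (T - S) * (\<Prod>t \<in> T. \<Sum>s \<in> S. f s t)) =
    (\<Sum>S \<in> Pow T. \<Sum>g \<in> {g \<in> T \<rightarrow>\<^sub>E T. g ` T \<subseteq> S}. (- 1) ^ card (T - S) * (\<Prod>t \<in> T. f (g t) t))"
  proof (rule sum.cong[OF refl])
    fix S assume "S \<in> Pow T"
    hence S: "S \<subseteq> T" "finite S" using T finite_subset by auto
    have "(\<Prod>t \<in> T. \<Sum>s \<in> S. f s t) = (\<Sum>g \<in> T \<rightarrow>\<^sub>E S. \<Prod>t \<in> T. f (g t) t)"
      by (rule prod_sum_PiE) (use T S in auto)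
    also have "T \<rightarrow>\<^sub>E S = {g \<in> T \<rightarrow>\<^sub>E T. g ` T \<subseteq> S}"
      using S by (auto simp: PiE_def Pi_def)
    finally show "(- 1) ^ card (T - S) * (\<Prod>t \<in> T. \<Sum>s \<in> S. f s t) =
      (\<Sum>g \<in> {g \<in> T \<rightarrow>\<^sub>E T. g ` T \<subseteq> S}. (- 1) ^ card (T - S) * (\<Prod>t \<in> T. f (g t) t))"
      by (simp add: sum_distrib_left)
  qed
  also have "\<dots> = (\<Sum>g \<in> T \<rightarrow>\<^sub>E T. \<Sum>S | S \<in> Pow T \<and> g ` T \<subseteq> S. (- 1) ^ card (T - S) * (\<Prod>t \<in> T. f (g t) t))"
    by (rule sum.swap_restrict) (use T in \<open>auto intro: finite_PiE\<close>)
  also have "\<dots> = (\<Sum>g \<in> T \<rightarrow>\<^sub>E T. if g ` T = T then \<Prod>t \<in> T. f (g t) t else 0)"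
  proof (rule sum.cong[OF refl])
    fix g assume "g \<in> T \<rightarrow>\<^sub>E T"
    hence "g ` T \<subseteq> T" by auto
    have "(\<Sum>S | S \<in> Pow T \<and> g ` T \<subseteq> S. (- 1) ^ card (T - S) * (\<Prod>t \<in> T. f (g t) t)) =
      (\<Sum>S | g ` T \<subseteq> S \<and> S \<subseteq> T. (- 1) ^ card (T - S)) * (\<Prod>t \<in> T. f (g t) t)"
      by (simp add: sum_distrib_right conj_commute)
    thus "(\<Sum>S | S \<in> Pow T \<and> g ` T \<subseteq> S. (- 1) ^ card (T - S) * (\<Prod>t \<in> T. f (g t) t)) =
      (if g ` T = T then \<Prod>t \<in> T. f (g t) t else 0)"
      by (simp add: sum_alternating_between[OF T \<open>g ` T \<subseteq> T\<close>])
  qed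
  also have "\<dots> = (\<Sum>g | g \<in> T \<rightarrow>\<^sub>E T \<and> g ` T = T. \<Prod>t \<in> T. f (g t) t)"
    using T by (subst sum.inter_filter[symmetric]) (auto intro: finite_PiE)
  also have "\<dots> = (\<Sum>\<pi> | \<pi> permutes T. \<Prod>t \<in> T. f (\<pi> t) t)"
  proof (rule sum.reindex_bij_witness[where j = "\<lambda>g t. if t \<in> T then g t else t" and i = "\<lambda>\<pi>. restrict \<pi> T"])
    fix \<pi> assume \<pi>: "\<pi> \<in> {\<pi>. \<pi> permutes T}"
    thus "(\<lambda>t. if t \<in> T then restrict \<pi> T t else t) = \<pi>"
      by (auto simp: fun_eq_iff permutes_def)
    from \<pi> show "restrict \<pi> T \<in> {g. g \<in> T \<rightarrow>\<^sub>E T \<and> g ` T = T}"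
      by (auto simp: permutes_in_image permutes_image)
  next
    fix g assume g: "g \<in> {g. g \<in> T \<rightarrow>\<^sub>E T \<and> g ` T = T}"
    thus "restrict (\<lambda>t. if t \<in> T then g t else t) T = g"
      by (auto simp: fun_eq_iff PiE_def extensional_def)
    have "bij_betw g T T"
      using g T by (auto simp: bij_betw_def intro: eq_card_imp_inj_on)
    hence "bij_betw (\<lambda>t. if t \<in> T then g t else t) T T"
      by (subst bij_betw_cong[where g = g]) auto
    thus "(\<lambda>t. if t \<in> T then g t else t) \<in> {\<pi>. \<pi> permutes T}"
      by (auto intro: bij_imp_permutes)
  qed (auto intro!: prod.cong)
  finally show ?thesis ..
qed

definition munit :: "nat \<Rightarrow> nat \<Rightarrow> nat \<Rightarrow> 'a::comm_ring_1 mat" where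
  "munit n a b = mat n n (\<lambda>(i, j). of_bool (i = a \<and> j = b))"

lemma munit_carrier [simp]: "munit n a b \<in> carrier_mat n n"
  by (simp add: munit_def)

lemma munit_index: "i < n \<Longrightarrow> j < n \<Longrightarrow> munit n a b $$ (i, j) = of_bool (i = a \<and> j = b)"
  by (simp add: munit_def)

lemma sum_of_bool_eq:
  fixes f :: "nat \<Rightarrow> 'a::comm_semiring_1"
  assumes "b < n"
  shows "(\<Sum>y<n. f y * of_bool (y = b)) = f b" "(\<Sum>y<n. f y * of_bool (b = y)) = f b"
    "(\<Sum>y<n. of_bool (y = b) * f y) = f b"
proof -
  have "(\<Sum>y<n. f y * of_bool (y = b)) = (\<Sum>y<n. if y = b then f y else 0)"
    by (rule sum.cong) auto
  thus "(\<Sum>y<n. f y * of_bool (y = b)) = f b" using assms by simp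
  thus "(\<Sum>y<n. f y * of_bool (b = y)) = f b" "(\<Sum>y<n. of_bool (y = b) * f y) = f b"
    by (simp_all add: mult.commute eq_commute[of b])
qed

lemma munit_mult_index:
  assumes W: "W \<in> carrier_mat n n" and "i < n" "j < n" "b < n"
  shows "(munit n a b * W) $$ (i, j) = of_bool (i = a) * W $$ (b, j)"
proof -
  have "(munit n a b * W) $$ (i, j) = (\<Sum>y<n. of_bool (i = a \<and> y = b) * W $$ (y, j))"
    using assms by (simp add: munit_def scalar_prod_def lessThan_atLeast0)
  thus ?thesis using assms by (cases "i = a") (simp_all add: sum_of_bool_eq)
qed

lemma mult_munit_index:
  assumes W: "W \<in> carrier_mat n n" and "i < n" "j < n" "a < n"
  shows "(W * munit n a b) $$ (i, j) = of_bool (j = b) * W $$ (i, a)"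
proof -
  have "(W * munit n a b) $$ (i, j) = (\<Sum>y<n. W $$ (i, y) * of_bool (y = a \<and> j = b))"
    using assms by (simp add: munit_def scalar_prod_def lessThan_atLeast0)
  thus ?thesis using assms by (cases "j = b") (simp_all add: sum_of_bool_eq)
qed

text \<open>
  Multi-indices of the basis of the \<open>n\<^sup>2\<close>-fold tensor power of an \<open>n\<close>-dimensional space.
\<close>

definition indices :: "nat \<Rightarrow> (nat \<Rightarrow> nat) set" where
  "indices n = {..<n\<^sup>2} \<rightarrow>\<^sub>E {..<n}"

lemma finite_indices: "finite (indices n)"
  by (auto simp: indices_def intro: finite_PiE)

lemma indices_less: "x \<in> indices n \<Longrightarrow> s < n\<^sup>2 \<Longrightarrow> x s < n"
  using PiE_mem[of x "{..<n\<^sup>2}" "\<lambda>_. {..<n}" s] by (simp add: indices_def)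

text \<open>
  The discriminant of the matrix units with row indices \<open>x\<close> and column indices \<open>y\<close>: the sign of the
  arrangement if every position occurs once, and zero otherwise.  It is read as a matrix whose
  rows and columns are labelled by multi-indices.
\<close>

definition levi :: "nat \<Rightarrow> (nat \<Rightarrow> nat) \<Rightarrow> (nat \<Rightarrow> nat) \<Rightarrow> 'a::comm_ring_1" where
  "levi n x y = discriminant n (\<lambda>s. munit n (x s) (y s))"

text \<open>
  Expanding the discriminant in its arguments, the left side is the discriminant of the matrix
  units multiplied from the right by the transpose of \<open>Z\<close>, and the right side is the same with
  multiplication from the left.
\<close>

lemma levi_commutes_with_tensor_power:
  assumes x: "x \<in> indices n" and d: "d \<in> indices n"
  shows "(\<Sum>c \<in> indices n. levi n x c * (\<Prod>s<n\<^sup>2. Z (c s) (d s))) =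
    (\<Sum>c \<in> indices n. (\<Prod>s<n\<^sup>2. Z (x s) (c s)) * levi n c d)"
proof -
  define W where "W = mat n n (\<lambda>(i, j). Z j i)"
  note xs = indices_less[OF x] and ds = indices_less[OF d]
  have W: "W \<in> carrier_mat n n" by (simp add: W_def)
  have W_index: "W $$ (i, j) = Z j i" if "i < n" "j < n" for i j
    using that by (simp add: W_def)
  have "(\<Sum>c \<in> indices n. levi n x c * (\<Prod>s<n\<^sup>2. Z (c s) (d s))) =
    det (mat (n\<^sup>2) (n\<^sup>2) (\<lambda>(s, e). \<Sum>y<n. Z y (d s) * munit n (x s) y $$ (e div n, e mod n)))"
    using det_rows_sum[where N = "n\<^sup>2" and Y = "{..<n}" and w = "\<lambda>s y. Z y (d s)"
        and f = "\<lambda>s y e. munit n (x s) y $$ (e div n, e mod n)"]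
    by (simp add: indices_def levi_def discriminant_def mult.commute[of _ "prod _ _"])
  also have "\<dots> = discriminant n (\<lambda>s. munit n (x s) (d s) * W)"
    unfolding discriminant_def
  proof (intro arg_cong[where f = det] cong_mat refl)
    fix s e assume se: "s < n\<^sup>2" "e < n\<^sup>2"
    note lt = xs[OF se(1)] ds[OF se(1)] square_div_less[OF se(2)] square_mod_less[OF se(2)]
    show "(case (s, e) of (s, e) \<Rightarrow> \<Sum>y<n. Z y (d s) * munit n (x s) y $$ (e div n, e mod n)) =
      (case (s, e) of (s, e) \<Rightarrow> (munit n (x s) (d s) * W) $$ (e div n, e mod n))"
      by (cases "e div n = x s")
        (simp_all add: munit_mult_index[OF W] munit_index lt W_index sum_of_bool_eq)
  qed
  also have "\<dots> = discriminant n (\<lambda>s. W * munit n (x s) (d s))"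
    by (rule discriminant_left_eq_right[OF W, symmetric]) simp
  also have "\<dots> = det (mat (n\<^sup>2) (n\<^sup>2) (\<lambda>(s, e). \<Sum>y<n. Z (x s) y * munit n y (d s) $$ (e div n, e mod n)))"
    unfolding discriminant_def
  proof (intro arg_cong[where f = det] cong_mat refl)
    fix s e assume se: "s < n\<^sup>2" "e < n\<^sup>2"
    note lt = xs[OF se(1)] ds[OF se(1)] square_div_less[OF se(2)] square_mod_less[OF se(2)]
    show "(case (s, e) of (s, e) \<Rightarrow> (W * munit n (x s) (d s)) $$ (e div n, e mod n)) =
      (case (s, e) of (s, e) \<Rightarrow> \<Sum>y<n. Z (x s) y * munit n y (d s) $$ (e div n, e mod n))"
      by (cases "e mod n = d s")
        (simp_all add: mult_munit_index[OF W] munit_index lt W_index sum_of_bool_eq)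
  qed
  also have "\<dots> = (\<Sum>c \<in> indices n. (\<Prod>s<n\<^sup>2. Z (x s) (c s)) * levi n c d)"
    using det_rows_sum[where N = "n\<^sup>2" and Y = "{..<n}" and w = "\<lambda>s y. Z (x s) y"
        and f = "\<lambda>s y e. munit n y (d s) $$ (e div n, e mod n)"]
    by (simp add: indices_def levi_def discriminant_def)
  finally show ?thesis .
qed

abbreviation perms :: "nat \<Rightarrow> (nat \<Rightarrow> nat) set" where
  "perms N \<equiv> {\<pi>. \<pi> permutes {..<N}}"

text \<open>
  For fixed \<open>a\<close> and \<open>b\<close> this is the symmetrization of the tensor product of the matrix units with
  indices \<open>a s\<close> and \<open>b s\<close>, as a matrix in \<open>c\<close> and \<open>d\<close>.
\<close>

definition orbit_matrix ::
    "nat \<Rightarrow> (nat \<Rightarrow> nat) \<Rightarrow> (nat \<Rightarrow> nat) \<Rightarrow> (nat \<Rightarrow> nat) \<Rightarrow> (nat \<Rightarrow> nat) \<Rightarrow> int" where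
  "orbit_matrix n a b c d = (\<Sum>\<pi> \<in> perms (n\<^sup>2). of_bool (c = a \<circ> \<pi> \<and> d = b \<circ> \<pi>))"

lemma indices_comp_perm:
  assumes "x \<in> indices n" "\<pi> \<in> perms (n\<^sup>2)"
  shows "x \<circ> \<pi> \<in> indices n"
  unfolding indices_def
proof (rule PiE_I)
  fix s assume "s \<in> {..<n\<^sup>2}"
  hence "\<pi> s \<in> {..<n\<^sup>2}" using assms(2) by (simp add: permutes_in_image del: lessThan_iff)
  thus "(x \<circ> \<pi>) s \<in> {..<n}" using indices_less[OF assms(1)] by simp
next
  fix s assume s: "s \<notin> {..<n\<^sup>2}"
  hence "\<pi> s = s" using assms(2) by (simp add: permutes_not_in)
  thus "(x \<circ> \<pi>) s = undefined"
    using PiE_arb[OF assms(1)[unfolded indices_def] s] by simp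
qed

lemma eq_comp_perm_iff:
  assumes "x \<in> indices n" "c \<in> indices n" "\<pi> \<in> perms (n\<^sup>2)"
  shows "c = x \<circ> \<pi> \<longleftrightarrow> (\<forall>s<n\<^sup>2. c s = x (\<pi> s))"
proof
  assume *: "\<forall>s<n\<^sup>2. c s = x (\<pi> s)"
  show "c = x \<circ> \<pi>"
    using assms(2) indices_comp_perm[OF assms(1,3)] unfolding indices_def
    by (rule PiE_ext) (simp add: *)
qed simp

text \<open>
  By polarization the symmetrized tensor product is a combination of tensor powers of the sums of
  the matrix units over subsets.
\<close>

lemma levi_commutes_with_orbit_matrix:
  assumes x: "x \<in> indices n" and d: "d \<in> indices n" and a: "a \<in> indices n" and b: "b \<in> indices n"
  shows "(\<Sum>c \<in> indices n. levi n x c * orbit_matrix n a b c d) =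
    (\<Sum>c \<in> indices n. orbit_matrix n a b x c * levi n c d)"
proof -
  define Z where "Z S p q = (\<Sum>r \<in> S. of_bool (p = a r \<and> q = b r) :: int)" for S p q
  define \<epsilon> where "\<epsilon> S = (- 1 :: int) ^ card ({..<n\<^sup>2} - S)" for S
  have *: "orbit_matrix n a b c e = (\<Sum>S \<in> Pow {..<n\<^sup>2}. \<epsilon> S * (\<Prod>s<n\<^sup>2. Z S (c s) (e s)))"
    if "c \<in> indices n" "e \<in> indices n" for c e
  proof -
    have "orbit_matrix n a b c e = (\<Sum>\<pi> \<in> perms (n\<^sup>2). \<Prod>s<n\<^sup>2. of_bool (c s = a (\<pi> s) \<and> e s = b (\<pi> s)))"
      unfolding orbit_matrix_def
    proof (rule sum.cong[OF refl])
      fix \<pi> assume \<pi>: "\<pi> \<in> perms (n\<^sup>2)"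
      show "of_bool (c = a \<circ> \<pi> \<and> e = b \<circ> \<pi>) = (\<Prod>s<n\<^sup>2. of_bool (c s = a (\<pi> s) \<and> e s = b (\<pi> s)) :: int)"
      proof (cases "\<forall>s<n\<^sup>2. c s = a (\<pi> s) \<and> e s = b (\<pi> s)")
        case True
        thus ?thesis
          using eq_comp_perm_iff[OF a that(1) \<pi>] eq_comp_perm_iff[OF b that(2) \<pi>] by simp
      next
        case False
        then obtain s where "s < n\<^sup>2" "\<not> (c s = a (\<pi> s) \<and> e s = b (\<pi> s))" by blast
        hence "(\<Prod>s<n\<^sup>2. of_bool (c s = a (\<pi> s) \<and> e s = b (\<pi> s)) :: int) = 0"
          by (intro prod_zero) auto
        moreover have "\<not> (c = a \<circ> \<pi> \<and> e = b \<circ> \<pi>)"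
          using False by auto
        ultimately show ?thesis by simp
      qed
    qed
    also have "\<dots> = (\<Sum>S \<in> Pow {..<n\<^sup>2}. \<epsilon> S * (\<Prod>s<n\<^sup>2. Z S (c s) (e s)))"
      unfolding \<epsilon>_def Z_def
      by (rule permanent_polarization[where f = "\<lambda>r s. of_bool (c s = a r \<and> e s = b r)"]) simp
    finally show ?thesis .
  qed
  have "(\<Sum>c \<in> indices n. levi n x c * orbit_matrix n a b c d) =
    (\<Sum>S \<in> Pow {..<n\<^sup>2}. \<epsilon> S * (\<Sum>c \<in> indices n. levi n x c * (\<Prod>s<n\<^sup>2. Z S (c s) (d s))))"
    by (simp add: * d sum_distrib_left mult_ac) (rule sum.swap)
  also have "\<dots> = (\<Sum>S \<in> Pow {..<n\<^sup>2}. \<epsilon> S * (\<Sum>c \<in> indices n. (\<Prod>s<n\<^sup>2. Z S (x s) (c s)) * levi n c d))"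
    by (simp add: levi_commutes_with_tensor_power[OF x d])
  also have "\<dots> = (\<Sum>c \<in> indices n. orbit_matrix n a b x c * levi n c d)"
    by (simp add: * x sum_distrib_left sum_distrib_right mult_ac) (rule sum.swap)
  finally show ?thesis .
qed

text \<open>
  Averaging over a group is an orthogonal projection: the pairing of \<open>v\<close> with its average is,
  up to the order of the group, the square of the length of the average.
\<close>

lemma sum_perm_average:
  fixes v :: "(nat \<Rightarrow> nat) \<Rightarrow> int"
  assumes G: "G \<subseteq> perms (n\<^sup>2)"
    and comp: "\<And>\<pi> \<rho>. \<pi> \<in> G \<Longrightarrow> \<rho> \<in> G \<Longrightarrow> \<pi> \<circ> \<rho> \<in> G" and inv: "\<And>\<pi>. \<pi> \<in> G \<Longrightarrow> Hilbert_Choice.inv \<pi> \<in> G"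
  shows "int (card G) * (\<Sum>\<pi> \<in> G. \<Sum>b \<in> indices n. v b * v (b \<circ> \<pi>)) =
    (\<Sum>b \<in> indices n. (\<Sum>\<pi> \<in> G. v (b \<circ> \<pi>))\<^sup>2)"
proof -
  have "(\<Sum>b \<in> indices n. (\<Sum>\<pi> \<in> G. v (b \<circ> \<pi>))\<^sup>2) =
    (\<Sum>\<pi> \<in> G. \<Sum>\<rho> \<in> G. \<Sum>b \<in> indices n. v (b \<circ> \<pi>) * v (b \<circ> \<rho>))"
    by (simp add: power2_eq_square[of "sum _ _"] sum_product sum.swap[of _ _ "indices n"])
  also have "\<dots> = (\<Sum>\<pi> \<in> G. \<Sum>\<rho> \<in> G. \<Sum>b \<in> indices n. v b * v (b \<circ> \<rho>))"
  proof (rule sum.cong[OF refl])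
    fix \<pi> assume \<pi>: "\<pi> \<in> G"
    hence p: "\<pi> \<in> perms (n\<^sup>2)" using G by auto
    hence invo: "\<pi> \<circ> Hilbert_Choice.inv \<pi> = id" "Hilbert_Choice.inv \<pi> \<circ> \<pi> = id" by (auto simp: permutes_inv_o)
    have cancel: "\<pi> \<circ> (Hilbert_Choice.inv \<pi> \<circ> \<rho>) = \<rho>" "Hilbert_Choice.inv \<pi> \<circ> (\<pi> \<circ> \<rho>) = \<rho>" for \<rho> :: "nat \<Rightarrow> nat"
      by (simp_all add: o_assoc invo)
    have ip: "Hilbert_Choice.inv \<pi> \<in> perms (n\<^sup>2)" using p by (auto intro: permutes_inv)
    \<comment> \<open>translate by \<open>\<pi>\<close>, once in the group and once in the multi-indices\<close>
    have "(\<Sum>\<rho> \<in> G. \<Sum>b \<in> indices n. v (b \<circ> \<pi>) * v (b \<circ> \<rho>)) =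
      (\<Sum>\<rho> \<in> G. \<Sum>b \<in> indices n. v (b \<circ> \<pi>) * v (b \<circ> \<pi> \<circ> \<rho>))"
      by (rule sum.reindex_bij_witness[where i = "\<lambda>\<rho>. \<pi> \<circ> \<rho>" and j = "\<lambda>\<rho>. Hilbert_Choice.inv \<pi> \<circ> \<rho>"])
         (auto simp: \<pi> comp inv comp_assoc cancel)
    also have "\<dots> = (\<Sum>\<rho> \<in> G. \<Sum>b \<in> indices n. v b * v (b \<circ> \<rho>))"
    proof (rule sum.cong[OF refl])
      fix \<rho>
      show "(\<Sum>b \<in> indices n. v (b \<circ> \<pi>) * v (b \<circ> \<pi> \<circ> \<rho>)) = (\<Sum>b \<in> indices n. v b * v (b \<circ> \<rho>))"
        by (rule sum.reindex_bij_witness[where i = "\<lambda>b. b \<circ> Hilbert_Choice.inv \<pi>" and j = "\<lambda>b. b \<circ> \<pi>"])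
           (auto simp: comp_assoc invo intro: indices_comp_perm[OF _ p] indices_comp_perm[OF _ ip])
    qed
    finally show "(\<Sum>\<rho> \<in> G. \<Sum>b \<in> indices n. v (b \<circ> \<pi>) * v (b \<circ> \<rho>)) =
      (\<Sum>\<rho> \<in> G. \<Sum>b \<in> indices n. v b * v (b \<circ> \<rho>))" .
  qed
  finally show ?thesis by simp
qed

lemma levi_diagonal: "levi n (\<lambda>s\<in>{..<n\<^sup>2}. s div n) (\<lambda>s\<in>{..<n\<^sup>2}. s mod n) = 1"
proof -
  have "levi n (\<lambda>s\<in>{..<n\<^sup>2}. s div n) (\<lambda>s\<in>{..<n\<^sup>2}. s mod n) = det (1\<^sub>m (n\<^sup>2) :: 'a mat)"
    unfolding levi_def discriminant_def
  proof (intro arg_cong[where f = det] eq_matI)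
    fix r c assume "r < dim_row (1\<^sub>m (n\<^sup>2) :: 'a mat)" "c < dim_col (1\<^sub>m (n\<^sup>2) :: 'a mat)"
    moreover have "r = c" if "c div n = r div n" "c mod n = r mod n"
      using that by (metis div_mult_mod_eq)
    ultimately show "mat (n\<^sup>2) (n\<^sup>2) (\<lambda>(r, c). munit n ((\<lambda>s\<in>{..<n\<^sup>2}. s div n) r) ((\<lambda>s\<in>{..<n\<^sup>2}. s mod n) r) $$
        (c div n, c mod n)) $$ (r, c) = (1\<^sub>m (n\<^sup>2) :: 'a mat) $$ (r, c)"
      by (auto simp: munit_def square_div_less square_mod_less)
  qed simp_all
  thus ?thesis by simp
qed

text \<open>
  Write \<open>D\<close> for \<open>levi n\<close> and \<open>F\<close> for \<open>orbit_matrix n\<close>.  The squares of the numbers in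
  question, summed over all \<open>\<pi>\<close>, give the sum of \<open>D a c * D b d * F a b c d\<close> over all multi-indices.  Since \<open>D\<close> commutes with
  \<open>F a b\<close>, the sum over \<open>c\<close> moves the factor \<open>D\<close> to the other side, which leaves \<open>D b d * D e d\<close> with the
  weight \<open>F a b a e\<close>.  That weight only involves the stabilizer \<open>G a\<close> of \<open>a\<close>, and
  \<open>sum_perm_average\<close> makes each term nonnegative.  For the multi-indices \<open>a\<close>, \<open>d\<close> which
  run through all pairs once, the square that belongs to \<open>b = a\<close> is that of the order of \<open>G a\<close>.
\<close>

lemma levi_trace_nonzero:
  obtains \<pi> where "\<pi> \<in> perms (n\<^sup>2)" "(\<Sum>x \<in> indices n. levi n x (x \<circ> \<pi>) :: int) \<noteq> 0"
proof -
  let ?I = "indices n" and ?D = "levi n :: _ \<Rightarrow> _ \<Rightarrow> int" and ?F = "orbit_matrix n"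
  let ?P = "perms (n\<^sup>2)"
  define G where "G a = {\<pi> \<in> ?P. a \<circ> \<pi> = a}" for a :: "nat \<Rightarrow> nat"
  define Q where "Q a d = (\<Sum>\<pi> \<in> G a. \<Sum>b \<in> ?I. ?D b d * ?D (b \<circ> \<pi>) d)" for a d
  have finP: "finite ?P" by (simp add: finite_permutations)
  have finG: "finite (G a)" for a using finP by (simp add: G_def)
  have "(\<Sum>\<pi> \<in> ?P. (\<Sum>x \<in> ?I. ?D x (x \<circ> \<pi>))\<^sup>2) =
    (\<Sum>\<pi> \<in> ?P. \<Sum>a \<in> ?I. \<Sum>b \<in> ?I. ?D a (a \<circ> \<pi>) * ?D b (b \<circ> \<pi>))"
    by (simp add: power2_eq_square[of "sum _ _"] sum_product)
  also have "\<dots> = (\<Sum>\<pi> \<in> ?P. \<Sum>a \<in> ?I. \<Sum>b \<in> ?I. \<Sum>d \<in> ?I. \<Sum>c \<in> ?I.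
      ?D a c * ?D b d * of_bool (c = a \<circ> \<pi> \<and> d = b \<circ> \<pi>))"
  proof (intro sum.cong refl)
    fix \<pi> a b assume "\<pi> \<in> ?P" "a \<in> ?I" "b \<in> ?I"
    hence "a \<circ> \<pi> \<in> ?I" "b \<circ> \<pi> \<in> ?I" by (auto intro: indices_comp_perm)
    hence "(\<Sum>d \<in> ?I. \<Sum>c \<in> ?I. ?D a c * ?D b d * of_bool (c = a \<circ> \<pi> \<and> d = b \<circ> \<pi>)) =
      (\<Sum>d \<in> ?I. if d = b \<circ> \<pi> then ?D a (a \<circ> \<pi>) * ?D b d else 0)"
      by (intro sum.cong refl) (simp add: of_bool_def if_distrib sum.delta finite_indices cong: if_cong)
    thus "?D a (a \<circ> \<pi>) * ?D b (b \<circ> \<pi>) =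
      (\<Sum>d \<in> ?I. \<Sum>c \<in> ?I. ?D a c * ?D b d * of_bool (c = a \<circ> \<pi> \<and> d = b \<circ> \<pi>))"
      using \<open>b \<circ> \<pi> \<in> ?I\<close> by (simp add: sum.delta finite_indices)
  qed
  also have "\<dots> = (\<Sum>a \<in> ?I. \<Sum>b \<in> ?I. \<Sum>d \<in> ?I. \<Sum>c \<in> ?I. ?D b d * (?D a c * ?F a b c d))"
    by (simp add: orbit_matrix_def sum_distrib_left mult_ac sum.swap[of _ _ ?P])
  \<comment> \<open>commutation moves \<open>D\<close> across the symmetrized matrix unit, so that it no longer involves \<open>a\<close>\<close>
  also have "\<dots> = (\<Sum>a \<in> ?I. \<Sum>b \<in> ?I. \<Sum>d \<in> ?I. ?D b d * (\<Sum>c \<in> ?I. ?F a b a c * ?D c d))"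
    by (simp add: levi_commutes_with_orbit_matrix sum_distrib_left[symmetric])
  also have "\<dots> = (\<Sum>a \<in> ?I. \<Sum>d \<in> ?I. Q a d)"
  proof (rule sum.cong[OF refl])
    fix a assume a: "a \<in> ?I"
    have inner: "(\<Sum>c \<in> ?I. ?F a b a c * ?D c d) = (\<Sum>\<pi> \<in> G a. ?D (b \<circ> \<pi>) d)" if b: "b \<in> ?I" for b d
    proof -
      have "(\<Sum>c \<in> ?I. ?F a b a c * ?D c d) =
        (\<Sum>\<pi> \<in> ?P. \<Sum>c \<in> ?I. of_bool (a = a \<circ> \<pi> \<and> c = b \<circ> \<pi>) * ?D c d)"
        by (simp add: orbit_matrix_def sum_distrib_right sum.swap[of _ _ ?P])
      also have "\<dots> = (\<Sum>\<pi> \<in> ?P. if a \<circ> \<pi> = a then ?D (b \<circ> \<pi>) d else 0)"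
      proof (rule sum.cong[OF refl])
        fix \<pi> assume "\<pi> \<in> ?P"
        hence "b \<circ> \<pi> \<in> ?I" using b by (auto intro: indices_comp_perm)
        thus "(\<Sum>c \<in> ?I. of_bool (a = a \<circ> \<pi> \<and> c = b \<circ> \<pi>) * ?D c d) =
          (if a \<circ> \<pi> = a then ?D (b \<circ> \<pi>) d else 0)"
          by (auto simp: of_bool_def if_distrib if_distribR sum.delta finite_indices cong: if_cong)
      qed
      also have "\<dots> = (\<Sum>\<pi> \<in> G a. ?D (b \<circ> \<pi>) d)"
        unfolding G_def by (rule sum.inter_filter[OF finP, symmetric])
      finally show ?thesis .
    qed
    have "(\<Sum>b \<in> ?I. \<Sum>d \<in> ?I. ?D b d * (\<Sum>c \<in> ?I. ?F a b a c * ?D c d)) =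
      (\<Sum>b \<in> ?I. \<Sum>d \<in> ?I. \<Sum>\<pi> \<in> G a. ?D b d * ?D (b \<circ> \<pi>) d)"
      by (simp add: inner sum_distrib_left)
    also have "\<dots> = (\<Sum>d \<in> ?I. \<Sum>b \<in> ?I. \<Sum>\<pi> \<in> G a. ?D b d * ?D (b \<circ> \<pi>) d)"
      by (rule sum.swap)
    also have "\<dots> = (\<Sum>d \<in> ?I. Q a d)"
      unfolding Q_def by (intro sum.cong refl sum.swap)
    finally show "(\<Sum>b \<in> ?I. \<Sum>d \<in> ?I. ?D b d * (\<Sum>c \<in> ?I. ?F a b a c * ?D c d)) = (\<Sum>d \<in> ?I. Q a d)" .
  qed
  finally have total: "(\<Sum>\<pi> \<in> ?P. (\<Sum>x \<in> ?I. ?D x (x \<circ> \<pi>))\<^sup>2) = (\<Sum>a \<in> ?I. \<Sum>d \<in> ?I. Q a d)" .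
  have idG: "id \<in> G a" for a by (simp add: G_def permutes_id)
  have cardG: "int (card (G a)) > 0" for a
    using idG finG by (auto simp: card_gt_0_iff)
  have avg: "int (card (G a)) * Q a d = (\<Sum>b \<in> ?I. (\<Sum>\<pi> \<in> G a. ?D (b \<circ> \<pi>) d)\<^sup>2)" for a d
    unfolding Q_def
  proof (rule sum_perm_average)
    show "G a \<subseteq> ?P" by (auto simp: G_def)
    show "\<pi> \<circ> \<rho> \<in> G a" if "\<pi> \<in> G a" "\<rho> \<in> G a" for \<pi> \<rho>
      using that by (auto simp: G_def o_assoc intro: permutes_compose)
    show "Hilbert_Choice.inv \<pi> \<in> G a" if "\<pi> \<in> G a" for \<pi>
    proof -
      have p: "\<pi> permutes {..<n\<^sup>2}" and "a \<circ> \<pi> = a" using that by (auto simp: G_def)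
      hence "a \<circ> Hilbert_Choice.inv \<pi> = a \<circ> \<pi> \<circ> Hilbert_Choice.inv \<pi>" by simp
      also have "\<dots> = a" by (simp add: comp_assoc permutes_inv_o[OF p])
      finally show ?thesis using p by (auto simp: G_def intro: permutes_inv)
    qed
  qed
  have nonneg: "Q a d \<ge> 0" for a d
  proof -
    have "int (card (G a)) * Q a d \<ge> 0" unfolding avg by (intro sum_nonneg) simp
    thus ?thesis using cardG[of a] by (simp add: zero_le_mult_iff)
  qed
  \<comment> \<open>the multi-indices at which the matrix units \<open>a s\<close>, \<open>d s\<close> run through all of them in order\<close>
  define a where "a = (\<lambda>s\<in>{..<n\<^sup>2}. s div n)"
  define d where "d = (\<lambda>s\<in>{..<n\<^sup>2}. s mod n)"
  have ad: "a \<in> ?I" "d \<in> ?I" by (simp_all add: a_def d_def indices_def restrict_PiE_iff square_div_less square_mod_less)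
  have "(\<Sum>\<pi> \<in> G a. ?D (a \<circ> \<pi>) d) = (\<Sum>\<pi> \<in> G a. 1)"
    by (rule sum.cong) (auto simp: G_def a_def d_def levi_diagonal)
  hence "0 < (\<Sum>\<pi> \<in> G a. ?D (a \<circ> \<pi>) d)\<^sup>2"
    using cardG[of a] by simp
  also have "\<dots> \<le> int (card (G a)) * Q a d"
    unfolding avg by (rule member_le_sum) (use ad finite_indices in auto)
  finally have "Q a d > 0" using cardG[of a] by (simp add: zero_less_mult_iff)
  also have "Q a d \<le> (\<Sum>d \<in> ?I. Q a d)"
    by (rule member_le_sum) (use ad finite_indices nonneg in auto)
  also have "\<dots> \<le> (\<Sum>a \<in> ?I. \<Sum>d \<in> ?I. Q a d)"
    by (rule member_le_sum[where f = "\<lambda>a. \<Sum>d \<in> ?I. Q a d"])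
       (use ad finite_indices nonneg in \<open>auto intro: sum_nonneg\<close>)
  finally have "(\<Sum>\<pi> \<in> ?P. (\<Sum>x \<in> ?I. ?D x (x \<circ> \<pi>))\<^sup>2) \<noteq> 0"
    using total by simp
  then obtain \<pi> where "\<pi> \<in> ?P" "(\<Sum>x \<in> ?I. ?D x (x \<circ> \<pi>))\<^sup>2 \<noteq> 0"
    by (meson sum.neutral)
  thus ?thesis using that by simp
qed


section \<open>The discriminant lies in the trace ring\<close>

lemma a_inv_ring_mat:
  assumes "A \<in> carrier_mat n n"
  shows "a_inv (ring_mat TYPE('a::comm_ring_1) n ()) A = - A"
proof -
  interpret ring "ring_mat TYPE('a) n ()" by (rule ring_mat)
  show ?thesis
    by (rule minus_equality) (use assms in \<open>auto simp: ring_mat_simps\<close>)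
qed

lemma subring_gen_carrier:
  assumes "S \<subseteq> carrier_mat n n" "A \<in> subring_gen n S"
  shows "A \<in> carrier_mat n n"
  using assms(2) unfolding subring_gen_def
  by (induction rule: generate_ring.induct) (use assms(1) in \<open>auto simp: ring_mat_simps a_inv_ring_mat\<close>)

lemma subring_gen_induct [consumes 2, case_names one incl uminus add mult]:
  assumes S: "S \<subseteq> carrier_mat n n" and A: "A \<in> subring_gen n S"
    and "P (1\<^sub>m n)" and "\<And>A. A \<in> S \<Longrightarrow> P A"
    and "\<And>A. A \<in> carrier_mat n n \<Longrightarrow> P A \<Longrightarrow> P (- A)"
    and "\<And>A B. A \<in> carrier_mat n n \<Longrightarrow> B \<in> carrier_mat n n \<Longrightarrow> P A \<Longrightarrow> P B \<Longrightarrow> P (A + B)"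
    and "\<And>A B. A \<in> carrier_mat n n \<Longrightarrow> B \<in> carrier_mat n n \<Longrightarrow> P A \<Longrightarrow> P B \<Longrightarrow> P (A * B)"
  shows "P A"
  using A unfolding subring_gen_def
  by (induction rule: generate_ring.induct)
     (use subring_gen_carrier[OF S, unfolded subring_gen_def] assms(3-)
       in \<open>auto simp: ring_mat_simps a_inv_ring_mat\<close>)

lemma subring_gen_one: "1\<^sub>m n \<in> subring_gen n S"
  using generate_ring.one[of "ring_mat TYPE('a::comm_ring_1) n ()" S]
  by (simp add: subring_gen_def ring_mat_simps)

lemma subring_gen_incl: "A \<in> S \<Longrightarrow> A \<in> subring_gen n S"
  by (simp add: subring_gen_def generate_ring.incl)

lemma subring_gen_add: "A \<in> subring_gen n S \<Longrightarrow> B \<in> subring_gen n S \<Longrightarrow> A + B \<in> subring_gen n S"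
  using generate_ring.eng_add[of A "ring_mat TYPE('a::comm_ring_1) n ()" S B]
  by (simp add: subring_gen_def ring_mat_simps)

lemma subring_gen_mult: "A \<in> subring_gen n S \<Longrightarrow> B \<in> subring_gen n S \<Longrightarrow> A * B \<in> subring_gen n S"
  using generate_ring.eng_mult[of A "ring_mat TYPE('a::comm_ring_1) n ()" S B]
  by (simp add: subring_gen_def ring_mat_simps)

lemma scalar_carrier [simp]: "scalar n a \<in> carrier_mat n n"
  by (simp add: scalar_def)

lemma scalar_index [simp]: "i < n \<Longrightarrow> j < n \<Longrightarrow> scalar n a $$ (i, j) = (if i = j then a else 0)"
  by (simp add: scalar_def)

lemma scalar_one: "scalar n 1 = 1\<^sub>m n"
  by (rule eq_matI) (auto simp: scalar_def)

lemma scalar_add: "scalar n (a + b) = scalar n a + scalar n b"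
  by (rule eq_matI) (auto simp: scalar_def)

lemma scalar_uminus: "scalar n (- a) = - scalar n a"
  by (rule eq_matI) (auto simp: scalar_def)

lemma scalar_mult: "scalar n (a * b) = scalar n a * scalar n b"
proof -
  have "scalar n a * scalar n b = a \<cdot>\<^sub>m (b \<cdot>\<^sub>m (1\<^sub>m n * 1\<^sub>m n))"
    by (simp add: scalar_def mult_smult_assoc_mat[of "1\<^sub>m n" n n _ n])
  also have "\<dots> = scalar n (a * b)"
    by (rule eq_matI) (simp_all add: scalar_def)
  finally show ?thesis ..
qed

lemma generic_carrier [simp]: "generic n h \<in> carrier_mat n n"
  by (simp add: generic_def)

lemma base_field_carrier: "base_field n \<subseteq> carrier_mat n n"
  by (auto simp: base_field_def)

lemma generic_alg_gens_carrier: "base_field n \<union> generic n ` {..<m} \<subseteq> carrier_mat n n"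
  using base_field_carrier by auto

lemma generic_alg_carrier: "generic_alg m n \<subseteq> carrier_mat n n"
  using subring_gen_carrier[OF generic_alg_gens_carrier]
  by (auto simp: generic_alg_def subalg_gen_def)

lemma trace_ring_gens_carrier:
  "generic_alg m n \<union> (\<lambda>Y. scalar n (mat_tr Y)) ` generic_alg m n \<subseteq> carrier_mat n n"
  using generic_alg_carrier by auto

lemma generic_in_generic_alg: "h < m \<Longrightarrow> generic n h \<in> generic_alg m n"
  by (auto simp: generic_alg_def subalg_gen_def intro: subring_gen_incl)

lemma generic_alg_mult: "A \<in> generic_alg m n \<Longrightarrow> B \<in> generic_alg m n \<Longrightarrow> A * B \<in> generic_alg m n"
  by (auto simp: generic_alg_def subalg_gen_def intro: subring_gen_mult)

lemma trace_in_trace_ring: "A \<in> generic_alg m n \<Longrightarrow> scalar n (mat_tr A) \<in> trace_ring m n"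
  by (auto simp: trace_ring_def intro: subring_gen_incl)

lemma trace_ring_add: "A \<in> trace_ring m n \<Longrightarrow> B \<in> trace_ring m n \<Longrightarrow> A + B \<in> trace_ring m n"
  by (auto simp: trace_ring_def intro: subring_gen_add)

lemma trace_ring_mult: "A \<in> trace_ring m n \<Longrightarrow> B \<in> trace_ring m n \<Longrightarrow> A * B \<in> trace_ring m n"
  by (auto simp: trace_ring_def intro: subring_gen_mult)

lemma trace_ring_one: "1\<^sub>m n \<in> trace_ring m n"
  by (simp add: trace_ring_def subring_gen_one)

lemma base_field_trace_ring: "base_field n \<subseteq> trace_ring m n"
  by (auto simp: trace_ring_def generic_alg_def subalg_gen_def intro!: subring_gen_incl)

lemma const_trace_ring: "scalar n (emb (const c)) \<in> trace_ring m n"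
  using base_field_trace_ring[of n m] unfolding base_field_def by blast

lemma zero_trace_ring: "scalar n 0 \<in> trace_ring m n"
  using const_trace_ring[of n 0] by simp

lemma scalar_sum_trace_ring:
  "(\<And>a. a \<in> A \<Longrightarrow> scalar n (f a) \<in> trace_ring m n) \<Longrightarrow> scalar n (\<Sum>a \<in> A. f a) \<in> trace_ring m n"
  by (induction A rule: infinite_finite_induct)
     (simp_all add: zero_trace_ring scalar_add trace_ring_add)

text \<open>
  With \<open>\<pi>\<close> a permutation of \<open>S\<close> this is the product over the cycles of \<open>\<pi>\<close> of the traces of the
  products of the \<open>X s\<close> along the cycle.  The closed form avoids an explicit cycle decomposition.
\<close>

definition trace_monomial :: "nat \<Rightarrow> nat set \<Rightarrow> (nat \<Rightarrow> nat) \<Rightarrow> (nat \<Rightarrow> 'a::comm_ring_1 mat) \<Rightarrow> 'a" where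
  "trace_monomial n S \<pi> X = (\<Sum>i \<in> S \<rightarrow>\<^sub>E {..<n}. \<Prod>s \<in> S. X s $$ (i s, i (\<pi> s)))"

lemma sum_PiE_insert:
  fixes f :: "('b \<Rightarrow> 'c) \<Rightarrow> 'a::comm_monoid_add"
  assumes "t \<notin> S"
  shows "(\<Sum>i \<in> insert t S \<rightarrow>\<^sub>E B. f i) = (\<Sum>i \<in> S \<rightarrow>\<^sub>E B. \<Sum>y \<in> B. f (i(t := y)))"
proof -
  have "(\<Sum>i \<in> insert t S \<rightarrow>\<^sub>E B. f i) = (\<Sum>(y, i) \<in> B \<times> (S \<rightarrow>\<^sub>E B). f (i(t := y)))"
    unfolding PiE_insert_eq
    by (subst sum.reindex[OF inj_combinator[OF assms]]) (simp add: o_def split_def)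
  also have "\<dots> = (\<Sum>y \<in> B. \<Sum>i \<in> S \<rightarrow>\<^sub>E B. f (i(t := y)))"
    by (rule sum.cartesian_product[symmetric])
  also have "\<dots> = (\<Sum>i \<in> S \<rightarrow>\<^sub>E B. \<Sum>y \<in> B. f (i(t := y)))"
    by (rule sum.swap)
  finally show ?thesis .
qed

text \<open>
  A fixed point of \<open>\<pi>\<close> is a cycle of length one and splits off as a trace.
\<close>

lemma trace_monomial_fixed_point:
  assumes S: "finite S" "s \<in> S" and \<pi>: "bij_betw \<pi> S S" "\<pi> s = s" and X: "X s \<in> carrier_mat n n"
  shows "trace_monomial n S \<pi> X = mat_tr (X s) * trace_monomial n (S - {s}) \<pi> X"
proof -
  define S' where "S' = S - {s}"
  have S': "S = insert s S'" "s \<notin> S'" "finite S'" using S by (auto simp: S'_def)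
  have "\<pi> r \<noteq> s" if "r \<in> S'" for r
    using \<pi> that S by (metis S'_def DiffE bij_betw_imp_inj_on inj_onD insertI1)
  hence "(\<Prod>r \<in> S'. X r $$ ((i(s := y)) r, (i(s := y)) (\<pi> r))) = (\<Prod>r \<in> S'. X r $$ (i r, i (\<pi> r)))"
    for i :: "nat \<Rightarrow> nat" and y
    using S' by (intro prod.cong) auto
  hence "trace_monomial n S \<pi> X = (\<Sum>i \<in> S' \<rightarrow>\<^sub>E {..<n}. \<Sum>y<n. X s $$ (y, y) * (\<Prod>r \<in> S'. X r $$ (i r, i (\<pi> r))))"
    unfolding trace_monomial_def S'(1) sum_PiE_insert[OF S'(2)]
    using S' \<pi> by (simp del: fun_upd_apply add: fun_upd_same)
  also have "\<dots> = mat_tr (X s) * trace_monomial n S' \<pi> X"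
    using X by (simp add: trace_monomial_def mat_tr_def sum_distrib_left sum_distrib_right)
  finally show ?thesis by (simp add: S'_def)
qed

text \<open>
  Summing over the index at \<open>t = \<pi> s\<close> multiplies \<open>X s\<close> and \<open>X t\<close>, which shortens the cycle by one.
\<close>

lemma trace_monomial_contract:
  assumes S: "finite S" "s \<in> S" and \<pi>: "bij_betw \<pi> S S" and t: "t = \<pi> s" "t \<noteq> s"
    and X: "X s \<in> carrier_mat n n" "X t \<in> carrier_mat n n"
  shows "trace_monomial n S \<pi> X = trace_monomial n (S - {t}) (\<pi>(s := \<pi> t)) (X(s := X s * X t))"
proof -
  define S' where "S' = S - {t}"
  define R where "R = S' - {s}"
  have "t \<in> S" using S \<pi> t by (auto simp: bij_betw_def)
  have inj: "inj_on \<pi> S" using \<pi> by (rule bij_betw_imp_inj_on)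
  have S': "S = insert t S'" "t \<notin> S'" "finite S'" "s \<in> S'" using S t \<open>t \<in> S\<close> by (auto simp: S'_def)
  have R: "S' = insert s R" "s \<notin> R" "t \<notin> R" "finite R" using S' by (auto simp: R_def)
  have \<pi>R: "\<pi> r \<noteq> t" if "r \<in> insert t R" for r
    using inj that S' R t S by (metis inj_on_def insertCI insertE)
  have "\<pi> t \<in> S" using \<pi> \<open>t \<in> S\<close> by (auto simp: bij_betw_def)
  hence \<pi>t: "\<pi> t \<in> S'" using \<pi>R[of t] by (auto simp: S'_def)
  have contracted: "(\<Sum>y<n. \<Prod>r \<in> S. X r $$ ((i(t := y)) r, (i(t := y)) (\<pi> r))) =
    (\<Prod>r \<in> S'. (X(s := X s * X t)) r $$ (i r, i ((\<pi>(s := \<pi> t)) r)))"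
    if i: "i \<in> S' \<rightarrow>\<^sub>E {..<n}" for i
  proof -
    have lt: "i s < n" "i (\<pi> t) < n"
      using PiE_mem[OF i S'(4)] PiE_mem[OF i \<pi>t] by simp_all
    have "(\<Prod>r \<in> R. X r $$ ((i(t := y)) r, (i(t := y)) (\<pi> r))) = (\<Prod>r \<in> R. X r $$ (i r, i (\<pi> r)))" for y
      using R \<pi>R by (intro prod.cong) auto
    hence "(\<Prod>r \<in> S. X r $$ ((i(t := y)) r, (i(t := y)) (\<pi> r))) =
      X t $$ (y, i (\<pi> t)) * (X s $$ (i s, y) * (\<Prod>r \<in> R. X r $$ (i r, i (\<pi> r))))" for y
      unfolding S'(1) R(1) using R t \<pi>R[of t] by simp
    hence "(\<Sum>y<n. \<Prod>r \<in> S. X r $$ ((i(t := y)) r, (i(t := y)) (\<pi> r))) =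
      (\<Sum>y<n. X s $$ (i s, y) * X t $$ (y, i (\<pi> t))) * (\<Prod>r \<in> R. X r $$ (i r, i (\<pi> r)))"
      by (simp only: sum_distrib_left sum_distrib_right mult_ac)
    also have "(\<Sum>y<n. X s $$ (i s, y) * X t $$ (y, i (\<pi> t))) = (X s * X t) $$ (i s, i (\<pi> t))"
      using X lt by (simp add: scalar_prod_def lessThan_atLeast0)
    also have "(\<Prod>r \<in> R. X r $$ (i r, i (\<pi> r))) =
        (\<Prod>r \<in> R. (X(s := X s * X t)) r $$ (i r, i ((\<pi>(s := \<pi> t)) r)))"
      using R by (intro prod.cong) auto
    finally show ?thesis
      unfolding R(1) using R by simp
  qed
  have "trace_monomial n S \<pi> X =
    (\<Sum>i \<in> S' \<rightarrow>\<^sub>E {..<n}. \<Sum>y<n. \<Prod>r \<in> S. X r $$ ((i(t := y)) r, (i(t := y)) (\<pi> r)))"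
    unfolding trace_monomial_def by (subst S'(1), subst sum_PiE_insert[OF S'(2)]) (rule refl)
  also have "\<dots> = trace_monomial n S' (\<pi>(s := \<pi> t)) (X(s := X s * X t))"
    unfolding trace_monomial_def by (rule sum.cong[OF refl contracted])
  finally show ?thesis by (simp add: S'_def)
qed

text \<open>
  Removing fixed points and contracting longer cycles reduces the number of positions.
\<close>

lemma trace_monomial_in_trace_ring:
  assumes "finite S" "bij_betw \<pi> S S" "\<And>s. s \<in> S \<Longrightarrow> X s \<in> generic_alg m n"
  shows "scalar n (trace_monomial n S \<pi> X) \<in> trace_ring m n"
  using assms
proof (induction S arbitrary: \<pi> X rule: finite_remove_induct)
  case empty
  show ?case by (simp add: trace_monomial_def scalar_one trace_ring_one)
next
  case (remove S)
  have X: "X s \<in> carrier_mat n n" if "s \<in> S" for s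
    using remove.prems(2)[OF that] generic_alg_carrier by blast
  obtain s where s: "s \<in> S" using remove.hyps by auto
  have \<pi>: "inj_on \<pi> S" "\<pi> ` S = S" using remove.prems(1) by (auto simp: bij_betw_def)
  show ?case
  proof (cases "\<pi> s = s")
    case True
    have "bij_betw \<pi> (S - {s}) (S - {s})"
      using \<pi> s True by (auto simp: bij_betw_def inj_on_image_set_diff inj_on_diff)
    hence "scalar n (trace_monomial n (S - {s}) \<pi> X) \<in> trace_ring m n"
      using s by (intro remove.IH) (auto simp: remove.prems)
    thus ?thesis
      using s remove.prems(2)[OF s]
      by (simp add: trace_monomial_fixed_point[of S s \<pi> X n] remove.hyps remove.prems True X
          scalar_mult trace_ring_mult trace_in_trace_ring)
  next
    case False
    define t where "t = \<pi> s"
    have t: "t \<in> S" "t \<noteq> s" using \<pi> s False by (auto simp: t_def)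
    have "bij_betw (\<pi>(s := \<pi> t)) (S - {t}) (S - {t})"
    proof (rule bij_betw_imageI)
      show "inj_on (\<pi>(s := \<pi> t)) (S - {t})"
        using \<pi>(1) s t by (auto simp: inj_on_def)
      \<comment> \<open>after the contraction \<open>s\<close> takes over the successor of \<open>t\<close>\<close>
      have "\<pi> t \<noteq> t" using \<pi>(1) s t by (metis t_def inj_onD)
      have "(\<pi>(s := \<pi> t)) ` (S - {t}) \<subseteq> S - {t}"
        using \<pi> s t \<open>\<pi> t \<noteq> t\<close> by (auto simp: t_def inj_on_def)
      moreover have "S - {t} \<subseteq> (\<pi>(s := \<pi> t)) ` (S - {t})"
      proof
        fix y assume y: "y \<in> S - {t}"
        then obtain r where r: "r \<in> S" "y = \<pi> r" using \<pi> by blast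
        hence "r \<noteq> s" using y by (auto simp: t_def)
        show "y \<in> (\<pi>(s := \<pi> t)) ` (S - {t})"
        proof (cases "r = t")
          case True
          show ?thesis by (rule image_eqI[of _ _ s]) (use r True s t in auto)
        next
          case False
          show ?thesis by (rule image_eqI[of _ _ r]) (use r False \<open>r \<noteq> s\<close> in auto)
        qed
      qed
      ultimately show "(\<pi>(s := \<pi> t)) ` (S - {t}) = S - {t}" by blast
    qed
    hence "scalar n (trace_monomial n (S - {t}) (\<pi>(s := \<pi> t)) (X(s := X s * X t))) \<in> trace_ring m n"
      using s t by (intro remove.IH)
        (auto simp: remove.prems generic_alg_mult simp del: fun_upd_apply, auto simp: remove.prems generic_alg_mult)
    thus ?thesis
      using s t by (subst trace_monomial_contract[of S s \<pi> t X n])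
        (auto simp: remove.hyps remove.prems X t_def)
  qed
qed

text \<open>
  For each fixed multi-index \<open>x\<close> the alternating sum is a determinant.  Its matrix is the product of
  the coordinate matrix of the \<open>X r\<close> and the transpose of that of the matrix units at \<open>x\<close> and
  \<open>x \<circ> \<pi>\<close>.
\<close>

lemma alternating_trace_monomial:
  fixes X :: "nat \<Rightarrow> 'a::comm_ring_1 mat"
  assumes X: "\<And>r. r < n\<^sup>2 \<Longrightarrow> X r \<in> carrier_mat n n" and \<pi>: "\<pi> \<in> perms (n\<^sup>2)"
  shows "(\<Sum>\<sigma> \<in> perms (n\<^sup>2). signof \<sigma> * trace_monomial n {..<n\<^sup>2} \<pi> (\<lambda>s. X (\<sigma> s))) =
    discriminant n X * (\<Sum>x \<in> indices n. levi n x (x \<circ> \<pi>))"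
proof -
  have "(\<Sum>\<sigma> \<in> perms (n\<^sup>2). signof \<sigma> * trace_monomial n {..<n\<^sup>2} \<pi> (\<lambda>s. X (\<sigma> s))) =
    (\<Sum>x \<in> indices n. \<Sum>\<sigma> \<in> perms (n\<^sup>2). signof \<sigma> * (\<Prod>s<n\<^sup>2. X (\<sigma> s) $$ (x s, x (\<pi> s))))"
    unfolding trace_monomial_def indices_def sum_distrib_left by (rule sum.swap)
  also have "\<dots> = (\<Sum>x \<in> indices n. discriminant n X * levi n x (x \<circ> \<pi>))"
  proof (rule sum.cong[OF refl])
    fix x assume x: "x \<in> indices n"
    hence x\<pi>: "x \<circ> \<pi> \<in> indices n" using \<pi> by (rule indices_comp_perm)
    define M where "M = mat (n\<^sup>2) (n\<^sup>2) (\<lambda>(r, s). X r $$ (x s, x (\<pi> s)))"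
    define L :: "'a mat" where "L = coords n (\<lambda>s. munit n (x s) (x (\<pi> s)))"
    have L: "L \<in> carrier_mat (n\<^sup>2) (n\<^sup>2)" by (simp add: L_def)
    have "M = coords n X * transpose_mat L"
    proof (rule eq_matI)
      fix r s assume "r < dim_row (coords n X * transpose_mat L)" "s < dim_col (coords n X * transpose_mat L)"
      hence r: "r < n\<^sup>2" and s: "s < n\<^sup>2" by (auto simp: coords_def L_def)
      have xs: "x s < n" "x (\<pi> s) < n"
        using indices_less[OF x s] indices_less[OF x\<pi> s] by simp_all
      have "(coords n X * transpose_mat L) $$ (r, s) =
        (\<Sum>d<n\<^sup>2. X r $$ (d div n, d mod n) * of_bool (d div n = x s \<and> d mod n = x (\<pi> s)))"
        using r s by (auto simp: coords_def L_def scalar_prod_def lessThan_atLeast0 munit_def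
            square_div_less square_mod_less intro!: sum.cong)
      also have "\<dots> = (\<Sum>a<n. \<Sum>b<n. X r $$ (a, b) * of_bool (a = x s \<and> b = x (\<pi> s)))"
        by (rule sum_square_div_mod[where f = "\<lambda>a b. X r $$ (a, b) * of_bool (a = x s \<and> b = x (\<pi> s))"])
      also have "\<dots> = (\<Sum>a<n. if a = x s then X r $$ (a, x (\<pi> s)) else 0)"
        using xs by (intro sum.cong refl) (simp add: of_bool_def if_distrib sum.delta cong: if_cong)
      also have "\<dots> = X r $$ (x s, x (\<pi> s))" using xs by simp
      finally show "M $$ (r, s) = (coords n X * transpose_mat L) $$ (r, s)"
        using r s by (simp add: M_def)
    qed (auto simp: M_def coords_def L_def)
    hence "det M = discriminant n X * det (transpose_mat L)"
      by (simp add: det_mult[of _ "n\<^sup>2"] L discriminant_coords)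
    also have "\<dots> = discriminant n X * levi n x (x \<circ> \<pi>)"
      by (simp add: det_transpose[OF L]) (simp add: L_def levi_def discriminant_coords)
    also have "det M = (\<Sum>\<sigma> \<in> perms (n\<^sup>2). signof \<sigma> * (\<Prod>s<n\<^sup>2. X (\<sigma> s) $$ (x s, x (\<pi> s))))"
      by (subst det_col[of _ "n\<^sup>2"]) (auto simp: M_def lessThan_atLeast0 permutes_upto_less intro!: sum.cong
          arg_cong2[where f = "(*)"] prod.cong)
    finally show "(\<Sum>\<sigma> \<in> perms (n\<^sup>2). signof \<sigma> * (\<Prod>s<n\<^sup>2. X (\<sigma> s) $$ (x s, x (\<pi> s)))) =
      discriminant n X * levi n x (x \<circ> \<pi>)" .
  qed
  finally show ?thesis by (simp add: sum_distrib_left)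
qed

lemma levi_of_int: "levi n x y = (of_int (levi n x y) :: 'a::comm_ring_1)"
proof -
  have "levi n x y = discriminant n (\<lambda>s. map_mat of_int (munit n (x s) (y s)) :: 'a mat)"
    unfolding levi_def by (rule discriminant_cong) (simp add: munit_def)
  also have "\<dots> = of_int (levi n x y)"
    unfolding levi_def by (rule of_int_hom.discriminant_hom) simp
  finally show ?thesis .
qed

lemma of_int_ratfun: "of_int z = emb (const (of_int z))"
  by (simp add: const.hom_of_int emb.hom_of_int)

text \<open>
  An alternating sum of trace monomials with \<open>c\<^sub>\<pi> \<noteq> 0\<close> can be divided by \<open>c\<^sub>\<pi>\<close> in characteristic zero.
\<close>

lemma Delta_in_trace_ring:
  "scalar n (Delta n :: 'k::field_char_0 ratfun) \<in> trace_ring (n\<^sup>2) n"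
proof -
  obtain \<pi> where \<pi>: "\<pi> \<in> perms (n\<^sup>2)" and c0: "(\<Sum>x \<in> indices n. levi n x (x \<circ> \<pi>) :: int) \<noteq> 0"
    by (rule levi_trace_nonzero)
  define c where "c = (\<Sum>x \<in> indices n. levi n x (x \<circ> \<pi>) :: int)"
  have "(\<Sum>x \<in> indices n. levi n x (x \<circ> \<pi>)) = (of_int c :: 'k ratfun)"
    unfolding c_def of_int_sum by (subst levi_of_int) (rule refl)
  hence c: "(\<Sum>x \<in> indices n. levi n x (x \<circ> \<pi>)) = (emb (const (of_int c)) :: 'k ratfun)"
    by (simp only: of_int_ratfun)
  have "scalar n (\<Sum>\<sigma> \<in> perms (n\<^sup>2). signof \<sigma> * trace_monomial n {..<n\<^sup>2} \<pi> (\<lambda>s. generic n (\<sigma> s)) :: 'k ratfun)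
      \<in> trace_ring (n\<^sup>2) n"
  proof (rule scalar_sum_trace_ring)
    fix \<sigma> assume \<sigma>: "\<sigma> \<in> perms (n\<^sup>2)"
    have "scalar n (trace_monomial n {..<n\<^sup>2} \<pi> (\<lambda>s. generic n (\<sigma> s)) :: 'k ratfun) \<in> trace_ring (n\<^sup>2) n"
    proof (rule trace_monomial_in_trace_ring)
      show "bij_betw \<pi> {..<n\<^sup>2} {..<n\<^sup>2}" using \<pi> by (simp add: permutes_imp_bij)
      fix s assume "s \<in> {..<n\<^sup>2}"
      hence "\<sigma> s \<in> {..<n\<^sup>2}" using \<sigma> by (simp add: permutes_in_image del: lessThan_iff)
      thus "generic n (\<sigma> s) \<in> generic_alg (n\<^sup>2) n" by (simp add: generic_in_generic_alg)
    qed simp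
    thus "scalar n (signof \<sigma> * trace_monomial n {..<n\<^sup>2} \<pi> (\<lambda>s. generic n (\<sigma> s)) :: 'k ratfun) \<in> trace_ring (n\<^sup>2) n"
      unfolding scalar_mult by (subst of_int_ratfun) (intro trace_ring_mult const_trace_ring)
  qed
  hence "scalar n (emb (const (inverse (of_int c))) * ((Delta n :: 'k ratfun) * emb (const (of_int c)))) \<in> trace_ring (n\<^sup>2) n"
    unfolding scalar_mult[of n "emb (const (inverse (of_int c)))"]
    by (intro trace_ring_mult const_trace_ring)
       (simp add: alternating_trace_monomial[OF _ \<pi>] Delta_def c)
  also have "emb (const (inverse (of_int c))) * (Delta n * emb (const (of_int c))) =
      Delta n * emb (const (inverse (of_int c) * of_int c))"
    by (simp add: emb_mult const_mult)
  also have "inverse (of_int c) * of_int c = (1 :: 'k)"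
    using c0 by (intro left_inverse) (simp only: c_def of_int_eq_0_iff not_False_eq_True)
  also have "Delta n * emb (const 1) = (Delta n :: 'k ratfun)"
    by simp
  finally show ?thesis .
qed


section \<open>Conjugation and the division algebra\<close>

type_synonym 'k point = "nat \<times> nat \<times> nat \<Rightarrow> 'k"

definition point_mat :: "nat \<Rightarrow> 'k point \<Rightarrow> nat \<Rightarrow> 'k mat" where
  "point_mat n \<xi> h = mat n n (\<lambda>(i, j). \<xi> (h, i, j))"

text \<open>
  Only the coordinates of the first \<open>m\<close> matrices matter; a point also assigns values to all other
  variables.
\<close>

definition agree :: "nat \<Rightarrow> nat \<Rightarrow> 'k point \<Rightarrow> 'k point \<Rightarrow> bool" where
  "agree m n \<xi> \<xi>' \<longleftrightarrow> (\<forall>h<m. point_mat n \<xi> h = point_mat n \<xi>' h)"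

text \<open>
  Coordinates with an index outside the matrix size receive an unspecified value, which \<open>agree\<close> ignores.
\<close>

definition conj_point :: "nat \<Rightarrow> 'k::field mat \<Rightarrow> 'k mat \<Rightarrow> 'k point \<Rightarrow> 'k point" where
  "conj_point n u v \<xi> = (\<lambda>(h, i, j). (u * point_mat n \<xi> h * v) $$ (i, j))"

definition act_point :: "'k::field mat \<Rightarrow> 'k point \<Rightarrow> 'k point" where
  "act_point g \<xi> = (\<lambda>(j, a, b). if j < dim_row g then \<Sum>i < dim_row g. g $$ (i, j) * \<xi> (i, a, b) else \<xi> (j, a, b))"

abbreviation peval_mat :: "'k::field point \<Rightarrow> 'k mpoly mat \<Rightarrow> 'k mat" where
  "peval_mat \<xi> \<equiv> map_mat (peval \<xi>)"

definition inverse_pair :: "nat \<Rightarrow> 'a::comm_ring_1 mat \<Rightarrow> 'a mat \<Rightarrow> bool" where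
  "inverse_pair n u v \<longleftrightarrow> u \<in> carrier_mat n n \<and> v \<in> carrier_mat n n \<and> u * v = 1\<^sub>m n \<and> v * u = 1\<^sub>m n"

lemma point_mat_carrier [simp]: "point_mat n \<xi> h \<in> carrier_mat n n"
  by (simp add: point_mat_def)

lemma point_mat_conj:
  assumes "u \<in> carrier_mat n n" "v \<in> carrier_mat n n"
  shows "point_mat n (conj_point n u v \<xi>) h = u * point_mat n \<xi> h * v"
  by (rule eq_matI) (use assms in \<open>auto simp: point_mat_def conj_point_def\<close>)

text \<open>
  Substitution of linear forms in a polynomial is the action on points.  It is the transpose of \<open>g\<close> that
  acts on the rows of the coordinate matrix.
\<close>

lemma peval_act_point: "peval \<xi> (subst (lin_subst g) p) = peval (act_point g \<xi>) p"
proof -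
  have "(\<lambda>v. peval \<xi> (lin_subst g v)) = act_point g \<xi>"
    by (auto simp: fun_eq_iff lin_subst_def act_point_def peval.hom_sum peval.hom_mult)
  thus ?thesis by (simp add: peval_subst)
qed

text \<open>
  A polynomial map from \<open>m\<close>-tuples of matrices to matrices that is equivariant under simultaneous
  conjugation.
\<close>

definition concomitant :: "nat \<Rightarrow> nat \<Rightarrow> 'k::field mpoly mat \<Rightarrow> bool" where
  "concomitant m n P \<longleftrightarrow> P \<in> carrier_mat n n \<and>
     (\<forall>\<xi> \<xi>'. agree m n \<xi> \<xi>' \<longrightarrow> peval_mat \<xi> P = peval_mat \<xi>' P) \<and>
     (\<forall>\<xi> u v. inverse_pair n u v \<longrightarrow> peval_mat (conj_point n u v \<xi>) P = u * peval_mat \<xi> P * v)"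

lemma conj_mult:
  assumes uv: "inverse_pair n u v" and A: "A \<in> carrier_mat n n" and B: "B \<in> carrier_mat n n"
  shows "(u * A * v) * (u * B * v) = u * (A * B) * v"
proof -
  from uv have u: "u \<in> carrier_mat n n" and v: "v \<in> carrier_mat n n" and vu: "v * u = 1\<^sub>m n"
    by (simp_all add: inverse_pair_def)
  have "(u * A * v) * (u * B * v) = u * A * (v * (u * (B * v)))"
    using u v A B by (simp add: assoc_mult_mat[of _ n n _ n _ n])
  also have "v * (u * (B * v)) = (v * u) * (B * v)"
    using u v B by (intro assoc_mult_mat[symmetric, of _ n n _ n _ n]) auto
  also have "u * A * ((v * u) * (B * v)) = u * (A * B) * v"
    unfolding vu using u v A B by (simp add: assoc_mult_mat[of _ n n _ n _ n])
  finally show ?thesis .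
qed

lemma conj_add:
  assumes uv: "inverse_pair n u v" and A: "A \<in> carrier_mat n n" and B: "B \<in> carrier_mat n n"
  shows "u * (A + B) * v = u * A * v + u * B * v"
  using assms by (auto simp: inverse_pair_def mult_add_distrib_mat[of _ n n] add_mult_distrib_mat[of _ n n])

lemma conj_uminus:
  fixes A :: "'a::comm_ring_1 mat"
  assumes uv: "inverse_pair n u v" and A: "A \<in> carrier_mat n n"
  shows "u * (- A) * v = - (u * A * v)"
proof -
  have "- A = (- 1) \<cdot>\<^sub>m A" "- (u * A * v) = (- 1) \<cdot>\<^sub>m (u * A * v)"
    by (auto intro!: eq_matI)
  thus ?thesis
    using assms by (auto simp: inverse_pair_def mult_smult_distrib[of _ n n _ n] mult_smult_assoc_mat[of _ n n _ n])
qed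

lemma conj_scalar: "inverse_pair n u v \<Longrightarrow> u * scalar n a * v = scalar n a"
  unfolding scalar_def inverse_pair_def
  by (auto simp: mult_smult_distrib[of _ n n _ n] mult_smult_assoc_mat[of _ n n _ n])

lemma trace_commute:
  fixes A B :: "'a::comm_ring_1 mat"
  assumes "A \<in> carrier_mat n n" "B \<in> carrier_mat n n"
  shows "mat_tr (A * B) = mat_tr (B * A)"
proof -
  have "mat_tr (A * B) = (\<Sum>i<n. \<Sum>k<n. A $$ (i, k) * B $$ (k, i))"
    using assms by (simp add: mat_tr_def scalar_prod_def lessThan_atLeast0)
  also have "\<dots> = (\<Sum>k<n. \<Sum>i<n. B $$ (k, i) * A $$ (i, k))"
    by (subst sum.swap) (simp add: mult.commute)
  also have "\<dots> = mat_tr (B * A)"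
    using assms by (simp add: mat_tr_def scalar_prod_def lessThan_atLeast0)
  finally show ?thesis .
qed

lemma conj_trace:
  assumes "inverse_pair n u v" "A \<in> carrier_mat n n"
  shows "mat_tr (u * A * v) = mat_tr A"
proof -
  from assms have u: "u \<in> carrier_mat n n" and v: "v \<in> carrier_mat n n" and vu: "v * u = 1\<^sub>m n"
    by (simp_all add: inverse_pair_def)
  have "mat_tr (u * A * v) = mat_tr (v * (u * A))"
    using u v assms by (intro trace_commute) auto
  also have "v * (u * A) = A"
    using u v assms vu by (simp add: assoc_mult_mat[symmetric, of _ n n _ n _ n])
  finally show ?thesis .
qed

lemma concomitant_carrier: "concomitant m n P \<Longrightarrow> P \<in> carrier_mat n n"
  by (simp add: concomitant_def)

lemma concomitant_scalar: "concomitant m n (scalar n (const c))"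
proof -
  have "peval_mat \<xi> (scalar n (const c)) = scalar n c" for \<xi>
    by (rule eq_matI) (auto simp: scalar_def)
  thus ?thesis by (simp add: concomitant_def conj_scalar)
qed

lemma concomitant_one: "concomitant m n (1\<^sub>m n)"
  using concomitant_scalar[of m n 1] by (simp add: scalar_one)

lemma concomitant_uminus:
  assumes "concomitant m n P" shows "concomitant m n (- P)"
proof -
  have P: "P \<in> carrier_mat n n" using assms by (rule concomitant_carrier)
  hence "peval_mat \<xi> (- P) = - peval_mat \<xi> P" for \<xi>
    by (intro eq_matI) (auto simp: peval.hom_uminus)
  thus ?thesis using assms P by (simp add: concomitant_def conj_uminus)
qed

lemma concomitant_add:
  assumes "concomitant m n P" "concomitant m n Q" shows "concomitant m n (P + Q)"
proof -
  have P: "P \<in> carrier_mat n n" "Q \<in> carrier_mat n n" using assms by (auto dest: concomitant_carrier)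
  hence "peval_mat \<xi> (P + Q) = peval_mat \<xi> P + peval_mat \<xi> Q" for \<xi>
    by (intro eq_matI) (auto simp: peval.hom_add)
  thus ?thesis using assms P by (simp add: concomitant_def conj_add)
qed

lemma concomitant_mult:
  assumes "concomitant m n P" "concomitant m n Q" shows "concomitant m n (P * Q)"
proof -
  have P: "P \<in> carrier_mat n n" "Q \<in> carrier_mat n n" using assms by (auto dest: concomitant_carrier)
  hence "peval_mat \<xi> (P * Q) = peval_mat \<xi> P * peval_mat \<xi> Q" for \<xi>
    by (rule peval.mat_hom_mult)
  thus ?thesis using assms P by (simp add: concomitant_def conj_mult)
qed

lemma concomitant_trace:
  assumes "concomitant m n P" shows "concomitant m n (scalar n (mat_tr P))"
proof -
  have P: "P \<in> carrier_mat n n" using assms by (rule concomitant_carrier)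
  have "peval \<xi> (mat_tr P) = mat_tr (peval_mat \<xi> P)" for \<xi>
    using P by (simp add: mat_tr_def peval.hom_sum)
  hence "peval_mat \<xi> (scalar n (mat_tr P)) = scalar n (mat_tr (peval_mat \<xi> P))" for \<xi>
    by (intro eq_matI) (auto simp: scalar_def)
  thus ?thesis using assms P by (simp add: concomitant_def conj_scalar conj_trace)
qed

definition generic_poly :: "nat \<Rightarrow> nat \<Rightarrow> 'k::field mpoly mat" where
  "generic_poly n h = mat n n (\<lambda>(i, j). var (h, i, j))"

lemma generic_poly_carrier [simp]: "generic_poly n h \<in> carrier_mat n n"
  by (simp add: generic_poly_def)

lemma generic_eq: "generic n h = map_mat emb (generic_poly n h)"
  by (rule eq_matI) (auto simp: generic_def generic_poly_def)

lemma peval_generic_poly: "peval_mat \<xi> (generic_poly n h) = point_mat n \<xi> h"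
  by (rule eq_matI) (auto simp: point_mat_def generic_poly_def)

lemma concomitant_generic: "h < m \<Longrightarrow> concomitant m n (generic_poly n h)"
  by (auto simp: concomitant_def peval_generic_poly agree_def point_mat_conj inverse_pair_def)

definition concomitants :: "nat \<Rightarrow> nat \<Rightarrow> 'k::field ratfun mat set" where
  "concomitants m n = map_mat emb ` Collect (concomitant m n)"

lemma concomitants_closed:
  "1\<^sub>m n \<in> concomitants m n"
  "A \<in> concomitants m n \<Longrightarrow> - A \<in> concomitants m n"
  "A \<in> concomitants m n \<Longrightarrow> B \<in> concomitants m n \<Longrightarrow> A + B \<in> concomitants m n"
  "A \<in> concomitants m n \<Longrightarrow> B \<in> concomitants m n \<Longrightarrow> A * B \<in> concomitants m n"
  "A \<in> concomitants m n \<Longrightarrow> scalar n (mat_tr A) \<in> concomitants m n"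
proof -
  show "1\<^sub>m n \<in> concomitants m n"
    unfolding concomitants_def by (rule image_eqI[of _ _ "1\<^sub>m n"]) (simp_all add: concomitant_one emb.mat_hom_one)
next
  assume "A \<in> concomitants m n"
  then obtain P where P: "A = map_mat emb P" "concomitant m n P" by (auto simp: concomitants_def)
  show "- A \<in> concomitants m n"
    unfolding concomitants_def
    by (rule image_eqI[of _ _ "- P"], rule eq_matI) (use P concomitant_carrier[OF P(2)] in \<open>auto simp: concomitant_uminus emb.hom_uminus\<close>)
  have "scalar n (mat_tr A) = map_mat emb (scalar n (mat_tr P))"
    by (rule eq_matI)
       (use P concomitant_carrier[OF P(2)] in \<open>auto simp: scalar_def mat_tr_def emb.hom_sum\<close>)
  thus "scalar n (mat_tr A) \<in> concomitants m n"
    unfolding concomitants_def using concomitant_trace[OF P(2)] by blast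
next
  assume "A \<in> concomitants m n" "B \<in> concomitants m n"
  then obtain P Q where P: "A = map_mat emb P" "concomitant m n P" and Q: "B = map_mat emb Q" "concomitant m n Q"
    by (auto simp: concomitants_def)
  note c = P(2)[THEN concomitant_carrier] Q(2)[THEN concomitant_carrier]
  show "A + B \<in> concomitants m n"
    unfolding concomitants_def
    by (rule image_eqI[of _ _ "P + Q"], rule eq_matI) (use P Q c in \<open>auto simp: concomitant_add emb.hom_add\<close>)
  show "A * B \<in> concomitants m n"
    unfolding concomitants_def
    by (rule image_eqI[of _ _ "P * Q"]) (use P Q c in \<open>auto simp: concomitant_mult emb.mat_hom_mult[of _ n n]\<close>)
qed

lemma base_field_concomitants: "base_field n \<subseteq> concomitants m n"
proof
  fix A :: "'k::field ratfun mat" assume "A \<in> base_field n"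
  then obtain c where A: "A = scalar n (emb (const c))" by (auto simp: base_field_def)
  show "A \<in> concomitants m n"
    unfolding concomitants_def
    by (rule image_eqI[of _ _ "scalar n (const c)"], rule eq_matI)
       (use concomitant_scalar in \<open>auto simp: A scalar_def\<close>)
qed

text \<open>
  The generic matrices are equivariant, constants and traces are fixed by conjugation, and sums and
  products of equivariant maps are equivariant.
\<close>

lemma trace_ring_concomitants: "trace_ring m n \<subseteq> concomitants m n"
proof -
  have G: "generic_alg m n \<subseteq> concomitants m n"
  proof
    fix A :: "'k::field ratfun mat" assume "A \<in> generic_alg m n"
    with generic_alg_gens_carrier show "A \<in> concomitants m n"
      unfolding generic_alg_def subalg_gen_def
    proof (induction rule: subring_gen_induct)
      case (incl A)
      thus ?case
        using base_field_concomitants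
        by (auto simp: generic_eq concomitants_def concomitant_generic)
    qed (auto intro: concomitants_closed)
  qed
  show ?thesis
  proof
    fix A :: "'k::field ratfun mat" assume "A \<in> trace_ring m n"
    with trace_ring_gens_carrier show "A \<in> concomitants m n"
      unfolding trace_ring_def
    proof (induction rule: subring_gen_induct)
      case (incl A)
      thus ?case using G by (auto intro: concomitants_closed)
    qed (auto intro: concomitants_closed)
  qed
qed

text \<open>
  A common denominator \<open>q\<close> for the entries of \<open>Y\<close>, with the properties of concomitants that survive
  division.  Equivariance of the numerator is only required where \<open>q\<close> does not vanish, since it is
  obtained by cancelling an invertible matrix.
\<close>

definition fraction_rep :: "nat \<Rightarrow> nat \<Rightarrow> 'k::field ratfun mat \<Rightarrow> 'k mpoly mat \<Rightarrow> 'k mpoly \<Rightarrow> bool" where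
  "fraction_rep m n Y R q \<longleftrightarrow> q \<noteq> 0 \<and> R \<in> carrier_mat n n \<and> Y = mat n n (\<lambda>(i, j). Fract (R $$ (i, j)) q) \<and>
     (\<forall>\<xi> \<xi>'. agree m n \<xi> \<xi>' \<longrightarrow> peval_mat \<xi> R = peval_mat \<xi>' R \<and> peval \<xi> q = peval \<xi>' q) \<and>
     (\<forall>\<xi> u v. inverse_pair n u v \<longrightarrow> peval (conj_point n u v \<xi>) q = peval \<xi> q) \<and>
     (\<forall>\<xi> u v. inverse_pair n u v \<longrightarrow> peval \<xi> q \<noteq> 0 \<longrightarrow>
        peval_mat (conj_point n u v \<xi>) R = u * peval_mat \<xi> R * v)"

lemma trace_ring_fraction_rep:
  assumes "Y \<in> trace_ring m n"
  obtains P where "fraction_rep m n Y P 1"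
proof -
  from assms obtain P where P: "Y = map_mat emb P" "concomitant m n P"
    using trace_ring_concomitants[of m n] unfolding concomitants_def by blast
  moreover have "Y = mat n n (\<lambda>(i, j). Fract (P $$ (i, j)) 1)"
    by (rule eq_matI) (use concomitant_carrier[OF P(2)] in \<open>auto simp: P emb_def\<close>)
  ultimately have "fraction_rep m n Y P 1"
    by (auto simp: fraction_rep_def concomitant_def)
  thus ?thesis by (rule that)
qed

lemma mat_right_cancel:
  fixes M :: "'a::field mat"
  assumes "X \<in> carrier_mat n n" "X' \<in> carrier_mat n n" "M \<in> carrier_mat n n" "det M \<noteq> 0"
    and "X * M = X' * M"
  shows "X = X'"
proof -
  from det_non_zero_imp_unit[OF assms(3,4)] obtain N where N: "N \<in> carrier_mat n n" "M * N = 1\<^sub>m n"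
    by (auto simp: Units_def ring_mat_simps)
  have "X = X * M * N" using assms(1,3) N by (simp add: assoc_mult_mat[of X n n M n N n])
  also have "\<dots> = X'" unfolding assms(5) using assms(2,3) N by (simp add: assoc_mult_mat[of X' n n M n N n])
  finally show ?thesis .
qed

lemma det_inverse_pair:
  assumes "inverse_pair n u v"
  shows "det u * det v = 1"
  using assms det_mult[of u n v] by (simp add: inverse_pair_def)

lemma det_conj:
  assumes uv: "inverse_pair n u v" and M: "M \<in> carrier_mat n n"
  shows "det (u * M * v) = det M"
proof -
  from uv have u: "u \<in> carrier_mat n n" and v: "v \<in> carrier_mat n n"
    by (simp_all add: inverse_pair_def)
  have "det (u * M * v) = det u * det M * det v"
    by (simp only: det_mult[OF mult_carrier_mat[OF u M] v] det_mult[OF u M])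
  also have "\<dots> = (det u * det v) * det M" by (simp only: mult_ac)
  finally show ?thesis by (simp only: det_inverse_pair[OF uv] mult_1_left)
qed

lemma (in comm_ring_hom) hom_adj_mat:
  assumes A: "A \<in> carrier_mat n n"
  shows "adj_mat (map_mat hom A) = map_mat hom (adj_mat A)"
proof (rule eq_matI)
  fix i j assume "i < dim_row (map_mat hom (adj_mat A))" "j < dim_col (map_mat hom (adj_mat A))"
  hence ij: "i < n" "j < n" using A by (auto simp: adj_mat_def)
  have "mat_delete (map_mat hom A) j i = map_mat hom (mat_delete A j i)"
    by (rule eq_matI) (use A ij in \<open>auto simp: mat_delete_def\<close>)
  hence "cofactor (map_mat hom A) j i = hom (cofactor A j i)"
    by (simp add: cofactor_def hom_mult hom_power hom_uminus)
  thus "adj_mat (map_mat hom A) $$ (i, j) = map_mat hom (adj_mat A) $$ (i, j)"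
    using A ij by (simp add: adj_mat_def)
qed (auto simp: adj_mat_def)

text \<open>
  For \<open>Y = A B\<^sup>-\<^sup>1\<close> take \<open>q = det B\<close> and \<open>R = A adj B\<close>.  Equivariance of \<open>R\<close> follows from that of \<open>A\<close> and
  \<open>B\<close> and the relation \<open>R B = q A\<close>.
\<close>

lemma UD_fraction_rep:
  fixes Y :: "'k::field ratfun mat"
  assumes "Y \<in> UD m n"
  obtains R q where "fraction_rep m n Y R q"
proof -
  from assms obtain A B C where Y: "Y = A * C" and A: "A \<in> trace_ring m n" and B: "B \<in> trace_ring m n"
    and C: "C \<in> carrier_mat n n" and BC: "B * C = 1\<^sub>m n" and CB: "C * B = 1\<^sub>m n"
    by (auto simp: UD_def)
  from A B obtain PA PB where PA: "A = map_mat emb PA" "concomitant m n PA"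
    and PB: "B = map_mat emb PB" "concomitant m n PB"
    using trace_ring_concomitants[of m n] unfolding concomitants_def by blast
  note cA = concomitant_carrier[OF PA(2)] and cB = concomitant_carrier[OF PB(2)]
  have carA: "A \<in> carrier_mat n n" and carB: "B \<in> carrier_mat n n" using cA cB by (auto simp: PA PB)
  define q where "q = det PB"
  define adj where "adj = adj_mat PB"
  define R where "R = PA * adj"
  have adj: "adj \<in> carrier_mat n n" "adj * PB = q \<cdot>\<^sub>m 1\<^sub>m n"
    using adj_mat[OF cB] by (simp_all add: adj_def q_def)
  have R: "R \<in> carrier_mat n n" using cA adj by (simp add: R_def)
  have "det B * det C = 1"
    using det_inverse_pair[of n B C] carB C BC CB by (simp add: inverse_pair_def)
  hence q0: "q \<noteq> 0"
    by (auto simp: PB q_def)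
  have RB: "R * PB = q \<cdot>\<^sub>m PA"
  proof -
    have "R * PB = PA * (q \<cdot>\<^sub>m 1\<^sub>m n)"
      unfolding R_def using cA adj cB by (simp add: assoc_mult_mat[of _ n n _ n _ n])
    also have "\<dots> = q \<cdot>\<^sub>m PA" using cA by (simp add: mult_smult_distrib[of _ n n _ n])
    finally show ?thesis .
  qed
  have "map_mat emb R = emb q \<cdot>\<^sub>m Y"
  proof -
    have "map_mat emb R = map_mat emb R * (B * C)"
      using R by (simp add: BC)
    also have "\<dots> = map_mat emb (R * PB) * C"
      using R carB C cB by (simp add: emb.mat_hom_mult[of _ n n] PB assoc_mult_mat[of _ n n _ n _ n])
    also have "\<dots> = (emb q \<cdot>\<^sub>m A) * C"
    proof -
      have "map_mat emb (q \<cdot>\<^sub>m PA) = emb q \<cdot>\<^sub>m A"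
        by (rule eq_matI) (auto simp: PA emb.hom_mult)
      thus ?thesis by (simp add: RB)
    qed
    also have "\<dots> = emb q \<cdot>\<^sub>m Y" unfolding Y by (rule mult_smult_assoc_mat[OF carA C])
    finally show ?thesis .
  qed
  hence "map_mat emb R $$ (i, j) = (emb q \<cdot>\<^sub>m Y) $$ (i, j)" for i j
    by (simp only:)
  moreover have carY: "Y \<in> carrier_mat n n" using carA C by (simp add: Y)
  ultimately have entry: "emb (R $$ (i, j)) = emb q * Y $$ (i, j)" if "i < n" "j < n" for i j
    using that R by (metis carrier_matD index_map_mat(1) index_smult_mat(1))
  have Yeq: "Y = mat n n (\<lambda>(i, j). Fract (R $$ (i, j)) q)"
  proof (rule eq_matI)
    fix i j assume "i < dim_row (mat n n (\<lambda>(i, j). Fract (R $$ (i, j)) q))"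
      "j < dim_col (mat n n (\<lambda>(i, j). Fract (R $$ (i, j)) q))"
    hence ij: "i < n" "j < n" by auto
    have "emb q * Y $$ (i, j) = emb q * Fract (R $$ (i, j)) q"
      using q0 unfolding entry[OF ij, symmetric] by (simp add: emb_def eq_fract)
    hence "Y $$ (i, j) = Fract (R $$ (i, j)) q" using q0 by simp
    thus "Y $$ (i, j) = mat n n (\<lambda>(i, j). Fract (R $$ (i, j)) q) $$ (i, j)" using ij by simp
  qed (use carY in auto)
  have evq: "peval \<xi> q = det (peval_mat \<xi> PB)" for \<xi>
    by (simp add: q_def)
  have evR: "peval_mat \<xi> R * peval_mat \<xi> PB = peval \<xi> q \<cdot>\<^sub>m peval_mat \<xi> PA" for \<xi>
  proof -
    have "peval_mat \<xi> (q \<cdot>\<^sub>m PA) = peval \<xi> q \<cdot>\<^sub>m peval_mat \<xi> PA"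
      by (rule eq_matI) (auto simp: peval.hom_mult)
    thus ?thesis using R cB RB by (simp add: peval.mat_hom_mult[of _ n n, symmetric])
  qed
  have conj_q: "peval (conj_point n u v \<xi>) q = peval \<xi> q" if uv: "inverse_pair n u v" for \<xi> u v
  proof -
    have "peval (conj_point n u v \<xi>) q = det (u * peval_mat \<xi> PB * v)"
      using PB uv by (simp add: evq concomitant_def)
    also have "\<dots> = det (peval_mat \<xi> PB)"
      using cB by (intro det_conj[OF uv]) simp
    finally show ?thesis by (simp only: evq)
  qed
  have conj_R: "peval_mat (conj_point n u v \<xi>) R = u * peval_mat \<xi> R * v"
    if uv: "inverse_pair n u v" and "peval \<xi> q \<noteq> 0" for \<xi> u v
  proof (rule mat_right_cancel)
    define \<xi>' where "\<xi>' = conj_point n u v \<xi>"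
    show "peval_mat (conj_point n u v \<xi>) R \<in> carrier_mat n n" using R by simp
    show "u * peval_mat \<xi> R * v \<in> carrier_mat n n" using R uv by (auto simp: inverse_pair_def)
    show "peval_mat (conj_point n u v \<xi>) PB \<in> carrier_mat n n" using cB by simp
    show "det (peval_mat (conj_point n u v \<xi>) PB) \<noteq> 0"
      using that by (simp only: evq[symmetric] conj_q not_False_eq_True)
    have "peval_mat (conj_point n u v \<xi>) R * peval_mat (conj_point n u v \<xi>) PB =
        peval \<xi> q \<cdot>\<^sub>m (u * peval_mat \<xi> PA * v)"
      using PA uv by (simp add: evR conj_q concomitant_def)
    also have "\<dots> = u * (peval \<xi> q \<cdot>\<^sub>m peval_mat \<xi> PA) * v"
      using uv cA by (auto simp: inverse_pair_def mult_smult_distrib[of _ n n _ n] mult_smult_assoc_mat[of _ n n _ n])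
    also have "\<dots> = (u * peval_mat \<xi> R * v) * (u * peval_mat \<xi> PB * v)"
      unfolding evR[symmetric] using R cB by (intro conj_mult[OF uv, symmetric]) auto
    also have "u * peval_mat \<xi> PB * v = peval_mat (conj_point n u v \<xi>) PB"
      using PB uv by (simp add: concomitant_def)
    finally show "peval_mat (conj_point n u v \<xi>) R * peval_mat (conj_point n u v \<xi>) PB =
      u * peval_mat \<xi> R * v * peval_mat (conj_point n u v \<xi>) PB" .
  qed
  have loc: "peval_mat \<xi> R = peval_mat \<xi>' R \<and> peval \<xi> q = peval \<xi>' q" if "agree m n \<xi> \<xi>'" for \<xi> \<xi>'
  proof -
    have AB: "peval_mat \<xi> PA = peval_mat \<xi>' PA" "peval_mat \<xi> PB = peval_mat \<xi>' PB"
      using that PA PB by (auto simp: concomitant_def)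
    have "peval_mat \<xi> adj = peval_mat \<xi>' adj"
      unfolding adj_def peval.hom_adj_mat[OF cB, symmetric] by (simp only: AB)
    thus ?thesis
      using AB cA adj by (simp add: R_def peval.mat_hom_mult[of _ n n] evq)
  qed
  have "fraction_rep m n Y R q"
    unfolding fraction_rep_def using q0 R Yeq loc conj_q conj_R by blast
  thus ?thesis by (rule that)
qed


section \<open>Orbits of points and invariants\<close>

lemma GL_I:
  assumes "g \<in> carrier_mat m m" "det g \<noteq> (0::'k::field)"
  shows "g \<in> GL m"
proof -
  from det_non_zero_imp_unit[OF assms, of "()"]
  obtain h where "h \<in> carrier_mat m m" "h * g = 1\<^sub>m m" "g * h = 1\<^sub>m m"
    by (auto simp: Units_def ring_mat_simps)
  with assms(1) show ?thesis
    by (auto simp: GL_def invertible_mat_def inverts_mat_def)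
qed

abbreviation delta :: "nat \<Rightarrow> 'k::field point \<Rightarrow> 'k" where
  "delta n \<xi> \<equiv> discriminant n (point_mat n \<xi>)"

definition Delta_poly :: "nat \<Rightarrow> 'k::field mpoly" where
  "Delta_poly n = discriminant n (generic_poly n)"

lemma Delta_eq: "Delta n = emb (Delta_poly n)"
proof -
  have "Delta n = discriminant n (\<lambda>r. map_mat emb (generic_poly n r))"
    by (simp add: Delta_def generic_eq[abs_def])
  also have "\<dots> = emb (Delta_poly n)"
    unfolding Delta_poly_def by (rule emb.discriminant_hom) simp
  finally show ?thesis .
qed

lemma peval_Delta_poly: "peval \<xi> (Delta_poly n) = delta n \<xi>"
  unfolding Delta_poly_def
  by (subst peval.discriminant_hom[symmetric]) (simp_all add: peval_generic_poly)

lemma Delta_poly_nonzero: "Delta_poly n \<noteq> (0 :: 'k::field mpoly)"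
proof
  assume 0: "Delta_poly n = (0 :: 'k mpoly)"
  \<comment> \<open>the point that consists of the matrix units in order\<close>
  define \<xi> :: "'k point" where "\<xi> = (\<lambda>(h, i, j). of_bool (i = h div n \<and> j = h mod n))"
  have "delta n \<xi> = levi n (\<lambda>s\<in>{..<n\<^sup>2}. s div n) (\<lambda>s\<in>{..<n\<^sup>2}. s mod n)"
    unfolding levi_def by (rule discriminant_cong) (simp add: point_mat_def \<xi>_def munit_def)
  hence "peval \<xi> (Delta_poly n) = 1"
    by (simp add: peval_Delta_poly levi_diagonal)
  thus False by (simp add: 0)
qed

lemma det_diagonal_corner:
  "det (mat k k (\<lambda>(i, j). if i = j then if i = 0 then c else 1 else 0)) = (if k = 0 then 1 else c :: 'a::comm_ring_1)"
proof -
  let ?D = "mat k k (\<lambda>(i, j). if i = j then if i = 0 then c else 1 else 0)"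
  have "det ?D = prod_list (diag_mat ?D)"
    by (rule det_upper_triangular[of _ k]) (auto simp: upper_triangular_def)
  also have "\<dots> = (\<Prod>i<k. if i = 0 then c else 1)"
    by (simp add: diag_mat_def prod.distinct_set_conv_list[symmetric] lessThan_atLeast0)
  also have "\<dots> = (if k = 0 then 1 else c)"
    by (cases k) (simp_all add: prod.lessThan_Suc_shift)
  finally show ?thesis .
qed

text \<open>
  The coordinates of the point fill the first \<open>n\<^sup>2\<close> columns, and unit vectors complete them to a square
  matrix.  If there is room for a new column, the entry \<open>c\<close> makes it possible to prescribe the determinant.
\<close>

definition completed_mat :: "nat \<Rightarrow> nat \<Rightarrow> 'k::field \<Rightarrow> 'k point \<Rightarrow> 'k mat" where
  "completed_mat m n c \<xi> = mat m m (\<lambda>(r, s). if s < n\<^sup>2 then \<xi> (r, s div n, s mod n)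
     else if r = s then if s = n\<^sup>2 then c else 1 else 0)"

lemma det_completed_mat:
  assumes "n\<^sup>2 \<le> m"
  shows "det (completed_mat m n c \<xi>) = delta n \<xi> * (if m = n\<^sup>2 then 1 else c)"
proof -
  define k where "k = m - n\<^sup>2"
  define D where "D = mat k k (\<lambda>(i, j). if i = j then if i = 0 then c else 1 else 0)"
  define L where "L = mat k (n\<^sup>2) (\<lambda>(i, s). \<xi> (n\<^sup>2 + i, s div n, s mod n))"
  have "completed_mat m n c \<xi> = four_block_mat (coords n (point_mat n \<xi>)) (0\<^sub>m (n\<^sup>2) k) L D"
    by (rule eq_matI)
       (use assms in \<open>auto simp: completed_mat_def coords_def L_def D_def k_def point_mat_def
          square_div_less square_mod_less four_block_mat_def Let_def\<close>)
  also have "det \<dots> = det (coords n (point_mat n \<xi>)) * det D"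
    by (rule det_four_block_mat_upper_right_zero[of _ "n\<^sup>2" _ k]) (simp_all add: L_def D_def)
  also have "det D = (if m = n\<^sup>2 then 1 else c)"
    unfolding D_def det_diagonal_corner using assms by (auto simp: k_def)
  finally show ?thesis by (simp add: discriminant_coords)
qed

text \<open>
  The transpose of \<open>g\<close> is the quotient \<open>N' N\<^sup>-\<^sup>1\<close> of the completed coordinate matrices, which have
  determinant one if \<open>m > n\<^sup>2\<close>.
\<close>

lemma point_transport:
  fixes \<xi> \<xi>' :: "'k::field point"
  assumes m: "n\<^sup>2 \<le> m" and nz: "delta n \<xi> \<noteq> 0" "delta n \<xi>' \<noteq> 0"
  obtains g where "g \<in> GL m" "agree m n (act_point g \<xi>) \<xi>'"
    "m > n\<^sup>2 \<or> delta n \<xi> = delta n \<xi>' \<Longrightarrow> g \<in> SL m"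
proof -
  \<comment> \<open>the free entry is the inverse of the discriminant, which normalizes the determinant to \<open>1\<close> if \<open>m > n\<^sup>2\<close>\<close>
  define N where "N = completed_mat m n (inverse (delta n \<xi>)) \<xi>"
  define N' where "N' = completed_mat m n (inverse (delta n \<xi>')) \<xi>'"
  have N: "N \<in> carrier_mat m m" "N' \<in> carrier_mat m m"
    by (simp_all add: N_def N'_def completed_mat_def)
  have detN: "det N = (if m = n\<^sup>2 then delta n \<xi> else 1)" "det N' = (if m = n\<^sup>2 then delta n \<xi>' else 1)"
    using nz by (simp_all add: N_def N'_def det_completed_mat[OF m])
  hence "det N \<noteq> 0" using nz by simp
  from det_non_zero_imp_unit[OF N(1) this, of "()"]
  obtain K where K: "K \<in> carrier_mat m m" "K * N = 1\<^sub>m m"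
    by (auto simp: Units_def ring_mat_simps)
  define G where "G = N' * K"
  have G: "G \<in> carrier_mat m m" using N K by (simp add: G_def)
  have GN: "G * N = N'"
    unfolding G_def using N K by (simp add: assoc_mult_mat[of N' m m K m N m])
  hence detG: "det G * det N = det N'"
    using det_mult[OF G N(1)] by simp
  define g where "g = transpose_mat G"
  have g: "g \<in> carrier_mat m m" "det g = det G"
    using G by (simp_all add: g_def det_transpose[OF G])
  have "det g \<noteq> 0"
    using detG detN nz by (auto simp: g split: if_splits)
  hence "g \<in> GL m" by (rule GL_I[OF g(1)])
  moreover have "agree m n (act_point g \<xi>) \<xi>'"
    unfolding agree_def
  proof (intro allI impI eq_matI)
    fix h i j assume h: "h < m" and "i < dim_row (point_mat n \<xi>' h)" "j < dim_col (point_mat n \<xi>' h)"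
    hence ij: "i < n" "j < n" by (simp_all add: point_mat_def)
    \<comment> \<open>the column of the coordinate matrix in which the entry \<open>(i, j)\<close> is placed\<close>
    define s where "s = i * n + j"
    have s: "s div n = i" "s mod n = j" using ij by (simp_all add: s_def)
    have "s < (i + 1) * n" using ij by (simp add: s_def)
    also have "\<dots> \<le> n * n" using ij by (intro mult_right_mono) auto
    finally have sn: "s < n\<^sup>2" by (simp add: power2_eq_square)
    hence sm: "s < m" using m by simp
    have "\<xi>' (h, i, j) = (G * N) $$ (h, s)"
      unfolding GN using h sn sm by (simp add: N'_def completed_mat_def s)
    also have "\<dots> = (\<Sum>r<m. G $$ (h, r) * N $$ (r, s))"
      using h sm G N by (simp add: scalar_prod_def lessThan_atLeast0)
    also have "\<dots> = act_point g \<xi> (h, i, j)"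
      using h sn sm G by (auto simp: act_point_def g_def N_def completed_mat_def s intro!: sum.cong)
    finally show "point_mat n (act_point g \<xi>) h $$ (i, j) = point_mat n \<xi>' h $$ (i, j)"
      using ij by (simp add: point_mat_def)
  qed (simp_all add: point_mat_def)
  moreover have "g \<in> SL m" if "m > n\<^sup>2 \<or> delta n \<xi> = delta n \<xi>'"
    using that detG detN nz g by (auto simp: SL_def split: if_splits)
  ultimately show ?thesis by (rule that)
qed

lemma delta_act_point:
  assumes g: "g \<in> carrier_mat (n\<^sup>2) (n\<^sup>2)"
  shows "delta n (act_point g \<xi>) = det g * delta n \<xi>"
proof -
  have "coords n (point_mat n (act_point g \<xi>)) = transpose_mat g * coords n (point_mat n \<xi>)"
    by (rule eq_matI)
       (use g in \<open>auto simp: coords_def point_mat_def act_point_def scalar_prod_def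
          square_div_less square_mod_less lessThan_atLeast0 intro!: sum.cong\<close>)
  thus ?thesis
    using g by (simp add: discriminant_coords det_mult[of _ "n\<^sup>2"] det_transpose[OF g])
qed

text \<open>
  The action multiplies the discriminant by \<open>det g\<close> at every point.
\<close>

lemma subst_Delta_poly:
  fixes g :: "'k::field_char_0 mat"
  assumes "g \<in> SL (n\<^sup>2)"
  shows "subst (lin_subst g) (Delta_poly n) = Delta_poly n"
  by (rule mpoly_eqI_generic[of 1])
     (use assms in \<open>auto simp: peval_act_point peval_Delta_poly delta_act_point SL_def\<close>)

lemma act_scalar:
  assumes g: "g \<in> GL m" and b: "b \<noteq> 0"
  shows "act g (scalar n (Fract a b)) =
    scalar n (Fract (subst (lin_subst g) a) (subst (lin_subst g) b))"
proof -
  have "frac_ext (subst (lin_subst g)) 0 = 0"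
    using frac_ext_emb[OF g, of 0] by (simp add: emb_zero)
  thus ?thesis
    by (intro eq_matI) (auto simp: act_def scalar_def frac_ext_subst[OF g b])
qed

lemma fraction_repD:
  assumes "fraction_rep m n Y R q"
  shows "q \<noteq> 0" "R \<in> carrier_mat n n" "Y = mat n n (\<lambda>(i, j). Fract (R $$ (i, j)) q)"
    "agree m n \<xi> \<xi>' \<Longrightarrow> peval_mat \<xi> R = peval_mat \<xi>' R"
    "agree m n \<xi> \<xi>' \<Longrightarrow> peval \<xi> q = peval \<xi>' q"
    "inverse_pair n u v \<Longrightarrow> peval (conj_point n u v \<xi>) q = peval \<xi> q"
    "inverse_pair n u v \<Longrightarrow> peval \<xi> q \<noteq> 0 \<Longrightarrow>
      peval_mat (conj_point n u v \<xi>) R = u * peval_mat \<xi> R * v"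
  using assms unfolding fraction_rep_def by blast+

text \<open>
  The values \<open>R / q\<close> agree at two points of an orbit.  The equation is multiplied out because the
  denominators may vanish.
\<close>

lemma invariant_fraction_rep:
  assumes Y: "fraction_rep m n Y R q" and g: "g \<in> GL m" "act g Y = Y"
    and agr: "agree m n (act_point g \<xi>) \<xi>'" and ij: "i < n" "j < n"
  shows "peval \<xi>' (R $$ (i, j)) * peval \<xi> q = peval \<xi> (R $$ (i, j)) * peval \<xi>' q"
proof -
  note q = fraction_repD(1)[OF Y] and R = fraction_repD(2)[OF Y] and Yeq = fraction_repD(3)[OF Y]
  define S where "S = subst (lin_subst g)"
  have Sq: "S q \<noteq> 0"
  proof
    assume "S q = 0"
    hence "subst (lin_subst g) q = subst (lin_subst g) 0" by (simp add: S_def)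
    with injD[OF inj_subst_lin_subst[OF g(1)]] q show False by blast
  qed
  have "Fract (S (R $$ (i, j))) (S q) = Fract (R $$ (i, j)) q"
    using arg_cong[OF g(2), of "\<lambda>M. M $$ (i, j)"] ij
    by (simp add: act_def Yeq frac_ext_subst[OF g(1) q] S_def)
  hence "S (R $$ (i, j)) * q = R $$ (i, j) * S q"
    using q Sq by (simp add: eq_fract)
  hence "peval \<xi> (S (R $$ (i, j)) * q) = peval \<xi> (R $$ (i, j) * S q)" by simp
  hence *: "peval (act_point g \<xi>) (R $$ (i, j)) * peval \<xi> q = peval \<xi> (R $$ (i, j)) * peval (act_point g \<xi>) q"
    by (simp add: peval.hom_mult S_def peval_act_point)
  have "peval_mat (act_point g \<xi>) R = peval_mat \<xi>' R" and "peval (act_point g \<xi>) q = peval \<xi>' q"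
    using fraction_repD(4,5)[OF Y agr] by simp_all
  moreover from this(1) have "peval (act_point g \<xi>) (R $$ (i, j)) = peval \<xi>' (R $$ (i, j))"
    using ij R by (metis carrier_matD index_map_mat(1))
  ultimately show ?thesis using * by simp
qed

text \<open>
  It is enough to conjugate by the transvections \<open>1 + E\<close> with \<open>E\<close> an off-diagonal matrix unit.
\<close>

lemma commutes_imp_scalar:
  fixes M :: "'k::field mat"
  assumes M: "M \<in> carrier_mat n n" and n: "0 < n"
    and comm: "\<And>u v. inverse_pair n u v \<Longrightarrow> u * M * v = M"
  shows "M = scalar n (M $$ (0, 0))"
proof -
  have entries: "M $$ (b, a) = 0 \<and> M $$ (b, b) = M $$ (a, a)" if ab: "a < n" "b < n" "a \<noteq> b" for a b
  proof -
    let ?E = "munit n a b :: 'k mat"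
    define u where "u = 1\<^sub>m n + ?E"
    define v where "v = 1\<^sub>m n - ?E"
    have E2: "?E * ?E = 0\<^sub>m n n"
      by (rule eq_matI) (use ab carrier_matD[OF munit_carrier[of n a b]] in
          \<open>auto simp: munit_mult_index[OF munit_carrier] munit_index\<close>)
    have u: "u \<in> carrier_mat n n" and v: "v \<in> carrier_mat n n"
      by (simp_all add: u_def v_def minus_carrier_mat[OF munit_carrier])
    have "u * v = 1\<^sub>m n * v + ?E * v"
      unfolding u_def by (rule add_mult_distrib_mat) (use v in auto)
    also have "?E * v = ?E * 1\<^sub>m n - ?E * ?E"
      unfolding v_def by (rule mult_minus_distrib_mat[of _ n n _ n]) auto
    finally have "u * v = v + (?E - 0\<^sub>m n n)"
      by (simp only: E2 left_mult_one_mat[OF v] right_mult_one_mat[OF munit_carrier])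
    hence uv: "u * v = 1\<^sub>m n"
      by (auto simp: v_def carrier_matD[OF munit_carrier] intro!: eq_matI)
    have "v * u = v * 1\<^sub>m n + v * ?E"
      unfolding u_def by (rule mult_add_distrib_mat) (use v in auto)
    also have "v * ?E = 1\<^sub>m n * ?E - ?E * ?E"
      unfolding v_def by (rule minus_mult_distrib_mat[of _ n n _ _ n]) auto
    finally have "v * u = v + (?E - 0\<^sub>m n n)"
      by (simp only: E2 right_mult_one_mat[OF v] left_mult_one_mat[OF munit_carrier])
    hence vu: "v * u = 1\<^sub>m n"
      by (auto simp: v_def carrier_matD[OF munit_carrier] intro!: eq_matI)
    have "u * M = u * M * (v * u)"
      using u M by (simp add: vu)
    also have "\<dots> = u * M * v * u"
      using u v M by (intro assoc_mult_mat[symmetric, of _ n n _ n _ n]) auto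
    also have "\<dots> = M * u"
      using comm[of u v] u v uv vu by (simp add: inverse_pair_def)
    finally have "u * M = M * u" .
    moreover have "u * M = M + ?E * M"
      unfolding u_def using M by (subst add_mult_distrib_mat[of _ n n]) auto
    moreover have "M * u = M + M * ?E"
      unfolding u_def using M by (subst mult_add_distrib_mat[of _ n n]) auto
    ultimately have eq: "(M + ?E * M) $$ (i, j) = (M + M * ?E) $$ (i, j)" for i j
      by simp
    have car: "?E * M \<in> carrier_mat n n" "M * ?E \<in> carrier_mat n n"
      using M by (auto intro: mult_carrier_mat munit_carrier)
    have "(?E * M) $$ (i, j) = (M * ?E) $$ (i, j)" if "i < n" "j < n" for i j
      using eq[of i j] that carrier_matD[OF car(1)] carrier_matD[OF car(2)]
      by (simp del: index_mult_mat)
    \<comment> \<open>the two entries of row \<open>a\<close> see the off-diagonal entry \<open>(b, a)\<close> and the difference of two diagonal entries\<close>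
    from this[of a a] this[of a b] ab show ?thesis
      by (simp only: munit_mult_index[OF M] mult_munit_index[OF M]) simp
  qed
  show ?thesis
  proof (rule eq_matI)
    fix i j assume "i < dim_row (scalar n (M $$ (0, 0)))" "j < dim_col (scalar n (M $$ (0, 0)))"
    hence "i < n" "j < n" by (simp_all add: scalar_def)
    thus "M $$ (i, j) = scalar n (M $$ (0, 0)) $$ (i, j)"
      using entries[of j i] entries[of 0 i] n by (cases "i = 0") auto
  qed (use M in \<open>auto simp: scalar_def\<close>)
qed

text \<open>
  Conjugation preserves the discriminant, so a general point and its conjugate by \<open>u\<close> lie in one
  \<open>SL\<close>-orbit.  The value at the conjugate point is therefore the value at the point and also its
  conjugate by \<open>u\<close>.
\<close>

lemma invariant_is_scalar:
  fixes Y :: "'k::field_char_0 ratfun mat"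
  assumes Y: "fraction_rep m n Y R q" and inv: "\<And>g. g \<in> SL m \<Longrightarrow> act g Y = Y"
    and m: "n\<^sup>2 \<le> m" and n: "0 < n"
  shows "Y = scalar n (Fract (R $$ (0, 0)) q)"
proof -
  note q = fraction_repD(1)[OF Y] and R = fraction_repD(2)[OF Y] and Yeq = fraction_repD(3)[OF Y]
  have generic: "peval_mat \<xi> R = scalar n (peval \<xi> (R $$ (0, 0)))"
    if nz: "peval \<xi> (q * Delta_poly n) \<noteq> 0" for \<xi>
  proof -
    from nz have q\<xi>: "peval \<xi> q \<noteq> 0" and d\<xi>: "delta n \<xi> \<noteq> 0"
      by (auto simp: peval.hom_mult peval_Delta_poly)
    have "u * peval_mat \<xi> R * v = peval_mat \<xi> R" if uv: "inverse_pair n u v" for u v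
    proof -
      \<comment> \<open>the conjugate point has the same discriminant and the same value of \<open>q\<close>\<close>
      define \<xi>' where "\<xi>' = conj_point n u v \<xi>"
      have R': "peval_mat \<xi>' R = u * peval_mat \<xi> R * v" and q': "peval \<xi>' q = peval \<xi> q"
        unfolding \<xi>'_def by (rule fraction_repD(7)[OF Y uv q\<xi>], rule fraction_repD(6)[OF Y uv])
      have "delta n \<xi>' = discriminant n (\<lambda>r. u * point_mat n \<xi> r * v)"
        by (rule discriminant_cong) (use uv in \<open>simp add: \<xi>'_def point_mat_conj inverse_pair_def\<close>)
      also have "\<dots> = delta n \<xi>"
        by (rule discriminant_conjugate) (use uv in \<open>auto simp: inverse_pair_def\<close>)
      finally have d': "delta n \<xi>' = delta n \<xi>" .
      with d\<xi> obtain g where g: "g \<in> SL m" "agree m n (act_point g \<xi>) \<xi>'"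
        using point_transport[OF m, of \<xi> \<xi>'] by metis
      have "peval_mat \<xi>' R = peval_mat \<xi> R"
      proof (rule eq_matI)
        fix i j assume "i < dim_row (peval_mat \<xi> R)" "j < dim_col (peval_mat \<xi> R)"
        hence ij: "i < n" "j < n" using R by auto
        from invariant_fraction_rep[OF Y _ inv[OF g(1)] g(2) ij] g(1) SL_subset_GL
        have "peval \<xi>' (R $$ (i, j)) * peval \<xi> q = peval \<xi> (R $$ (i, j)) * peval \<xi>' q" by blast
        thus "peval_mat \<xi>' R $$ (i, j) = peval_mat \<xi> R $$ (i, j)"
          using ij R q\<xi> by (simp add: q')
      qed simp_all
      thus ?thesis by (simp only: R')
    qed
    moreover have "peval_mat \<xi> R $$ (0, 0) = peval \<xi> (R $$ (0, 0))" using R n by simp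
    moreover have "peval_mat \<xi> R \<in> carrier_mat n n" using R by simp
    ultimately show ?thesis using commutes_imp_scalar[OF _ n] by metis
  qed
  have nz: "q * Delta_poly n \<noteq> 0" using q Delta_poly_nonzero by simp
  have entry: "R $$ (i, j) = (if i = j then R $$ (0, 0) else 0)" if ij: "i < n" "j < n" for i j
  proof (rule mpoly_eqI_generic[OF nz])
    fix \<xi> :: "'k point" assume "peval \<xi> (q * Delta_poly n) \<noteq> 0"
    from arg_cong[OF generic[OF this], of "\<lambda>M. M $$ (i, j)"] ij R
    show "peval \<xi> (R $$ (i, j)) = peval \<xi> (if i = j then R $$ (0, 0) else 0)" by simp
  qed
  have zero: "Fract 0 q = 0" using q by (simp add: Zero_fract_def eq_fract)
  show ?thesis
  proof (rule eq_matI)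
    fix i j assume "i < dim_row (scalar n (Fract (R $$ (0, 0)) q))" "j < dim_col (scalar n (Fract (R $$ (0, 0)) q))"
    hence "i < n" "j < n" by (simp_all add: scalar_def)
    thus "Y $$ (i, j) = scalar n (Fract (R $$ (0, 0)) q) $$ (i, j)"
      using zero entry[of i j] by (simp add: Yeq)
  qed (simp_all add: Yeq scalar_def)
qed

lemma poly_along_line:
  fixes L :: "nat \<times> nat \<times> nat \<Rightarrow> 'k::field poly"
  obtains P where "\<And>t. poly P t = peval (\<lambda>v. poly (L v) t) p"
proof
  fix t
  show "poly (\<Sum>m \<in> Poly_Mapping.keys p. Polynomial.smult (Poly_Mapping.lookup p m)
      (\<Prod>v \<in> Poly_Mapping.keys m. L v ^ Poly_Mapping.lookup m v)) t = peval (\<lambda>v. poly (L v) t) p"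
    by (simp add: peval_def poly_sum poly_prod)
qed

lemma peval_poly_const: "peval \<xi> (poly (map_poly const P) a) = poly P (peval \<xi> a)"
  by (induction P) (simp_all add: map_poly_pCons peval.hom_add peval.hom_mult)

text \<open>
  Scaling the first matrix of a general point \<open>\<xi>0\<close> gives a line on which \<open>t\<close> is the value of the
  discriminant.  The polynomials \<open>P\<close> and \<open>Q\<close> are the restrictions of \<open>p\<close> and \<open>q\<close> to this line, and every
  point with nonzero discriminant can be compared with the point of the line that has the same
  discriminant.  At \<open>\<xi>0\<close> itself the denominator does not vanish.
\<close>

lemma invariant_factors_through_Delta:
  fixes p q :: "'k::field_char_0 mpoly"
  assumes q: "q \<noteq> 0" and n: "0 < n"
    and rel: "\<And>\<xi> \<xi>'. delta n \<xi> \<noteq> 0 \<Longrightarrow> delta n \<xi> = delta n \<xi>' \<Longrightarrow>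
      peval \<xi>' p * peval \<xi> q = peval \<xi> p * peval \<xi>' q"
  obtains P Q :: "'k poly" where "p * poly (map_poly const Q) (Delta_poly n) = q * poly (map_poly const P) (Delta_poly n)"
    "poly (map_poly const Q) (Delta_poly n) \<noteq> 0" "q = 1 \<Longrightarrow> Q = 1"
proof -
  obtain \<xi>0 where "peval \<xi>0 (q * Delta_poly n) \<noteq> 0"
    using nonzero_point[of "q * Delta_poly n"] q Delta_poly_nonzero by (metis mult_eq_0_iff)
  hence q0: "peval \<xi>0 q \<noteq> 0" and d0: "delta n \<xi>0 \<noteq> 0"
    by (auto simp: peval.hom_mult peval_Delta_poly)
  \<comment> \<open>the first matrix is scaled by \<open>t / delta n \<xi>0\<close>, hence the discriminant becomes \<open>t\<close>\<close>
  define L where "L = (\<lambda>(h, i, j). if h = 0 then [:0, \<xi>0 (0, i, j) / delta n \<xi>0:] else [:\<xi>0 (h, i, j):])"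
  define line where "line t = (\<lambda>v. poly (L v) t)" for t
  have delta_line: "delta n (line t) = t" for t
  proof -
    have "coords n (point_mat n (line t)) = multrow 0 (t / delta n \<xi>0) (coords n (point_mat n \<xi>0))"
      by (rule eq_matI) (auto simp: coords_def point_mat_def line_def L_def square_div_less square_mod_less)
    thus ?thesis
      using det_multrow[of 0 "n\<^sup>2" "coords n (point_mat n \<xi>0)" "t / delta n \<xi>0"] n d0
      by (simp add: discriminant_coords)
  qed
  obtain P where P: "\<And>t. poly P t = peval (line t) p" using poly_along_line[of L p] unfolding line_def by blast
  obtain Q where Q: "\<And>t. poly Q t = peval (line t) q" using poly_along_line[of L q] unfolding line_def by blast
  have "p * poly (map_poly const Q) (Delta_poly n) = q * poly (map_poly const P) (Delta_poly n)"
  proof (rule mpoly_eqI_generic[OF Delta_poly_nonzero[of n]])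
    fix \<xi> :: "'k point" assume "peval \<xi> (Delta_poly n) \<noteq> 0"
    hence "delta n (line (delta n \<xi>)) \<noteq> 0" by (simp add: delta_line peval_Delta_poly)
    from rel[OF this, of \<xi>]
    show "peval \<xi> (p * poly (map_poly const Q) (Delta_poly n)) = peval \<xi> (q * poly (map_poly const P) (Delta_poly n))"
      by (simp add: peval.hom_mult peval_poly_const peval_Delta_poly P Q delta_line mult_ac)
  qed
  moreover have "poly (map_poly const Q) (Delta_poly n) \<noteq> 0"
  proof
    have line0: "line (delta n \<xi>0) = \<xi>0"
      using d0 by (auto simp: fun_eq_iff line_def L_def)
    assume "poly (map_poly const Q) (Delta_poly n) = 0"
    hence "peval \<xi>0 (poly (map_poly const Q) (Delta_poly n)) = 0" by simp
    hence "peval \<xi>0 q = 0" by (simp add: peval_poly_const peval_Delta_poly Q line0)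
    with q0 show False ..
  qed
  moreover have "Q = 1" if "q = 1"
  proof -
    have "poly Q = poly 1" by (simp add: fun_eq_iff Q that)
    thus ?thesis by (simp add: poly_eq_poly_eq_iff)
  qed
  ultimately show ?thesis by (rule that)
qed

lemma poly_Delta_in_poly_in: "scalar n (emb (poly (map_poly const P) (Delta_poly n))) \<in> poly_in n (Delta n)"
proof -
  let ?S = "base_field n \<union> {scalar n (Delta n)} :: 'k::field ratfun mat set"
  have "scalar n (emb (poly (map_poly const P) (Delta_poly n))) \<in> subring_gen n ?S"
  proof (induction P)
    case 0
    have "scalar n (emb (const 0)) \<in> subring_gen n ?S"
      by (rule subring_gen_incl) (unfold base_field_def, blast)
    thus ?case by simp
  next
    case (pCons a P)
    have "scalar n (emb (const a)) \<in> subring_gen n ?S"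
      by (rule subring_gen_incl) (unfold base_field_def, blast)
    moreover have "scalar n (Delta n) \<in> subring_gen n ?S"
      by (rule subring_gen_incl) simp
    ultimately have "scalar n (emb (const a)) + scalar n (Delta n) *
        scalar n (emb (poly (map_poly const P) (Delta_poly n))) \<in> subring_gen n ?S"
      using pCons.IH by (intro subring_gen_add subring_gen_mult)
    thus ?case
      by (simp add: map_poly_pCons emb.hom_add emb.hom_mult scalar_add scalar_mult Delta_eq)
  qed
  thus ?thesis by (simp add: poly_in_def subalg_gen_def)
qed

lemma m_inv_class_ring: "x \<noteq> 0 \<Longrightarrow> m_inv class_ring x = inverse (x :: 'a::field)"
  by (rule class_cring.comm_inv_char) simp_all

lemma poly_Delta_in_generate_field:
  "emb (poly (map_poly const P) (Delta_poly n)) \<in>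
     generate_field class_ring (range (\<lambda>c. emb (const c)) \<union> {Delta n})" (is "_ \<in> ?F")
proof (induction P)
  case 0
  have "emb (const 0) \<in> ?F" by (rule generate_field.incl) blast
  thus ?case by simp
next
  case (pCons a P)
  have "emb (const a) \<in> ?F" by (rule generate_field.incl) blast
  moreover have "Delta n \<in> ?F" by (rule generate_field.incl) simp
  ultimately have "add class_ring (emb (const a))
      (mult class_ring (Delta n) (emb (poly (map_poly const P) (Delta_poly n)))) \<in> ?F"
    using pCons.IH by (intro generate_field.eng_add generate_field.eng_mult)
  thus ?case by (simp add: map_poly_pCons emb.hom_add emb.hom_mult Delta_eq)
qed

lemma Fract_eq_divide: "q \<noteq> 0 \<Longrightarrow> Fract p q = emb p * inverse (emb q)"
  by (simp add: emb_def)

lemma scalar_fraction_in_UD: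
  assumes "scalar n (emb a) \<in> trace_ring m n" "scalar n (emb b) \<in> trace_ring m n" "b \<noteq> 0" "0 < n"
  shows "scalar n (Fract a b) \<in> UD m n"
proof -
  have "scalar n (Fract a b) = scalar n (emb a) * scalar n (inverse (emb b))"
    using assms(3) by (simp add: Fract_eq_divide scalar_mult)
  moreover have "scalar n (emb b) * scalar n (inverse (emb b)) = 1\<^sub>m n"
    "scalar n (inverse (emb b)) * scalar n (emb b) = 1\<^sub>m n"
    using assms(3) by (simp_all add: scalar_mult[symmetric] scalar_one)
  moreover have "scalar n (inverse (emb b)) \<in> carrier_mat n n"
    by simp
  moreover have "scalar n (emb b) \<noteq> 0\<^sub>m n n"
  proof
    assume "scalar n (emb b) = 0\<^sub>m n n"
    from arg_cong[OF this, of "\<lambda>M. M $$ (0, 0)"] assms(3,4) show False by simp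
  qed
  ultimately show ?thesis
    using assms(1,2) unfolding UD_def by blast
qed

lemma base_field_invariant:
  assumes "g \<in> GL m" "Y \<in> base_field n" shows "act g Y = Y"
proof -
  from assms(2) obtain c where "Y = scalar n (Fract (const c) 1)"
    by (auto simp: base_field_def emb_def)
  moreover have "subst (lin_subst g) 1 = 1" using subst_const[of "lin_subst g" 1] by simp
  ultimately show ?thesis using act_scalar[OF assms(1), of 1 n "const c"] by (simp add: subst_const)
qed

lemma base_field_subset_UD: "0 < n \<Longrightarrow> base_field n \<subseteq> UD m n"
proof
  fix Y :: "'k::field ratfun mat" assume n: "0 < n" and "Y \<in> base_field n"
  then obtain c where "Y = scalar n (Fract (const c) 1)"
    by (auto simp: base_field_def emb_def)
  thus "Y \<in> UD m n"
    using scalar_fraction_in_UD[of n "const c" m 1] n const_trace_ring[of n c m] const_trace_ring[of n 1 m]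
    by simp
qed

text \<open>
  If \<open>H\<close> has a single orbit on the points with nonzero discriminant, comparison with one of them shows
  that the scalar \<open>p / q\<close> is constant.
\<close>

lemma invariants_eq_base_field:
  fixes H :: "'k::field_char_0 mat set"
  assumes H: "SL m \<subseteq> H" "H \<subseteq> GL m" and m: "n\<^sup>2 \<le> m" and n: "0 < n"
    and trans: "\<And>\<xi> \<xi>'. delta n \<xi> \<noteq> 0 \<Longrightarrow> delta n \<xi>' \<noteq> 0 \<Longrightarrow> \<exists>g \<in> H. agree m n (act_point g \<xi>) \<xi>'"
  shows "invariants H (UD m n) = base_field n"
proof
  show "base_field n \<subseteq> invariants H (UD m n)"
    using base_field_subset_UD[OF n] base_field_invariant H(2) unfolding invariants_def by blast
next
  show "invariants H (UD m n) \<subseteq> base_field n"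
  proof
    fix Y :: "'k ratfun mat" assume "Y \<in> invariants H (UD m n)"
    hence YU: "Y \<in> UD m n" and inv: "\<And>g. g \<in> H \<Longrightarrow> act g Y = Y" by (auto simp: invariants_def)
    obtain R q where Y: "fraction_rep m n Y R q" using UD_fraction_rep[OF YU] .
    have q: "q \<noteq> 0" by (rule fraction_repD(1)[OF Y])
    define p where "p = R $$ (0, 0)"
    have Ys: "Y = scalar n (Fract p q)"
      unfolding p_def using invariant_is_scalar[OF Y _ m n] inv H(1) by blast
    obtain \<xi>0 where "peval \<xi>0 (q * Delta_poly n) \<noteq> 0"
      using nonzero_point[of "q * Delta_poly n"] q Delta_poly_nonzero by (metis mult_eq_0_iff)
    hence q0: "peval \<xi>0 q \<noteq> 0" and d0: "delta n \<xi>0 \<noteq> 0"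
      by (auto simp: peval.hom_mult peval_Delta_poly)
    define c where "c = peval \<xi>0 p / peval \<xi>0 q"
    have "p = const c * q"
    proof (rule mpoly_eqI_generic[OF Delta_poly_nonzero[of n]])
      fix \<xi> :: "'k point" assume "peval \<xi> (Delta_poly n) \<noteq> 0"
      then obtain g where "g \<in> H" "agree m n (act_point g \<xi>0) \<xi>"
        using trans[OF d0, of \<xi>] by (auto simp: peval_Delta_poly)
      from invariant_fraction_rep[OF Y _ inv[OF this(1)] this(2) n n] this(1) H(2)
      have "peval \<xi> p * peval \<xi>0 q = peval \<xi>0 p * peval \<xi> q" unfolding p_def by blast
      thus "peval \<xi> p = peval \<xi> (const c * q)"
        using q0 by (simp add: peval.hom_mult c_def field_simps)
    qed
    hence "Fract p q = emb (const c)"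
      using q by (simp add: emb_def eq_fract)
    thus "Y \<in> base_field n" by (simp add: Ys base_field_def)
  qed
qed

text \<open>
  By \<open>point_transport\<close> the values of the scalar \<open>p / q\<close> depend on the discriminant of the point only.
\<close>

lemma SL_invariant_fraction:
  fixes Y :: "'k::field_char_0 ratfun mat"
  assumes Y: "fraction_rep (n\<^sup>2) n Y R q" and inv: "\<And>g. g \<in> SL (n\<^sup>2) \<Longrightarrow> act g Y = Y" and n: "0 < n"
  obtains P Q :: "'k poly" where
    "Y = scalar n (Fract (poly (map_poly const P) (Delta_poly n)) (poly (map_poly const Q) (Delta_poly n)))"
    "poly (map_poly const Q) (Delta_poly n) \<noteq> 0" "q = 1 \<Longrightarrow> Q = 1"
proof -
  have q: "q \<noteq> 0" by (rule fraction_repD(1)[OF Y])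
  define p where "p = R $$ (0, 0)"
  have Ys: "Y = scalar n (Fract p q)"
    unfolding p_def using invariant_is_scalar[OF Y inv _ n] by simp
  have "peval \<xi>' p * peval \<xi> q = peval \<xi> p * peval \<xi>' q"
    if d: "delta n \<xi> \<noteq> 0" "delta n \<xi> = delta n \<xi>'" for \<xi> \<xi>'
  proof -
    obtain g where "g \<in> SL (n\<^sup>2)" "agree (n\<^sup>2) n (act_point g \<xi>) \<xi>'"
      using point_transport[of n "n\<^sup>2" \<xi> \<xi>'] d by (metis order_refl)
    from invariant_fraction_rep[OF Y _ inv[OF this(1)] this(2) n n] this(1) SL_subset_GL
    show ?thesis unfolding p_def by blast
  qed
  from invariant_factors_through_Delta[OF q n this] obtain P Q :: "'k poly" where
    PQ: "p * poly (map_poly const Q) (Delta_poly n) = q * poly (map_poly const P) (Delta_poly n)"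
    "poly (map_poly const Q) (Delta_poly n) \<noteq> 0" "q = 1 \<Longrightarrow> Q = 1" by blast
  have "Fract p q = Fract (poly (map_poly const P) (Delta_poly n)) (poly (map_poly const Q) (Delta_poly n))"
    using q PQ(1,2) by (simp add: eq_fract mult.commute)
  with PQ show ?thesis by (intro that[of P Q]) (simp_all add: Ys)
qed

text \<open>
  The numerators and denominators from which the elements of \<open>k(\<Delta>)\<close> are formed; they are a ring that
  contains the constants and \<open>\<Delta>\<close>.
\<close>

definition invariant_numerator :: "nat \<Rightarrow> 'k::field mpoly \<Rightarrow> bool" where
  "invariant_numerator n a \<longleftrightarrow> scalar n (emb a) \<in> trace_ring (n\<^sup>2) n \<and>
     (\<forall>g \<in> SL (n\<^sup>2). subst (lin_subst g) a = a)"

lemma invariant_numerator_const: "invariant_numerator n (const c)"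
  by (simp add: invariant_numerator_def const_trace_ring subst_const)

lemma invariant_numerator_one: "invariant_numerator n 1"
  using invariant_numerator_const[of n 1] by simp

lemma invariant_numerator_Delta: "invariant_numerator n (Delta_poly n :: 'k::field_char_0 mpoly)"
  using Delta_in_trace_ring[of n] by (simp add: invariant_numerator_def subst_Delta_poly Delta_eq)

lemma invariant_numerator_add:
  "invariant_numerator n a \<Longrightarrow> invariant_numerator n b \<Longrightarrow> invariant_numerator n (a + b)"
  by (simp add: invariant_numerator_def emb_add scalar_add trace_ring_add subst_add)

lemma invariant_numerator_mult:
  "invariant_numerator n a \<Longrightarrow> invariant_numerator n b \<Longrightarrow> invariant_numerator n (a * b)"
  by (simp add: invariant_numerator_def emb_mult scalar_mult trace_ring_mult subst_mult)

lemma invariant_numerator_uminus: "invariant_numerator n a \<Longrightarrow> invariant_numerator n (- a)"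
  using invariant_numerator_mult[of n "const (- 1)" a] invariant_numerator_const[of n "- 1"]
  by (simp add: const.hom_uminus)

lemma scalar_in_poly_in:
  fixes Y :: "'k::field_char_0 ratfun mat"
  assumes "Y \<in> poly_in n (Delta n)"
  obtains a where "Y = scalar n (emb a)" "invariant_numerator n a"
proof -
  let ?S = "base_field n \<union> {scalar n (Delta n)} :: 'k ratfun mat set"
  have S: "?S \<subseteq> carrier_mat n n" using base_field_carrier by auto
  have "Y \<in> subring_gen n ?S" using assms by (simp add: poly_in_def subalg_gen_def)
  with S have "\<exists>a. Y = scalar n (emb a) \<and> invariant_numerator n a"
  proof (induction rule: subring_gen_induct)
    case one
    show ?case by (intro exI[of _ 1]) (simp add: scalar_one invariant_numerator_one)
  next
    case (incl A)
    thus ?case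
      using invariant_numerator_const invariant_numerator_Delta
      by (auto simp: base_field_def Delta_eq)
  next
    case (uminus A)
    thus ?case by (metis emb.hom_uminus scalar_uminus invariant_numerator_uminus)
  next
    case (add A B)
    thus ?case by (metis emb_add scalar_add invariant_numerator_add)
  next
    case (mult A B)
    thus ?case by (metis emb_mult scalar_mult invariant_numerator_mult)
  qed
  thus ?thesis using that by blast
qed

text \<open>
  Fractions of invariants are closed under the field operations and contain the generators.
\<close>

lemma generate_field_fraction:
  fixes x :: "'k::field_char_0 ratfun"
  assumes "x \<in> generate_field class_ring (range (\<lambda>c. emb (const c)) \<union> {Delta n})"
  obtains a b where "x = Fract a b" "b \<noteq> 0" "invariant_numerator n a" "invariant_numerator n b"
proof -
  have "\<exists>a b. x = Fract a b \<and> b \<noteq> 0 \<and> invariant_numerator n a \<and> invariant_numerator n b"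
    using assms
  proof (induction rule: generate_field.induct)
    case one
    show ?case
      by (intro exI[of _ 1]) (simp add: One_fract_def invariant_numerator_one)
  next
    case (incl h)
    then obtain a where "h = Fract a 1" "invariant_numerator n a"
      using invariant_numerator_const invariant_numerator_Delta by (auto simp: Delta_eq emb_def)
    thus ?case using invariant_numerator_one[of n] by (metis one_neq_zero)
  next
    case (a_inv h)
    then obtain a b where "h = Fract a b" "b \<noteq> 0" "invariant_numerator n a" "invariant_numerator n b" by blast
    thus ?case
      by (intro exI[of _ "- a"] exI[of _ b]) (simp add: class_ring_simps invariant_numerator_uminus)
  next
    case (m_inv h)
    then obtain a b where h: "h = Fract a b" "b \<noteq> 0" "invariant_numerator n a" "invariant_numerator n b" by blast
    from m_inv.hyps have "h \<noteq> 0" by simp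
    hence "a \<noteq> 0" using h by (auto simp: Zero_fract_def eq_fract)
    with h \<open>h \<noteq> 0\<close> show ?case
      by (intro exI[of _ b] exI[of _ a]) (simp add: m_inv_class_ring)
  next
    case (eng_add h1 h2)
    then obtain a b c d where "h1 = Fract a b" "b \<noteq> 0" "invariant_numerator n a" "invariant_numerator n b"
      "h2 = Fract c d" "d \<noteq> 0" "invariant_numerator n c" "invariant_numerator n d" by blast
    thus ?case
      by (intro exI[of _ "a * d + c * b"] exI[of _ "b * d"])
         (simp add: invariant_numerator_add invariant_numerator_mult)
  next
    case (eng_mult h1 h2)
    then obtain a b c d where "h1 = Fract a b" "b \<noteq> 0" "invariant_numerator n a" "invariant_numerator n b"
      "h2 = Fract c d" "d \<noteq> 0" "invariant_numerator n c" "invariant_numerator n d" by blast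
    thus ?case
      by (intro exI[of _ "a * c"] exI[of _ "b * d"])
         (simp add: invariant_numerator_mult)
  qed
  thus ?thesis using that by blast
qed

lemma SL_invariants_trace_ring:
  assumes n: "0 < n"
  shows "invariants (SL (n\<^sup>2)) (trace_ring (n\<^sup>2) n :: 'k::field_char_0 ratfun mat set) = poly_in n (Delta n)"
proof
  show "invariants (SL (n\<^sup>2)) (trace_ring (n\<^sup>2) n :: 'k ratfun mat set) \<subseteq> poly_in n (Delta n)"
  proof
    fix Y :: "'k ratfun mat" assume "Y \<in> invariants (SL (n\<^sup>2)) (trace_ring (n\<^sup>2) n)"
    hence Y: "Y \<in> trace_ring (n\<^sup>2) n" and inv: "\<And>g. g \<in> SL (n\<^sup>2) \<Longrightarrow> act g Y = Y"
      by (auto simp: invariants_def)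
    obtain R where "fraction_rep (n\<^sup>2) n Y R 1" using trace_ring_fraction_rep[OF Y] .
    from SL_invariant_fraction[OF this inv n] obtain P Q :: "'k poly" where
      "Y = scalar n (Fract (poly (map_poly const P) (Delta_poly n)) (poly (map_poly const Q) (Delta_poly n)))"
      "Q = 1" by metis
    hence "Y = scalar n (emb (poly (map_poly const P) (Delta_poly n)))"
      by (simp add: emb_def map_poly_1)
    thus "Y \<in> poly_in n (Delta n)" by (simp only: poly_Delta_in_poly_in)
  qed
next
  show "poly_in n (Delta n) \<subseteq> invariants (SL (n\<^sup>2)) (trace_ring (n\<^sup>2) n :: 'k ratfun mat set)"
  proof
    fix Y :: "'k ratfun mat" assume "Y \<in> poly_in n (Delta n)"
    then obtain a where a: "Y = scalar n (emb a)" "invariant_numerator n a" by (rule scalar_in_poly_in)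
    have "act g Y = Y" if g: "g \<in> SL (n\<^sup>2)" for g
    proof -
      have "g \<in> GL (n\<^sup>2)" using g SL_subset_GL by blast
      from act_scalar[OF this, of 1 n a] a g show ?thesis
        by (simp add: emb_def invariant_numerator_def)
           (metis invariant_numerator_def invariant_numerator_one)
    qed
    thus "Y \<in> invariants (SL (n\<^sup>2)) (trace_ring (n\<^sup>2) n)"
      using a by (simp add: invariants_def invariant_numerator_def)
  qed
qed

lemma SL_invariants_UD:
  assumes n: "0 < n"
  shows "invariants (SL (n\<^sup>2)) (UD (n\<^sup>2) n :: 'k::field_char_0 ratfun mat set) = ratfun_in n (Delta n)"
proof
  let ?F = "generate_field class_ring (range (\<lambda>c. emb (const c)) \<union> {Delta n}) :: 'k ratfun set"
  show "invariants (SL (n\<^sup>2)) (UD (n\<^sup>2) n :: 'k ratfun mat set) \<subseteq> ratfun_in n (Delta n)"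
  proof
    fix Y :: "'k ratfun mat" assume "Y \<in> invariants (SL (n\<^sup>2)) (UD (n\<^sup>2) n)"
    hence Y: "Y \<in> UD (n\<^sup>2) n" and inv: "\<And>g. g \<in> SL (n\<^sup>2) \<Longrightarrow> act g Y = Y"
      by (auto simp: invariants_def)
    obtain R q where "fraction_rep (n\<^sup>2) n Y R q" using UD_fraction_rep[OF Y] .
    from SL_invariant_fraction[OF this inv n] obtain P Q :: "'k poly" where
      PQ: "Y = scalar n (Fract (poly (map_poly const P) (Delta_poly n)) (poly (map_poly const Q) (Delta_poly n)))"
      "poly (map_poly const Q) (Delta_poly n) \<noteq> 0" by metis
    let ?p = "emb (poly (map_poly const P) (Delta_poly n))" and ?q = "emb (poly (map_poly const Q) (Delta_poly n))"
    have "mult class_ring ?p (m_inv class_ring ?q) \<in> ?F"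
      using PQ(2) by (intro generate_field.eng_mult generate_field.m_inv poly_Delta_in_generate_field) simp
    hence "?p * inverse ?q \<in> ?F"
      using PQ(2) by (simp add: m_inv_class_ring)
    thus "Y \<in> ratfun_in n (Delta n)"
      using PQ by (simp add: ratfun_in_def Fract_eq_divide)
  qed
  show "ratfun_in n (Delta n) \<subseteq> invariants (SL (n\<^sup>2)) (UD (n\<^sup>2) n :: 'k ratfun mat set)"
  proof
    fix Y :: "'k ratfun mat" assume "Y \<in> ratfun_in n (Delta n)"
    then obtain x where x: "Y = scalar n x" "x \<in> ?F" by (auto simp: ratfun_in_def)
    obtain a b where ab: "x = Fract a b" "b \<noteq> 0" "invariant_numerator n a" "invariant_numerator n b"
      using generate_field_fraction[OF x(2)] .
    have "act g Y = Y" if g: "g \<in> SL (n\<^sup>2)" for g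
    proof -
      have "g \<in> GL (n\<^sup>2)" using g SL_subset_GL by blast
      from act_scalar[OF this ab(2), of n a] ab g x show ?thesis
        by (simp add: invariant_numerator_def)
    qed
    moreover have "Y \<in> UD (n\<^sup>2) n"
      using scalar_fraction_in_UD[OF _ _ ab(2) n, of a "n\<^sup>2"] ab x by (simp add: invariant_numerator_def)
    ultimately show "Y \<in> invariants (SL (n\<^sup>2)) (UD (n\<^sup>2) n)"
      by (simp add: invariants_def)
  qed
qed

theorem proposition8p1:
  fixes m n :: nat
  assumes "m \<ge> 2" and "n \<ge> 2"
  shows
    "(m > n\<^sup>2 \<longrightarrow>
        invariants (SL m) (UD m n :: 'k::field_char_0 ratfun mat set) = base_field n \<and>
        invariants (GL m) (UD m n :: 'k ratfun mat set) = base_field n) \<and>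
     (m = n\<^sup>2 \<longrightarrow>
        invariants (GL m) (UD m n :: 'k ratfun mat set) = base_field n \<and>
        invariants (SL m) (trace_ring m n :: 'k ratfun mat set) = poly_in n (Delta n) \<and>
        invariants (SL m) (UD m n :: 'k ratfun mat set) = ratfun_in n (Delta n))"
proof (intro conjI impI)
  have n: "0 < n" using assms(2) by simp
  have GL: "invariants (GL m) (UD m n :: 'k ratfun mat set) = base_field n" if "n\<^sup>2 \<le> m"
  proof (rule invariants_eq_base_field[OF SL_subset_GL order_refl that n])
    fix \<xi> \<xi>' :: "'k point" assume "delta n \<xi> \<noteq> 0" "delta n \<xi>' \<noteq> 0"
    thus "\<exists>g \<in> GL m. agree m n (act_point g \<xi>) \<xi>'" using point_transport[OF that] by metis
  qed
  show "invariants (GL m) (UD m n :: 'k ratfun mat set) = base_field n" if "m > n\<^sup>2" using GL that by simp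
  show "invariants (GL m) (UD m n :: 'k ratfun mat set) = base_field n" if "m = n\<^sup>2" using GL that by simp
  show "invariants (SL m) (UD m n :: 'k ratfun mat set) = base_field n" if m: "m > n\<^sup>2"
  proof (rule invariants_eq_base_field[OF order_refl SL_subset_GL less_imp_le[OF m] n])
    fix \<xi> \<xi>' :: "'k point" assume "delta n \<xi> \<noteq> 0" "delta n \<xi>' \<noteq> 0"
    thus "\<exists>g \<in> SL m. agree m n (act_point g \<xi>) \<xi>'"
      using point_transport[OF less_imp_le[OF m]] m by metis
  qed
  show "invariants (SL m) (trace_ring m n :: 'k ratfun mat set) = poly_in n (Delta n)" if "m = n\<^sup>2"
    unfolding that by (rule SL_invariants_trace_ring[OF n])
  show "invariants (SL m) (UD m n :: 'k ratfun mat set) = ratfun_in n (Delta n)" if "m = n\<^sup>2"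
    unfolding that by (rule SL_invariants_UD[OF n])
qed

end
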